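(* Let $D=(0,1)$. For every $\omega\in[0,2.03]$ the problem $$ \begin{cases} u_1''+\omega^2 u_1=-u_2\overline{u}_1 & \text{in } (0,1),\\ u_2''+4\omega^2 u_2=-u_1^2 & \text{in } (0,1),\\ u_2=u_2'=0 & \text{at } \{0,1\}, \end{cases} $$ admits a nontrivial solution $\boldsymbol{u}=\boldsymbol{u}(\omega)=(u_1,u_2)$ such that: (1) $\boldsymbol{u}$ depends smoothly on $\omega$, i.e. $\omega\mapsto\boldsymbol{u}(\omega)\in H^2(D)\times L^2(D)$ is $C^\infty$ on $[0,2.03]$; (2) the norm $\|\boldsymbol{u}(\omega)\|_{H^2(D)\times L^2(D)}$ stays uniformly bounded away from zero, i.e. there is $c>0$ with $\|\boldsymbol{u}(\omega)\|_{H^2(D)\times L^2(D)}\ge c$ for all $\omega\in[0,2.03]$; (3) for $j=1,2$ and every $\omega\in[0,2.03]$, $\operatorname{Re}u_j$ is even and $\operatorname{Im}u_j$ is odd with respect to the midpoint $x=\tfrac12$, that is, $u_j(\tfrac12+x)=\overline{u_j(\tfrac12-x)}$ for all $x\in(-\tfrac12,\tfrac12)$.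
   Context: The unknowns $u_1,u_2$ are complex-valued functions on $(0,1)$; the bar denotes complex conjugation. Nontrivial means $(u_1,u_2)\neq(0,0)$. No boundary conditions are imposed on $u_1$. $H^2(D)$ is the Sobolev space of order 2, and $H^2(D)\times L^2(D)$ carries a standard product norm (with $u_1$ measured in $H^2(D)$ and $u_2$ in $L^2(D)$). *)

theory Defs
  imports "HOL-Analysis.Analysis"
begin

text \<open>Real-valued test functions, \<open>C\<^sub>c\<^sup>\<infinity>(S)\<close>. Testing with real functions suffices for
  complex-valued weak derivatives, by linearity.\<close>

definition test_functions :: "real set \<Rightarrow> (real \<Rightarrow> real) set" where
  "test_functions S =
     {\<phi>. (\<forall>n x. (deriv ^^ n) \<phi> differentiable (at x)) \<and>
         compact (closure {x. \<phi> x \<noteq> 0}) \<and> closure {x. \<phi> x \<noteq> 0} \<subseteq> S}"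

text \<open>Elements of Lebesgue and Sobolev spaces are represented by functions on all of
  \<open>real\<close>; only their values on \<open>S\<close> matter, and functions agreeing almost everywhere on \<open>S\<close>
  are not identified, so that the norms below are seminorms on the representatives.\<close>

definition L2_space :: "real set \<Rightarrow> (real \<Rightarrow> complex) set" where
  "L2_space S =
     {f. f \<in> borel_measurable (lebesgue_on S) \<and>
         integrable (lebesgue_on S) (\<lambda>x. (cmod (f x))\<^sup>2)}"

definition L2_norm :: "real set \<Rightarrow> (real \<Rightarrow> complex) \<Rightarrow> real" where
  "L2_norm S f = sqrt (\<integral>x. (cmod (f x))\<^sup>2 \<partial>lebesgue_on S)"

definition has_weak_deriv ::
  "real set \<Rightarrow> (real \<Rightarrow> complex) \<Rightarrow> (real \<Rightarrow> complex) \<Rightarrow> bool" where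
  "has_weak_deriv S f g \<longleftrightarrow>
     f \<in> L2_space S \<and> g \<in> L2_space S \<and>
     (\<forall>\<phi>\<in>test_functions S.
        (\<integral>x. deriv \<phi> x *\<^sub>R f x \<partial>lebesgue_on S) = - (\<integral>x. \<phi> x *\<^sub>R g x \<partial>lebesgue_on S))"

text \<open>A representative of the weak derivative, which is unique up to null sets
  when \<open>S\<close> is open.\<close>

definition weak_deriv :: "real set \<Rightarrow> (real \<Rightarrow> complex) \<Rightarrow> real \<Rightarrow> complex" where
  "weak_deriv S f = (SOME g. has_weak_deriv S f g)"

definition H2_space :: "real set \<Rightarrow> (real \<Rightarrow> complex) set" where
  "H2_space S = {f. \<exists>g h. has_weak_deriv S f g \<and> has_weak_deriv S g h}"

definition H2_norm :: "real set \<Rightarrow> (real \<Rightarrow> complex) \<Rightarrow> real" where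
  "H2_norm S f =
     sqrt ((L2_norm S f)\<^sup>2 + (L2_norm S (weak_deriv S f))\<^sup>2
           + (L2_norm S (weak_deriv S (weak_deriv S f)))\<^sup>2)"

definition H2_L2_norm :: "real set \<Rightarrow> (real \<Rightarrow> complex) \<Rightarrow> (real \<Rightarrow> complex) \<Rightarrow> real" where
  "H2_L2_norm S f g = sqrt ((H2_norm S f)\<^sup>2 + (L2_norm S g)\<^sup>2)"

text \<open>Infinite differentiability on \<open>I\<close> of the curve \<open>t \<mapsto> (v t, w t)\<close> into
  \<open>H\<^sup>2(S) \<times> L\<^sup>2(S)\<close>: \<open>(V k t, W k t)\<close> is its \<open>k\<close>-th derivative, the limit of difference
  quotients being taken in the norm of the product space, and one-sided at end points of
  an interval \<open>I\<close>. Each derivative is continuous because it is itself differentiable.\<close>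

definition smooth_H2_L2 ::
  "real set \<Rightarrow> real set \<Rightarrow> (real \<Rightarrow> real \<Rightarrow> complex) \<Rightarrow> (real \<Rightarrow> real \<Rightarrow> complex) \<Rightarrow> bool" where
  "smooth_H2_L2 S I v w \<longleftrightarrow>
     (\<exists>V W :: nat \<Rightarrow> real \<Rightarrow> real \<Rightarrow> complex.
        V 0 = v \<and> W 0 = w \<and>
        (\<forall>k. \<forall>t\<in>I. V k t \<in> H2_space S \<and> W k t \<in> L2_space S \<and>
           ((\<lambda>s. H2_L2_norm S
                  (\<lambda>x. (V k s x - V k t x) /\<^sub>R (s - t) - V (Suc k) t x)
                  (\<lambda>x. (W k s x - W k t x) /\<^sub>R (s - t) - W (Suc k) t x))
              \<longlongrightarrow> 0) (at t within I)))"

text \<open>Classical solutions: twice differentiable in \<open>(0,1)\<close> and continuously differentiable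
  up to the boundary, where the derivatives are one-sided. By the equations the second
  derivatives then extend continuously to \<open>[0,1]\<close>. Since \<open>H\<^sup>2(0,1)\<close> embeds into \<open>C\<^sup>1[0,1]\<close>,
  strong \<open>H\<^sup>2\<close> solutions are, up to the choice of representative, the same thing.\<close>

definition solves_system :: "real \<Rightarrow> (real \<Rightarrow> complex) \<Rightarrow> (real \<Rightarrow> complex) \<Rightarrow> bool" where
  "solves_system \<omega> u1 u2 \<longleftrightarrow>
     (\<exists>u1' u1'' u2' u2'' :: real \<Rightarrow> complex.
        (\<forall>x\<in>{0..1}. (u1 has_vector_derivative u1' x) (at x within {0..1})) \<and>
        (\<forall>x\<in>{0..1}. (u2 has_vector_derivative u2' x) (at x within {0..1})) \<and>
        continuous_on {0..1} u1' \<and> continuous_on {0..1} u2' \<and>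
        (\<forall>x\<in>{0<..<1}. (u1' has_vector_derivative u1'' x) (at x)) \<and>
        (\<forall>x\<in>{0<..<1}. (u2' has_vector_derivative u2'' x) (at x)) \<and>
        (\<forall>x\<in>{0<..<1}. u1'' x + (complex_of_real \<omega>)\<^sup>2 * u1 x = - (u2 x * cnj (u1 x))) \<and>
        (\<forall>x\<in>{0<..<1}. u2'' x + 4 * (complex_of_real \<omega>)\<^sup>2 * u2 x = - ((u1 x)\<^sup>2)) \<and>
        (\<forall>x\<in>{0, 1}. u2 x = 0 \<and> u2' x = 0))"

end

theory Submission
  imports Defs "HOL-Complex_Analysis.Complex_Analysis"
begin

text \<open>
  In \<open>y = 2x - 1 \<in> [-1, 1]\<close> and with \<open>\<omega>\<^sup>2 = (33 + 34t)/16\<close>, look for \<open>u\<^sub>1 = \<surd>A p + \<i> q\<close>,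
  \<open>u\<^sub>2 = r + \<i> \<surd>A s\<close>, where \<open>p, r\<close> are even, \<open>q, s\<close> are odd, all of them and the scalar \<open>A\<close> are
  real for real \<open>t\<close>, and \<open>p(0) \<approx> 1\<close> is prescribed. By parity the boundary conditions reduce to the four equations
  \<open>r = s = r' = s' = 0\<close> at \<open>y = 1\<close> for the four unknowns \<open>A, q'(0), r(0), s'(0)\<close>, and since only
  \<open>A = (\<surd>A)\<^sup>2\<close> enters the system for \<open>(p, q, r, s)\<close>, that system is polynomial.

  An explicit polynomial in \<open>y\<close> and \<open>t\<close> approximates a branch of solutions, and four further
  polynomial quadruples approximate the variations of the initial data, normalised by their
  boundary values. Writing the solution as the approximate branch plus a combination of the
  variations plus a remainder that is the double integral of its second derivative gives a fixed
  point equation for this second derivative and the four amplitudes. In the sup norm over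
  \<open>[-1, 1]\<close> and the complex unit disc in \<open>t\<close>, with weight \<open>cosh 6y\<close> so that double
  integration gains a factor 36, the equation is a contraction. Its residual and its linear part are
  estimated with integer polynomial arithmetic: substituting \<open>y\<^sup>2 - 1/2 = cos \<theta> / 2\<close> turns a polynomial
  into a cosine sum, whose sup norm is at most the sum of the absolute values of its coefficients.

  The fixed point is holomorphic in \<open>t\<close>; as \<open>A > 0\<close> on the parameter interval, \<open>\<surd>A\<close> is holomorphic
  near it, and the solution is smooth in \<open>\<omega>\<close> in every norm. Finally \<open>Im u\<^sub>1(1) = q(1)\<close>, which is about 21,
  does not vanish, and compactness bounds the norms from below.
\<close>

text \<open>The linearisation at the branch is far from small: its coefficients are large enough to
  use up two thirds of the factor 36, so nothing cruder than the \<open>cosh\<close> weight would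
  give a contraction. The four amplitudes enjoy no such gain and are tamed by the choice of the
  variations. These nearly solve the linearised equations, so an amplitude acts on the second
  derivatives only through a small residual; and their boundary matrix is nearly the identity, so
  the boundary conditions can be iterated without inverting a matrix. The opposite influence, of
  second derivatives on boundary values, is large, but being one-way it is absorbed by larger
  weights for the amplitudes.

  The disc |t| < 1 cuts the real line in -1/16 < omega^2 < 67/16, just more than the required
  [0, 2.03^2]. Complex \<open>t\<close> costs nothing, since sums of absolute coefficients bound a
  polynomial on the whole disc, and it spares all estimates of parameter derivatives.

  Working with \<open>A\<close> instead of its root keeps the equations regular towards the right
  end, where \<open>A\<close> becomes small: it is about 375 at omega = 0 and about 6 at omega =
  2.03.\<close>

section \<open>Weak derivatives on an interval\<close>

text \<open>The representative chosen by \<^const>\<open>weak_deriv\<close> is pinned down almost everywhere by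
  testing against smooth bumps. The extra powers in \<open>bump\<close> make the span of these functions
  closed under differentiation.\<close>

definition bump :: "real \<Rightarrow> real \<Rightarrow> real \<Rightarrow> nat \<Rightarrow> nat \<Rightarrow> real \<Rightarrow> real" where
  "bump c a b i j x =
     (if a < x \<and> x < b then exp (- c / (x - a)) / (x - a) ^ i * (exp (- c / (b - x)) / (b - x) ^ j)
      else 0)"

inductive_set bump_span :: "real \<Rightarrow> real \<Rightarrow> real \<Rightarrow> (real \<Rightarrow> real) set" for c a b where
  base: "bump c a b i j \<in> bump_span c a b"
| add: "f \<in> bump_span c a b \<Longrightarrow> g \<in> bump_span c a b \<Longrightarrow> (\<lambda>x. f x + g x) \<in> bump_span c a b"
| scale: "f \<in> bump_span c a b \<Longrightarrow> (\<lambda>x. r * f x) \<in> bump_span c a b"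

text \<open>A single term of the exponential series bounds \<open>exp (c / u)\<close> from below;
  the reciprocal decays faster than any power of \<open>u\<close>.\<close>

lemma exp_neg_inverse_le:
  fixes c u :: real
  assumes "c > 0" "u > 0"
  shows "exp (- c / u) \<le> fact k / c ^ k * u ^ k"
proof -
  have "(c / u) ^ k / fact k \<le> (\<Sum>n. (c / u) ^ n / fact n)"
    using sum_le_suminf[OF summable_exp[of "c/u"], of "{k}"] assms
    by (simp add: divide_inverse mult.commute)
  also have "\<dots> = exp (c / u)"
    by (simp add: exp_def divide_inverse mult.commute)
  finally have "(c / u) ^ k / fact k \<le> exp (c / u)" .
  hence "inverse (exp (c / u)) \<le> inverse ((c / u) ^ k / fact k)"
    using assms by (intro le_imp_inverse_le) auto
  thus ?thesis
    using assms by (simp add: exp_minus power_divide field_simps)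
qed

lemma exp_neg_inverse_div_power_le:
  fixes c u :: real
  assumes "c > 0" "u > 0"
  shows "exp (- c / u) / u ^ i \<le> fact (i + k) / c ^ (i + k) * u ^ k"
proof -
  have "exp (- c / u) / u ^ i \<le> (fact (i + k) / c ^ (i + k) * u ^ (i + k)) / u ^ i"
    using exp_neg_inverse_le[OF assms, of "i + k"] assms by (intro divide_right_mono) auto
  thus ?thesis
    using assms by (simp add: power_add)
qed

text \<open>The free exponents distribute the decay over the two ends: \<open>k = 2, l = 0\<close>
  and \<open>k = 0, l = 2\<close> give differentiability at \<open>a\<close> and at
  \<open>b\<close>, and with all four exponents 0 the bound is 1.\<close>

lemma bump_bound:
  assumes "c > 0"
  shows "\<bar>bump c a b i j x\<bar> \<le> fact (i + k) / c ^ (i + k) * \<bar>x - a\<bar> ^ k * (fact (j + l) / c ^ (j + l) * \<bar>b - x\<bar> ^ l)"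
proof (cases "a < x \<and> x < b")
  case True
  have "\<bar>bump c a b i j x\<bar> = exp (- c / (x - a)) / (x - a) ^ i * (exp (- c / (b - x)) / (b - x) ^ j)"
    using True by (simp add: bump_def)
  also have "\<dots> \<le> fact (i + k) / c ^ (i + k) * (x - a) ^ k * (fact (j + l) / c ^ (j + l) * (b - x) ^ l)"
    using True assms by (intro mult_mono exp_neg_inverse_div_power_le) auto
  finally show ?thesis
    using True by simp
next
  case False
  thus ?thesis
    using assms by (auto simp: bump_def)
qed

lemma has_derivative_0_if_quadratic:
  fixes f :: "real \<Rightarrow> real"
  assumes "f x0 = 0" and "\<And>x. \<bar>f x\<bar> \<le> K * (x - x0)\<^sup>2"
  shows "(f has_real_derivative 0) (at x0)"
proof -
  have "((\<lambda>x. K * \<bar>x - x0\<bar>) \<longlongrightarrow> K * \<bar>x0 - x0\<bar>) (at x0)"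
    by (intro tendsto_intros)
  hence lim: "((\<lambda>x. K * \<bar>x - x0\<bar>) \<longlongrightarrow> 0) (at x0)"
    by simp
  have "norm ((f x - f x0) / (x - x0)) \<le> K * \<bar>x - x0\<bar>" if "x \<noteq> x0" for x
    using assms(2)[of x] that
    by (simp add: assms(1) divide_le_eq power2_eq_square mult.assoc flip: abs_mult)
  hence "((\<lambda>x. (f x - f x0) / (x - x0)) \<longlongrightarrow> 0) (at x0)"
    by (intro Lim_null_comparison[OF _ lim]) (auto simp: eventually_at_filter)
  thus ?thesis
    by (simp add: has_field_derivative_iff)
qed

lemma exp_neg_inverse_has_derivative:
  fixes u :: real
  assumes "u \<noteq> 0"
  shows "((\<lambda>u. exp (- c / u) / u ^ i) has_real_derivative
           c * (exp (- c / u) / u ^ (i + 2)) - real i * (exp (- c / u) / u ^ (i + 1))) (at u)"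
proof -
  have "((\<lambda>u. exp (- c * inverse u) * inverse (u ^ i)) has_real_derivative
           exp (- c * inverse u) * (- c * - (inverse u * inverse u)) * inverse (u ^ i)
           + - (real i * u ^ (i - 1) * (inverse (u ^ i) * inverse (u ^ i))) * exp (- c * inverse u)) (at u)"
    (is "(?f has_real_derivative ?d) _")
    using assms by (auto intro!: derivative_eq_intros simp: power2_eq_square)
  moreover have "?d = c * (exp (- c / u) / u ^ (i + 2)) - real i * (exp (- c / u) / u ^ (i + 1))"
    using assms by (cases i) (simp_all add: divide_inverse algebra_simps power2_eq_square)
  moreover have "?f = (\<lambda>u. exp (- c / u) / u ^ i)"
    by (simp add: divide_inverse)
  ultimately show ?thesis
    by simp
qed

lemma bump_has_derivative:
  assumes "c > 0" "a < b"
  shows "(bump c a b i j has_real_derivative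
           (c * bump c a b (i + 2) j x + (- c) * bump c a b i (j + 2) x)
             + ((- real i) * bump c a b (i + 1) j x + real j * bump c a b i (j + 1) x)) (at x)"
proof -
  consider "x \<le> a" | "x \<ge> b" | "a < x" "x < b" by linarith
  thus ?thesis
  proof cases
    case 1
    \<comment> \<open>Centring the square at \<open>x\<close> instead of \<open>a\<close> lets one
      estimate serve both the end point and every point to its left.\<close>
    have bd: "\<bar>bump c a b i j y\<bar> \<le> fact (i + 2) / c ^ (i + 2) * (fact j / c ^ j) * (y - x)\<^sup>2" for y
    proof (cases "a < y \<and> y < b")
      case True
      have "(y - a)\<^sup>2 \<le> (y - x)\<^sup>2"
        using 1 True by (intro power_mono) auto
      hence "fact (i + 2) / c ^ (i + 2) * (fact j / c ^ j) * (y - a)\<^sup>2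
              \<le> fact (i + 2) / c ^ (i + 2) * (fact j / c ^ j) * (y - x)\<^sup>2"
        using assms by (intro mult_left_mono) auto
      thus ?thesis
        using bump_bound[OF assms(1), of a b i j y 2 0] by (simp add: mult_ac)
    next
      case False
      thus ?thesis using assms by (auto simp: bump_def)
    qed
    have "(bump c a b i j has_real_derivative 0) (at x)"
      by (rule has_derivative_0_if_quadratic[OF _ bd]) (use 1 in \<open>simp add: bump_def\<close>)
    thus ?thesis using 1 by (simp add: bump_def)
  next
    case 2
    have bd: "\<bar>bump c a b i j y\<bar> \<le> fact i / c ^ i * (fact (j + 2) / c ^ (j + 2)) * (y - x)\<^sup>2" for y
    proof (cases "a < y \<and> y < b")
      case True
      have "(b - y)\<^sup>2 \<le> (x - y)\<^sup>2"
        using 2 True by (intro power_mono) auto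
      hence "fact i / c ^ i * (fact (j + 2) / c ^ (j + 2)) * (b - y)\<^sup>2
              \<le> fact i / c ^ i * (fact (j + 2) / c ^ (j + 2)) * (y - x)\<^sup>2"
        using assms by (intro mult_left_mono) (auto simp: power2_commute)
      thus ?thesis
        using bump_bound[OF assms(1), of a b i j y 0 2] by (simp add: mult_ac)
    next
      case False
      thus ?thesis using assms by (auto simp: bump_def)
    qed
    have "(bump c a b i j has_real_derivative 0) (at x)"
      by (rule has_derivative_0_if_quadratic[OF _ bd]) (use 2 in \<open>simp add: bump_def\<close>)
    thus ?thesis using 2 by (simp add: bump_def)
  next
    case 3
    let ?f = "\<lambda>x. exp (- c / (x - a)) / (x - a) ^ i * (exp (- c / (b - x)) / (b - x) ^ j)"
    have nz: "x - a \<noteq> 0" "b - x \<noteq> 0" using 3 by auto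
    have "((\<lambda>x. x - a) has_real_derivative 1) (at x)" "((\<lambda>x. b - x) has_real_derivative - 1) (at x)"
      by (auto intro!: derivative_eq_intros)
    note E = DERIV_chain2[OF exp_neg_inverse_has_derivative[OF nz(1)] this(1), of c i]
      DERIV_chain2[OF exp_neg_inverse_has_derivative[OF nz(2)] this(2), of c j]
    have "(?f has_real_derivative
           (c * bump c a b (i + 2) j x + (- c) * bump c a b i (j + 2) x)
             + ((- real i) * bump c a b (i + 1) j x + real j * bump c a b i (j + 1) x)) (at x)"
      using DERIV_mult[OF E] 3
      by (simp add: bump_def divide_inverse power_inverse algebra_simps)
    moreover have "eventually (\<lambda>y. bump c a b i j y = ?f y) (nhds x)"
      using eventually_nhds_in_open[of "{a<..<b}" x] 3
      by (auto elim!: eventually_mono simp: bump_def)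
    ultimately show ?thesis
      by (subst DERIV_cong_ev[OF refl _ refl])
  qed
qed

lemma bump_span_derivative:
  assumes "c > 0" "a < b" "f \<in> bump_span c a b"
  shows "\<exists>g\<in>bump_span c a b. \<forall>x. (f has_real_derivative g x) (at x)"
  using assms(3)
proof induction
  case (base i j)
  show ?case
    by (intro bexI[of _ "\<lambda>x. (c * bump c a b (i + 2) j x + (- c) * bump c a b i (j + 2) x)
             + ((- real i) * bump c a b (i + 1) j x + real j * bump c a b i (j + 1) x)"]
          allI bump_has_derivative assms bump_span.add bump_span.scale bump_span.base)
next
  case (add f g)
  then obtain f' g' where "f' \<in> bump_span c a b" "g' \<in> bump_span c a b"
    "\<And>x. (f has_real_derivative f' x) (at x)" "\<And>x. (g has_real_derivative g' x) (at x)"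
    by blast
  thus ?case
    by (intro bexI[of _ "\<lambda>x. f' x + g' x"]) (auto intro: bump_span.add DERIV_add)
next
  case (scale f r)
  then obtain f' where "f' \<in> bump_span c a b" "\<And>x. (f has_real_derivative f' x) (at x)"
    by blast
  thus ?case
    by (intro bexI[of _ "\<lambda>x. r * f' x"]) (auto intro: bump_span.scale DERIV_cmult)
qed

lemma bump_span_higher_deriv:
  assumes "c > 0" "a < b" "f \<in> bump_span c a b"
  shows "(deriv ^^ n) f \<in> bump_span c a b"
proof (induction n)
  case (Suc n)
  then obtain g where "g \<in> bump_span c a b" "\<forall>x. ((deriv ^^ n) f has_real_derivative g x) (at x)"
    using bump_span_derivative[OF assms(1,2)] by blast
  moreover from this have "(deriv ^^ Suc n) f = g"
    by (auto intro!: ext DERIV_imp_deriv)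
  ultimately show ?case by simp
qed (use assms in simp)

lemma bump_test_function:
  assumes "c > 0" "0 < a" "a < b" "b < 1"
  shows "bump c a b 0 0 \<in> test_functions {0<..<1}"
proof -
  have "(deriv ^^ n) (bump c a b 0 0) differentiable (at x)" for n x
    using bump_span_derivative[OF assms(1,3) bump_span_higher_deriv[OF assms(1,3) bump_span.base]]
    by (meson real_differentiable_def)
  moreover have "closure {x. bump c a b 0 0 x \<noteq> 0} \<subseteq> {a..b}"
    by (intro closure_minimal) (auto simp: bump_def split: if_splits)
  moreover from this have "compact (closure {x. bump c a b 0 0 x \<noteq> 0})"
    using compact_Int_closed[of "{a..b}" "closure {x. bump c a b 0 0 x \<noteq> 0}"]
    by (simp add: inf.absorb2)
  ultimately show ?thesis
    using assms by (fastforce simp: test_functions_def)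
qed

text \<open>As \<open>c\<close> shrinks, the bump fills its interval, so indicators of intervals are
  bounded pointwise limits of test functions.\<close>

lemma bump_tendsto_indicator:
  "(\<lambda>n. bump (1 / real (Suc n)) a b 0 0 x) \<longlonglongrightarrow> indicator {a<..<b} x"
proof (cases "a < x \<and> x < b")
  case True
  have "(\<lambda>n. exp (- (1 / real (Suc n)) / (x - a)) * exp (- (1 / real (Suc n)) / (b - x)))
          \<longlonglongrightarrow> exp (- 0 / (x - a)) * exp (- 0 / (b - x))"
    using True LIMSEQ_inverse_real_of_nat
    by (intro tendsto_intros) (auto simp: inverse_eq_divide)
  thus ?thesis using True by (simp add: bump_def)
qed (auto simp: bump_def)

lemma bump_le_1: "c > 0 \<Longrightarrow> \<bar>bump c a b 0 0 x\<bar> \<le> 1"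
  using bump_bound[of c a b 0 0 x 0 0] by simp

section \<open>Test functions and integrals over the unit interval\<close>

lemma continuous_on_test_function:
  assumes "\<phi> \<in> test_functions S"
  shows "continuous_on A \<phi>"
proof -
  have "\<phi> differentiable at x" for x
    using assms unfolding test_functions_def by (metis (mono_tags, lifting) funpow_0 mem_Collect_eq)
  thus ?thesis
    by (intro continuous_at_imp_continuous_on ballI) (auto intro: differentiable_imp_continuous_within)
qed

lemma test_function_has_derivative:
  assumes "\<phi> \<in> test_functions S"
  shows "(\<phi> has_real_derivative deriv \<phi> x) (at x)"
    and "continuous_on A (deriv \<phi>)"
proof -
  have d: "(deriv ^^ n) \<phi> differentiable at x" for n x
    using assms unfolding test_functions_def by blast
  show "(\<phi> has_real_derivative deriv \<phi> x) (at x)"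
    using d[of 0 x] by (simp add: DERIV_deriv_iff_real_differentiable)
  have "deriv \<phi> differentiable at x" for x
    using d[of 1 x] by simp
  thus "continuous_on A (deriv \<phi>)"
    by (intro continuous_at_imp_continuous_on ballI) (auto intro: differentiable_imp_continuous_within)
qed

lemma test_function_outside:
  "\<phi> \<in> test_functions S \<Longrightarrow> x \<notin> S \<Longrightarrow> \<phi> x = 0"
  unfolding test_functions_def using closure_subset[of "{x. \<phi> x \<noteq> 0}"] by auto

lemma finite_measure_unit_interval: "finite_measure (lebesgue_on {0<..<1::real})"
  by (intro finite_measure_lebesgue_on) auto

lemma measure_unit_interval: "measure (lebesgue_on {0<..<1::real}) {0<..<1} = 1"
  by (simp add: measure_restrict_space)

lemma bounded_continuous_measurable:
  fixes f :: "real \<Rightarrow> 'a::euclidean_space"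
  assumes "continuous_on {0<..<1} f"
  shows "f \<in> borel_measurable (lebesgue_on {0<..<1})"
  by (rule continuous_imp_measurable_on_sets_lebesgue[OF assms]) auto

lemma integrable_unit_interval:
  fixes f :: "real \<Rightarrow> 'a::euclidean_space"
  assumes "continuous_on {0..1} f"
  shows "integrable (lebesgue_on {0<..<1}) f"
proof -
  interpret finite_measure "lebesgue_on {0<..<1::real}"
    by (rule finite_measure_unit_interval)
  have "compact (f ` {0..1})"
    by (rule compact_continuous_image[OF assms]) simp
  then obtain B where "\<And>x. x \<in> {0..1} \<Longrightarrow> norm (f x) \<le> B"
    using compact_imp_bounded bounded_iff by (metis imageI)
  thus ?thesis
    by (intro integrable_const_bound[where B = B] bounded_continuous_measurable
          continuous_on_subset[OF assms] AE_I2) auto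
qed

lemma continuous_in_L2_space:
  assumes "continuous_on {0..1} f"
  shows "f \<in> L2_space {0<..<1}"
  unfolding L2_space_def
  by (auto intro!: bounded_continuous_measurable integrable_unit_interval continuous_intros
        continuous_on_subset[OF assms] assms)

text \<open>Integration by parts on the closed interval; the boundary terms vanish because the
  support of a test function lies in the open one.\<close>

lemma classical_imp_weak_deriv:
  assumes f: "continuous_on {0..1} f" and f': "continuous_on {0..1} f'"
    and deriv: "\<And>x. x \<in> {0<..<1} \<Longrightarrow> (f has_vector_derivative f' x) (at x)"
  shows "has_weak_deriv {0<..<1} f f'"
  unfolding has_weak_deriv_def
proof (intro conjI ballI continuous_in_L2_space f f')
  fix \<phi> assume \<phi>: "\<phi> \<in> test_functions {0<..<1::real}"
  have int1: "integrable (lebesgue_on {0<..<1}) (\<lambda>x. deriv \<phi> x *\<^sub>R f x)"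
    by (intro integrable_unit_interval continuous_intros test_function_has_derivative(2)[OF \<phi>] f)
  have int2: "integrable (lebesgue_on {0<..<1}) (\<lambda>x. \<phi> x *\<^sub>R f' x)"
    by (intro integrable_unit_interval continuous_intros continuous_on_test_function[OF \<phi>] f')
  have "((\<lambda>x. deriv \<phi> x *\<^sub>R f x + \<phi> x *\<^sub>R f' x) has_integral (\<phi> 1 *\<^sub>R f 1 - \<phi> 0 *\<^sub>R f 0)) {0..1}"
  proof (rule fundamental_theorem_of_calculus_interior)
    fix x :: real assume "x \<in> {0<..<1}"
    thus "((\<lambda>x. \<phi> x *\<^sub>R f x) has_vector_derivative deriv \<phi> x *\<^sub>R f x + \<phi> x *\<^sub>R f' x) (at x)"
      by (auto intro!: derivative_eq_intros test_function_has_derivative(1)[OF \<phi>] deriv)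
  qed (auto intro!: continuous_intros continuous_on_test_function[OF \<phi>] f)
  hence "((\<lambda>x. deriv \<phi> x *\<^sub>R f x + \<phi> x *\<^sub>R f' x) has_integral 0) {0<..<1}"
    using test_function_outside[OF \<phi>] by (simp add: has_integral_Icc_iff_Ioo)
  moreover have "((\<lambda>x. deriv \<phi> x *\<^sub>R f x + \<phi> x *\<^sub>R f' x) has_integral
       integral\<^sup>L (lebesgue_on {0<..<1}) (\<lambda>x. deriv \<phi> x *\<^sub>R f x + \<phi> x *\<^sub>R f' x)) {0<..<1}"
    using int1 int2 by (intro has_integral_integral_lebesgue_on) auto
  ultimately have "integral\<^sup>L (lebesgue_on {0<..<1}) (\<lambda>x. deriv \<phi> x *\<^sub>R f x + \<phi> x *\<^sub>R f' x) = 0"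
    using has_integral_unique by blast
  thus "(\<integral>x. deriv \<phi> x *\<^sub>R f x \<partial>lebesgue_on {0<..<1}) = - (\<integral>x. \<phi> x *\<^sub>R f' x \<partial>lebesgue_on {0<..<1})"
    using int1 int2 by (simp add: add_eq_0_iff2)
qed

lemma L2_space_integrable:
  assumes "g \<in> L2_space {0<..<1}"
  shows "integrable (lebesgue_on {0<..<1}) g"
proof -
  interpret finite_measure "lebesgue_on {0<..<1::real}"
    by (rule finite_measure_unit_interval)
  have m: "g \<in> borel_measurable (lebesgue_on {0<..<1})"
    and sq: "integrable (lebesgue_on {0<..<1}) (\<lambda>x. (cmod (g x))\<^sup>2)"
    using assms by (auto simp: L2_space_def)
  have le: "cmod (g x) \<le> 1 + (cmod (g x))\<^sup>2" for x
    using sum_power2_ge_zero[of "cmod (g x) - 1/2" 0] by (simp add: power2_eq_square algebra_simps)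
  have "integrable (lebesgue_on {0<..<1}) (\<lambda>x. 1 + (cmod (g x))\<^sup>2)"
    using sq by (intro Bochner_Integration.integrable_add) auto
  thus ?thesis
    by (rule Bochner_Integration.integrable_bound[OF _ m]) (use le in \<open>auto intro!: AE_I2\<close>)
qed

text \<open>Bumps tending to an indicator, with dominated convergence, show that \<open>g\<close>
  has integral 0 over every subinterval; Lebesgue differentiation then gives \<open>g = 0\<close>
  almost everywhere.\<close>

lemma fundamental_lemma_calculus_of_variations:
  fixes g :: "real \<Rightarrow> complex"
  assumes g: "integrable (lebesgue_on {0<..<1}) g"
    and test: "\<And>\<phi>. \<phi> \<in> test_functions {0<..<1} \<Longrightarrow> (\<integral>x. \<phi> x *\<^sub>R g x \<partial>lebesgue_on {0<..<1}) = 0"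
  shows "AE x in lebesgue_on {0<..<1}. g x = 0"
proof -
  let ?M = "lebesgue_on {0<..<1::real}"
  have int0: "(g has_integral 0) {a<..<b}" if ab: "0 < a" "a < b" "b < 1" for a b
  proof -
    have "(\<lambda>n. \<integral>x. bump (1 / real (Suc n)) a b 0 0 x *\<^sub>R g x \<partial>?M)
            \<longlonglongrightarrow> (\<integral>x. indicat_real {a<..<b} x *\<^sub>R g x \<partial>?M)"
    proof (rule integral_dominated_convergence[where w = "\<lambda>x. norm (g x)"])
      show "(\<lambda>x. indicat_real {a<..<b} x *\<^sub>R g x) \<in> borel_measurable ?M"
        using g ab by (intro borel_measurable_scaleR borel_measurable_indicator)
            (auto simp: sets_restrict_space intro!: image_eqI[of _ _ "{a<..<b}"])
      show "(\<lambda>x. bump (1 / real (Suc n)) a b 0 0 x *\<^sub>R g x) \<in> borel_measurable ?M" for n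
      proof (rule borel_measurable_scaleR)
        show "bump (1 / real (Suc n)) a b 0 0 \<in> borel_measurable ?M"
          by (intro bounded_continuous_measurable continuous_on_test_function[OF bump_test_function])
            (use ab in auto)
      qed (use g in auto)
      show "AE x in ?M. (\<lambda>n. bump (1 / real (Suc n)) a b 0 0 x *\<^sub>R g x)
               \<longlonglongrightarrow> indicat_real {a<..<b} x *\<^sub>R g x"
        by (intro AE_I2 tendsto_intros bump_tendsto_indicator)
      show "AE x in ?M. norm (bump (1 / real (Suc n)) a b 0 0 x *\<^sub>R g x) \<le> norm (g x)" for n
        by (intro AE_I2) (auto intro!: mult_left_le_one_le bump_le_1)
    qed (use g in auto)
    moreover have "(\<integral>x. bump (1 / real (Suc n)) a b 0 0 x *\<^sub>R g x \<partial>?M) = 0" for n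
      by (intro test bump_test_function) (use ab in auto)
    ultimately have "(\<integral>x. indicat_real {a<..<b} x *\<^sub>R g x \<partial>?M) = 0"
      using LIMSEQ_unique[OF tendsto_const] by force
    moreover have "integrable ?M (\<lambda>x. indicat_real {a<..<b} x *\<^sub>R g x)"
      using ab by (intro integrable_mult_indicator g)
          (auto simp: sets_restrict_space intro!: image_eqI[of _ _ "{a<..<b}"])
    ultimately have "((\<lambda>x. indicat_real {a<..<b} x *\<^sub>R g x) has_integral 0) {0<..<1}"
      using has_integral_integral_lebesgue_on[of "{0<..<1}" "\<lambda>x. indicat_real {a<..<b} x *\<^sub>R g x"] by auto
    hence "((\<lambda>x. if x \<in> {a<..<b} then g x else 0) has_integral 0) {0<..<1}"
      by (rule has_integral_eq[rotated]) auto
    thus ?thesis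
      using ab by (subst (asm) has_integral_restrict) auto
  qed
  define f where "f = (\<lambda>x. if x \<in> {0<..<1} then g x else 0)"
  have "(g has_integral (\<integral>x. g x \<partial>?M)) {0<..<1}"
    by (rule has_integral_integral_lebesgue_on[OF g]) auto
  hence "f integrable_on UNIV"
    unfolding f_def integrable_restrict_UNIV by blast
  hence "f integrable_on cbox a b" for a b
    by (rule integrable_on_subcbox) auto
  from integrable_ccontinuous_explicit[OF this] obtain N where N: "negligible N"
    and dense: "\<And>x e. \<lbrakk>x \<notin> N; 0 < e\<rbrakk> \<Longrightarrow> \<exists>d>0. \<forall>h. 0 < h \<and> h < d \<longrightarrow>
         norm (integral (cbox x (x + h *\<^sub>R One)) f /\<^sub>R h ^ DIM(real) - f x) < e"
    by metis
  have "g x = 0" if x: "x \<in> {0<..<1}" "x \<notin> N" for x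
  proof (rule ccontr)
    assume "g x \<noteq> 0"
    hence "norm (g x) > 0" by simp
    from dense[OF x(2) this] obtain d where d: "d > 0"
      "\<And>h. 0 < h \<Longrightarrow> h < d \<Longrightarrow> norm (integral (cbox x (x + h *\<^sub>R One)) f /\<^sub>R h ^ DIM(real) - f x) < norm (g x)"
      by blast
    define h where "h = min (d / 2) ((1 - x) / 2)"
    have h: "0 < h" "h < d" "x + h < 1" using x d by (auto simp: h_def min_def field_simps)
    have "(g has_integral 0) {x<..<x+h}" using x h by (intro int0) auto
    hence "(f has_integral 0) {x<..<x+h}"
      by (rule has_integral_eq[rotated]) (use x h in \<open>auto simp: f_def\<close>)
    hence "integral {x..x+h} f = 0"
      by (simp add: has_integral_Icc_iff_Ioo integral_unique)
    thus False
      using d(2)[OF h(1,2)] x by (simp add: f_def)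
  qed
  moreover have "AE x in ?M. x \<notin> N"
    using N by (intro AE_restrict_space_iff[THEN iffD2])
      (auto simp: negligible_iff_null_sets intro: AE_not_in[THEN eventually_mono])
  ultimately show ?thesis
    by (auto elim: eventually_mono simp: AE_restrict_space_iff)
qed

lemma weak_deriv_testD:
  "has_weak_deriv S f g \<Longrightarrow> \<forall>\<phi>\<in>test_functions S.
     (\<integral>x. deriv \<phi> x *\<^sub>R f x \<partial>lebesgue_on S) = - (\<integral>x. \<phi> x *\<^sub>R g x \<partial>lebesgue_on S)"
  by (simp add: has_weak_deriv_def)

lemma weak_deriv_unique:
  assumes "has_weak_deriv {0<..<1} f g" "has_weak_deriv {0<..<1} f h"
  shows "AE x in lebesgue_on {0<..<1}. g x = h x"
proof -
  let ?M = "lebesgue_on {0<..<1::real}"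
  have gh: "integrable ?M g" "integrable ?M h"
    using assms by (auto simp: has_weak_deriv_def intro: L2_space_integrable)
  have "AE x in ?M. g x - h x = 0"
  proof (rule fundamental_lemma_calculus_of_variations)
    fix \<phi> assume \<phi>: "\<phi> \<in> test_functions {0<..<1::real}"
    have bd: "bounded (\<phi> ` {0..1})"
      by (intro compact_imp_bounded compact_continuous_image continuous_on_test_function[OF \<phi>]) auto
    then obtain B where B: "\<forall>x\<in>{0..1}. \<bar>\<phi> x\<bar> \<le> B"
      by (auto simp: bounded_iff)
    have i: "integrable ?M (\<lambda>x. \<phi> x *\<^sub>R k x)" if "integrable ?M k" for k :: "real \<Rightarrow> complex"
    proof (rule Bochner_Integration.integrable_bound)
      show "integrable ?M (\<lambda>x. B *\<^sub>R k x)" using that by auto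
      show "(\<lambda>x. \<phi> x *\<^sub>R k x) \<in> borel_measurable ?M"
        by (rule borel_measurable_scaleR[OF
              bounded_continuous_measurable[OF continuous_on_test_function[OF \<phi>]]
              borel_measurable_integrable[OF that]])
      show "AE x in ?M. norm (\<phi> x *\<^sub>R k x) \<le> norm (B *\<^sub>R k x)"
      proof (rule AE_I2)
        fix x assume "x \<in> space ?M"
        hence "\<bar>\<phi> x\<bar> \<le> B" using B by (simp add: less_imp_le)
        thus "norm (\<phi> x *\<^sub>R k x) \<le> norm (B *\<^sub>R k x)"
          using abs_ge_self[of B] by (simp add: mult_right_mono del: abs_ge_self)
      qed
    qed
    have "(\<integral>x. \<phi> x *\<^sub>R g x \<partial>?M) = (\<integral>x. \<phi> x *\<^sub>R h x \<partial>?M)"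
      using bspec[OF weak_deriv_testD[OF assms(1)] \<phi>] bspec[OF weak_deriv_testD[OF assms(2)] \<phi>] by simp
    thus "(\<integral>x. \<phi> x *\<^sub>R (g x - h x) \<partial>?M) = 0"
      using i[OF gh(1)] i[OF gh(2)] by (simp add: scaleR_diff_right)
  qed (use gh in auto)
  thus ?thesis by simp
qed

lemma weak_deriv_AE:
  assumes "has_weak_deriv {0<..<1} f f'"
  shows "AE x in lebesgue_on {0<..<1}. weak_deriv {0<..<1} f x = f' x"
    and "has_weak_deriv {0<..<1} f (weak_deriv {0<..<1} f)"
proof -
  show *: "has_weak_deriv {0<..<1} f (weak_deriv {0<..<1} f)"
    unfolding weak_deriv_def by (rule someI[of "has_weak_deriv {0<..<1} f", OF assms])
  show "AE x in lebesgue_on {0<..<1}. weak_deriv {0<..<1} f x = f' x"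
    by (rule weak_deriv_unique[OF * assms])
qed

text \<open>\<open>H2_norm\<close> differentiates the chosen representative
  \<open>weak_deriv S f\<close>, which agrees with a classical derivative only almost everywhere;
  this lemma carries the second derivative across.\<close>

lemma has_weak_deriv_cong_AE:
  assumes "has_weak_deriv {0<..<1} f h" "AE x in lebesgue_on {0<..<1}. f x = g x" "g \<in> L2_space {0<..<1}"
  shows "has_weak_deriv {0<..<1} g h"
  unfolding has_weak_deriv_def
proof (intro conjI ballI)
  fix \<phi> assume \<phi>: "\<phi> \<in> test_functions {0<..<1::real}"
  have "(\<integral>x. deriv \<phi> x *\<^sub>R g x \<partial>lebesgue_on {0<..<1}) = (\<integral>x. deriv \<phi> x *\<^sub>R f x \<partial>lebesgue_on {0<..<1})"
    using assms
    by (intro integral_cong_AE borel_measurable_scaleR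
          bounded_continuous_measurable[OF test_function_has_derivative(2)[OF \<phi>]])
       (auto simp: has_weak_deriv_def L2_space_def)
  thus "(\<integral>x. deriv \<phi> x *\<^sub>R g x \<partial>lebesgue_on {0<..<1}) = - (\<integral>x. \<phi> x *\<^sub>R h x \<partial>lebesgue_on {0<..<1})"
    using assms \<phi> by (auto simp: has_weak_deriv_def)
qed (use assms in \<open>auto simp: has_weak_deriv_def\<close>)

lemma L2_norm_cong_AE:
  assumes "AE x in lebesgue_on {0<..<1}. f x = g x" "f \<in> L2_space {0<..<1}" "g \<in> L2_space {0<..<1}"
  shows "L2_norm {0<..<1} f = L2_norm {0<..<1} g"
  unfolding L2_norm_def using assms
  by (intro arg_cong[where f = sqrt] integral_cong_AE) (auto simp: L2_space_def)

text \<open>Replaces the arbitrary choices inside \<open>H2_norm\<close> by classical derivatives.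
  The difference quotients in \<open>smooth_H2_L2\<close> are estimated through it.\<close>

lemma classical_H2:
  assumes cont: "continuous_on {0..1} f" "continuous_on {0..1} f'" "continuous_on {0..1} f''"
    and "\<And>x. x \<in> {0<..<1} \<Longrightarrow> (f has_vector_derivative f' x) (at x)"
    and "\<And>x. x \<in> {0<..<1} \<Longrightarrow> (f' has_vector_derivative f'' x) (at x)"
  shows "f \<in> H2_space {0<..<1}"
    and "H2_norm {0<..<1} f =
           sqrt ((L2_norm {0<..<1} f)\<^sup>2 + (L2_norm {0<..<1} f')\<^sup>2 + (L2_norm {0<..<1} f'')\<^sup>2)"
proof -
  let ?S = "{0<..<1::real}"
  have w1: "has_weak_deriv ?S f f'" and w2: "has_weak_deriv ?S f' f''"
    using assms by (auto intro: classical_imp_weak_deriv)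
  thus "f \<in> H2_space ?S" by (auto simp: H2_space_def)
  have L2: "f' \<in> L2_space ?S" "f'' \<in> L2_space ?S" "weak_deriv ?S f \<in> L2_space ?S"
    using w1 w2 weak_deriv_AE(2)[OF w1] by (auto simp: has_weak_deriv_def)
  have w3: "has_weak_deriv ?S (weak_deriv ?S f) f''"
    by (rule has_weak_deriv_cong_AE[OF w2 _ L2(3)]) (use weak_deriv_AE(1)[OF w1] in \<open>auto elim: eventually_mono\<close>)
  have L2': "weak_deriv ?S (weak_deriv ?S f) \<in> L2_space ?S"
    using weak_deriv_AE(2)[OF w3] by (auto simp: has_weak_deriv_def)
  have "L2_norm ?S (weak_deriv ?S f) = L2_norm ?S f'"
    "L2_norm ?S (weak_deriv ?S (weak_deriv ?S f)) = L2_norm ?S f''"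
    by (rule L2_norm_cong_AE weak_deriv_AE(1)[OF w1] weak_deriv_AE(1)[OF w3] L2 L2')+
  thus "H2_norm ?S f = sqrt ((L2_norm ?S f)\<^sup>2 + (L2_norm ?S f')\<^sup>2 + (L2_norm ?S f'')\<^sup>2)"
    by (simp add: H2_norm_def)
qed

lemma L2_norm_le_sup:
  assumes "continuous_on {0..1} f" "\<And>x. x \<in> {0..1} \<Longrightarrow> cmod (f x) \<le> C"
  shows "L2_norm {0<..<1} f \<le> C"
proof -
  interpret finite_measure "lebesgue_on {0<..<1::real}"
    by (rule finite_measure_unit_interval)
  have C: "C \<ge> 0" using order_trans[OF norm_ge_zero assms(2)[of 0]] by simp
  have "(\<integral>x. (cmod (f x))\<^sup>2 \<partial>lebesgue_on {0<..<1}) \<le> (\<integral>x. C\<^sup>2 \<partial>lebesgue_on {0<..<1::real})"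
  proof (rule Bochner_Integration.integral_mono)
    show "integrable (lebesgue_on {0<..<1}) (\<lambda>x. (cmod (f x))\<^sup>2)"
      by (intro integrable_unit_interval continuous_intros assms(1))
  qed (use assms(2) in \<open>auto intro!: power_mono\<close>)
  also have "\<dots> = C\<^sup>2"
    by (simp add: measure_unit_interval)
  finally show ?thesis
    unfolding L2_norm_def using C by (auto intro: real_le_lsqrt)
qed

section \<open>Families that are holomorphic in a parameter\<close>

type_synonym family = "real \<Rightarrow> complex \<Rightarrow> complex"

definition hol_family :: "complex set \<Rightarrow> family \<Rightarrow> bool" where
  "hol_family \<Omega> h \<longleftrightarrow>
     continuous_on ({-1..1} \<times> \<Omega>) (\<lambda>(x, z). h x z) \<and> (\<forall>x\<in>{-1..1}. h x holomorphic_on \<Omega>)"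

lemma scale_in_Icc:
  fixes \<tau> x :: real
  assumes "\<tau> \<in> {0..1}" "x \<in> {-1..1}"
  shows "\<tau> * x \<in> {-1..1}"
proof -
  have "\<bar>\<tau> * x\<bar> \<le> 1 * 1" unfolding abs_mult using assms by (intro mult_mono) auto
  thus ?thesis by (auto simp: abs_le_iff)
qed

definition dz :: "family \<Rightarrow> family" where
  "dz h x z = deriv (h x) z"

text \<open>The antiderivative from 0 in the first argument, pulled back to a fixed interval: both
  signs of \<open>x\<close> are treated alike, and the parameter can be differentiated under an
  integral with constant limits.\<close>

definition prim :: "family \<Rightarrow> family" where
  "prim h x z = of_real x * integral {0..1} (\<lambda>\<tau>. h (\<tau> * x) z)"

lemma hol_family_continuous_x:
  assumes "hol_family \<Omega> h" "z \<in> \<Omega>"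
  shows "continuous_on {-1..1} (\<lambda>x. h x z)"
proof -
  have "continuous_on {-1..1} ((\<lambda>(x, z). h x z) \<circ> (\<lambda>x. (x, z)))"
    using assms by (intro continuous_on_compose continuous_intros)
      (auto simp: hol_family_def intro: continuous_on_subset)
  thus ?thesis by (simp add: o_def)
qed

lemma hol_family_holomorphic: "hol_family \<Omega> h \<Longrightarrow> x \<in> {-1..1} \<Longrightarrow> h x holomorphic_on \<Omega>"
  by (simp add: hol_family_def)

lemma hol_family_uniform:
  assumes h: "hol_family \<Omega> h" and K: "compact K" "K \<subseteq> \<Omega>" and e: "e > 0"
  obtains d where "d > 0"
    "\<And>x x' z z'. x \<in> {-1..1} \<Longrightarrow> x' \<in> {-1..1} \<Longrightarrow> z \<in> K \<Longrightarrow> z' \<in> K \<Longrightarrow> \<bar>x - x'\<bar> < d \<Longrightarrow>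
       dist z z' < d \<Longrightarrow> dist (h x z) (h x' z') < e"
proof -
  have "uniformly_continuous_on ({-1..1} \<times> K) (\<lambda>(x, z). h x z)"
    using h K by (intro compact_uniformly_continuous compact_Times)
      (auto simp: hol_family_def intro: continuous_on_subset)
  then obtain d where d: "d > 0" "\<And>p p'. p \<in> {-1..1} \<times> K \<Longrightarrow> p' \<in> {-1..1} \<times> K \<Longrightarrow> dist p p' < d \<Longrightarrow>
      dist ((\<lambda>(x, z). h x z) p) ((\<lambda>(x, z). h x z) p') < e"
    unfolding uniformly_continuous_on_def using e by metis
  show ?thesis
  proof (rule that[of "d / 2"])
    fix x x' z z' assume *: "x \<in> {-1..1}" "x' \<in> {-1..1}" "z \<in> K" "z' \<in> K" "\<bar>x - x'\<bar> < d / 2" "dist z z' < d / 2"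
    have "dist (x, z) (x', z') \<le> dist x x' + dist z z'"
      unfolding dist_Pair_Pair by (rule sqrt_sum_squares_le_sum) auto
    also have "\<dots> < d" using * by (simp add: dist_real_def)
    finally show "dist (h x z) (h x' z') < e"
      using d(2)[of "(x, z)" "(x', z')"] * by auto
  qed (use d in auto)
qed

text \<open>The issue is joint continuity. Cauchy's inequality on a small circle turns uniform
  closeness of \<open>h x\<close> and \<open>h x0\<close> into closeness of their
  derivatives.\<close>

lemma hol_family_dz:
  assumes \<Omega>: "open \<Omega>" and h: "hol_family \<Omega> h"
  shows "hol_family \<Omega> (dz h)"
proof -
  have "\<exists>d>0. \<forall>p'\<in>{-1..1} \<times> \<Omega>. dist p' p < d \<longrightarrow> dist ((\<lambda>(x, z). dz h x z) p') ((\<lambda>(x, z). dz h x z) p) < e"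
    if p: "p \<in> {-1..1} \<times> \<Omega>" and e: "e > 0" for p e
  proof -
    obtain x0 z0 where p_eq: "p = (x0, z0)" and x0: "x0 \<in> {-1..1}" and z0: "z0 \<in> \<Omega>"
      using p by auto
    obtain R where R: "R > 0" "cball z0 R \<subseteq> \<Omega>"
      using \<Omega> z0 open_contains_cball by blast
    \<comment> \<open>Half the radius, so that circles of radius \<open>r\<close> about all nearby
      centres stay in the compact disc on which \<open>h\<close> is uniformly continuous.\<close>
    define r where "r = R / 2"
    have r: "cball z r \<subseteq> cball z0 R" if "z \<in> ball z0 r" for z
    proof
      fix w assume "w \<in> cball z r"
      thus "w \<in> cball z0 R"
        using that dist_triangle[of z0 w z] by (simp add: r_def)
    qed
    have r0: "r > 0" using R by (simp add: r_def)
    from hol_family_uniform[OF h compact_cball R(2), of "e * r / 4"] e r0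
    obtain d1 where d1: "d1 > 0" "\<And>x x' z z'. x \<in> {-1..1} \<Longrightarrow> x' \<in> {-1..1} \<Longrightarrow> z \<in> cball z0 R \<Longrightarrow>
        z' \<in> cball z0 R \<Longrightarrow> \<bar>x - x'\<bar> < d1 \<Longrightarrow> dist z z' < d1 \<Longrightarrow> dist (h x z) (h x' z') < e * r / 4"
      by (metis divide_pos_pos mult_pos_pos zero_less_numeral)
    have "continuous_on \<Omega> (deriv (h x0))"
      using \<Omega> h x0 by (intro holomorphic_on_imp_continuous_on holomorphic_deriv hol_family_holomorphic)
    then obtain d2 where d2: "d2 > 0" "\<And>z. z \<in> \<Omega> \<Longrightarrow> dist z z0 < d2 \<Longrightarrow> dist (deriv (h x0) z) (deriv (h x0) z0) < e / 2"
      unfolding continuous_on_iff using z0 e by (metis half_gt_zero)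
    define d where "d = min r (min d1 d2)"
    have "dist (dz h x z) (dz h x0 z0) < e" if x: "x \<in> {-1..1}" and z: "z \<in> \<Omega>" and dist: "dist (x, z) (x0, z0) < d" for x z
    proof -
      have dx: "dist x x0 < d" and dz: "dist z z0 < d"
        using dist dist_fst_le[of "(x, z)" "(x0, z0)"] dist_snd_le[of "(x, z)" "(x0, z0)"] by auto
      have zb: "z \<in> ball z0 r" using dz by (auto simp: d_def dist_commute)
      have sub: "cball z r \<subseteq> \<Omega>" using r[OF zb] R by blast
      have hol: "h y holomorphic_on cball z r" if "y \<in> {-1..1}" for y
        using hol_family_holomorphic[OF h that] sub holomorphic_on_subset by blast
      have "norm ((deriv ^^ 1) (\<lambda>w. h x w - h x0 w) z) \<le> fact 1 * (e * r / 4) / r ^ 1"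
      proof (rule Cauchy_inequality)
        show "(\<lambda>w. h x w - h x0 w) holomorphic_on ball z r"
          using hol[OF x] hol[OF x0] by (intro holomorphic_intros) (auto intro: holomorphic_on_subset)
        show "continuous_on (cball z r) (\<lambda>w. h x w - h x0 w)"
          using hol[OF x] hol[OF x0] by (intro continuous_intros holomorphic_on_imp_continuous_on)
        fix w assume "norm (z - w) = r"
        hence "w \<in> cball z0 R" using r[OF zb] by (auto simp: dist_norm)
        thus "norm (h x w - h x0 w) \<le> e * r / 4"
          using d1(2)[of x x0 w w] x x0 d1(1) dx by (simp add: dist_norm d_def less_imp_le)
      qed (rule r0)
      moreover have "deriv (\<lambda>w. h x w - h x0 w) z = deriv (h x) z - deriv (h x0) z"
        using hol[OF x] hol[OF x0] r0 z \<Omega> hol_family_holomorphic[OF h] x x0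
        by (intro deriv_diff holomorphic_on_imp_differentiable_at[OF _ \<Omega> z]) auto
      ultimately have "dist (deriv (h x) z) (deriv (h x0) z) \<le> e / 4"
        using r0 by (simp add: dist_norm)
      moreover have "dist (deriv (h x0) z) (deriv (h x0) z0) < e / 2"
        using d2(2)[OF z] dz by (simp add: d_def)
      ultimately show ?thesis
        using e dist_triangle[of "deriv (h x) z" "deriv (h x0) z0" "deriv (h x0) z"] by (simp add: dz_def)
    qed
    moreover have "d > 0" using r0 d1 d2 by (simp add: d_def)
    ultimately show ?thesis unfolding p_eq by fastforce
  qed
  hence "continuous_on ({-1..1} \<times> \<Omega>) (\<lambda>(x, z). dz h x z)"
    unfolding continuous_on_iff by blast
  moreover have "dz h x holomorphic_on \<Omega>" if "x \<in> {-1..1}" for x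
    using holomorphic_deriv[OF hol_family_holomorphic[OF h that] \<Omega>] by (simp add: dz_def[abs_def])
  ultimately show ?thesis by (simp add: hol_family_def)
qed

lemma hol_family_has_field_derivative:
  assumes "open \<Omega>" "hol_family \<Omega> h" "x \<in> {-1..1}" "z \<in> \<Omega>"
  shows "(h x has_field_derivative dz h x z) (at z)"
  using holomorphic_derivI[OF hol_family_holomorphic[OF assms(2,3)] assms(1,4)] by (simp add: dz_def)

lemma hol_family_uniform_derivative:
  assumes \<Omega>: "open \<Omega>" and h: "hol_family \<Omega> h" and t: "t \<in> \<Omega>" and e: "e > 0"
  obtains d where "d > 0" "\<And>(s::complex) (x::real). s \<noteq> t \<Longrightarrow> dist s t < d \<Longrightarrow> x \<in> {-1..1} \<Longrightarrow>
     norm ((h x s - h x t) / (s - t) - dz h x t) \<le> e"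
proof -
  obtain r where r: "r > 0" "cball t r \<subseteq> \<Omega>"
    using \<Omega> t open_contains_cball by blast
  from hol_family_uniform[OF hol_family_dz[OF \<Omega> h] compact_cball r(2) e]
  obtain d where d: "d > 0" "\<And>x x' z z'. x \<in> {-1..1} \<Longrightarrow> x' \<in> {-1..1} \<Longrightarrow> z \<in> cball t r \<Longrightarrow>
        z' \<in> cball t r \<Longrightarrow> \<bar>x - x'\<bar> < d \<Longrightarrow> dist z z' < d \<Longrightarrow> dist (dz h x z) (dz h x' z') < e"
    by metis
  show ?thesis
  proof (rule that[of "min d r"])
    fix s :: complex and x :: real assume s: "s \<noteq> t" "dist s t < min d r" and x: "x \<in> {-1..1}"
    \<comment> \<open>Subtracting the linear function of slope \<open>dz h x t\<close> leaves a
      derivative of size at most \<open>e\<close> near \<open>t\<close>, uniformly in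
      \<open>x\<close>; the mean value bound then gives the error of the difference
      quotient.\<close>
    have "norm ((h x s - s * dz h x t) - (h x t - t * dz h x t)) \<le> e * norm (s - t)"
    proof (rule field_differentiable_bound[where S = "ball t (min d r)" and f' = "\<lambda>z. dz h x z - dz h x t"])
      fix z assume z: "z \<in> ball t (min d r)"
      hence "z \<in> \<Omega>" using r by (auto simp: dist_commute)
      from DERIV_diff[OF hol_family_has_field_derivative[OF \<Omega> h x this] DERIV_cmult_right[OF DERIV_ident]]
      show "((\<lambda>z. h x z - z * dz h x t) has_field_derivative dz h x z - dz h x t) (at z within ball t (min d r))"
        by (rule has_field_derivative_at_within[OF DERIV_cong]) simp
      show "norm (dz h x z - dz h x t) \<le> e"
        using d(2)[of x x z t] z x d(1) r(1) by (auto simp: dist_norm norm_minus_commute less_imp_le)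
    qed (use s r d in \<open>auto simp: dist_commute\<close>)
    moreover have "(h x s - h x t) / (s - t) - dz h x t
        = ((h x s - s * dz h x t) - (h x t - t * dz h x t)) / (s - t)"
      using s by (simp add: field_simps)
    ultimately show "norm ((h x s - h x t) / (s - t) - dz h x t) \<le> e"
      using s by (simp add: norm_divide divide_le_eq)
  qed (use d r in auto)
qed

lemma prim_integrand_continuous:
  assumes "hol_family \<Omega> h"
  shows "continuous_on (({-1..1} \<times> \<Omega>) \<times> cbox 0 1) (\<lambda>((x, z), \<tau>). h (\<tau> * x) z)"
proof -
  have "\<tau> * x \<in> {-1..1}" if "0 \<le> \<tau>" "\<tau> \<le> 1" "-1 \<le> x" "x \<le> 1" for \<tau> x :: real
    using scale_in_Icc[of \<tau> x] that by simp
  hence "continuous_on (({-1..1} \<times> \<Omega>) \<times> cbox 0 1) ((\<lambda>(x, z). h x z) \<circ> (\<lambda>p. (snd p * fst (fst p), snd (fst p))))"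
    using assms by (intro continuous_on_compose continuous_intros)
      (auto simp: hol_family_def elim!: continuous_on_subset)
  thus ?thesis by (simp add: o_def case_prod_unfold)
qed

text \<open>The fundamental theorem along the segment from 0 to \<open>x\<close>. It also serves as
  a uniqueness statement, from which linearity of \<open>prim\<close> follows later.\<close>

lemma prim_eq_antiderivative:
  assumes "\<And>x. x \<in> {-1..1} \<Longrightarrow> (G has_vector_derivative h x z) (at x within {-1..1})" "x \<in> {-1..1}"
  shows "prim h x z = G x - G 0"
proof -
  have sub: "(\<lambda>\<tau>. \<tau> * x) ` {0..1} \<subseteq> {-1..1}"
    using scale_in_Icc[OF _ assms(2)] by blast
  have "((\<lambda>\<tau>. x *\<^sub>R h (\<tau> * x) z) has_integral (G \<circ> (\<lambda>\<tau>. \<tau> * x)) 1 - (G \<circ> (\<lambda>\<tau>. \<tau> * x)) 0) {0..1}"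
  proof (rule fundamental_theorem_of_calculus)
    fix \<tau> :: real assume \<tau>: "\<tau> \<in> {0..1}"
    have "((\<lambda>\<tau>. \<tau> * x) has_vector_derivative x) (at \<tau> within {0..1})"
      by (auto intro!: derivative_eq_intros)
    moreover have "(G has_vector_derivative h (\<tau> * x) z) (at (\<tau> * x) within (\<lambda>\<tau>. \<tau> * x) ` {0..1})"
      using sub \<tau> by (intro has_vector_derivative_within_subset[OF assms(1) sub]) blast
    ultimately show "(G \<circ> (\<lambda>\<tau>. \<tau> * x) has_vector_derivative x *\<^sub>R h (\<tau> * x) z) (at \<tau> within {0..1})"
      by (rule vector_diff_chain_within)
  qed auto
  from integral_unique[OF this] show ?thesis
    by (simp add: prim_def scaleR_conv_of_real)
qed

lemma prim_has_vector_derivative: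
  assumes "hol_family \<Omega> h" "z \<in> \<Omega>" "x \<in> {-1..1}"
  shows "((\<lambda>x. prim h x z) has_vector_derivative h x z) (at x within {-1..1})"
proof -
  obtain G where G: "\<And>x. x \<in> {-1..1} \<Longrightarrow> (G has_vector_derivative h x z) (at x within {-1..1})"
    using antiderivative_continuous[OF hol_family_continuous_x[OF assms(1,2)]] by metis
  have "((\<lambda>x. G x - G 0) has_vector_derivative h x z) (at x within {-1..1})"
    using G[OF assms(3)] by (auto intro!: derivative_eq_intros)
  thus ?thesis
  proof (rule has_vector_derivative_transform[OF assms(3), rotated])
    fix y :: real assume "y \<in> {-1..1}"
    thus "prim h y z = G y - G 0"
      by (intro prim_eq_antiderivative G)
  qed
qed

lemma hol_family_prim:
  assumes \<Omega>: "open \<Omega>" and h: "hol_family \<Omega> h"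
  shows "hol_family \<Omega> (prim h)"
    and "\<And>x z. x \<in> {-1..1} \<Longrightarrow> z \<in> \<Omega> \<Longrightarrow> dz (prim h) x z = prim (dz h) x z"
proof -
  have "continuous_on ({-1..1} \<times> \<Omega>) (\<lambda>p. integral (cbox 0 1) (\<lambda>\<tau>. (\<lambda>(x, z) \<tau>. h (\<tau> * x) z) p \<tau>))"
    using prim_integrand_continuous[OF h] by (intro integral_continuous_on_param) (simp add: case_prod_unfold)
  hence cont: "continuous_on ({-1..1} \<times> \<Omega>) (\<lambda>(x, z). prim h x z)"
    unfolding prim_def case_prod_unfold by (intro continuous_intros) auto
  have deriv: "(prim h x has_field_derivative prim (dz h) x z) (at z)" if x: "x \<in> {-1..1}" and z: "z \<in> \<Omega>" for x z
  proof -
    obtain r where r: "r > 0" "ball z r \<subseteq> \<Omega>"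
      using \<Omega> z open_contains_ball by blast
    note \<tau>x = scale_in_Icc[OF _ x]
    have "((\<lambda>z. integral (cbox 0 1) (\<lambda>\<tau>. h (\<tau> * x) z)) has_field_derivative
            integral (cbox 0 1) (\<lambda>\<tau>. dz h (\<tau> * x) z)) (at z within ball z r)"
    proof (rule leibniz_rule_field_derivative)
      fix w \<tau> assume "w \<in> ball z r" "\<tau> \<in> cbox 0 (1::real)"
      thus "((\<lambda>z. h (\<tau> * x) z) has_field_derivative dz h (\<tau> * x) w) (at w within ball z r)"
        using r \<tau>x
        by (intro has_field_derivative_at_within[OF hol_family_has_field_derivative[OF \<Omega> h]]) auto
    next
      fix w assume "w \<in> ball z r"
      hence "continuous_on {0..1} ((\<lambda>x. h x w) \<circ> (\<lambda>\<tau>. \<tau> * x))"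
        using r \<tau>x by (intro continuous_on_compose continuous_intros
            continuous_on_subset[OF hol_family_continuous_x[OF h]]) auto
      thus "(\<lambda>\<tau>. h (\<tau> * x) w) integrable_on cbox 0 1"
        by (auto simp: o_def intro: integrable_continuous_real)
    next
      have "continuous_on (ball z r \<times> cbox 0 1) ((\<lambda>((x, z), \<tau>). dz h (\<tau> * x) z) \<circ> (\<lambda>p. ((x, fst p), snd p)))"
        using r x by (intro continuous_on_compose continuous_intros
            continuous_on_subset[OF prim_integrand_continuous[OF hol_family_dz[OF \<Omega> h]]]) auto
      thus "continuous_on (ball z r \<times> cbox 0 1) (\<lambda>(z, \<tau>). dz h (\<tau> * x) z)"
        by (simp add: o_def case_prod_unfold)
    qed (use r in auto)
    hence "((\<lambda>z. integral {0..1} (\<lambda>\<tau>. h (\<tau> * x) z)) has_field_derivative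
            integral {0..1} (\<lambda>\<tau>. dz h (\<tau> * x) z)) (at z)"
      using r at_within_open[of z "ball z r"] by simp
    from DERIV_cmult[OF this, of "of_real x"] show ?thesis
      unfolding prim_def[abs_def] .
  qed
  show "hol_family \<Omega> (prim h)"
    unfolding hol_family_def holomorphic_on_open[OF \<Omega>] using cont deriv by blast
  show "dz (prim h) x z = prim (dz h) x z" if "x \<in> {-1..1}" "z \<in> \<Omega>" for x z
    using DERIV_imp_deriv[OF deriv[OF that]] by (simp add: dz_def)
qed

definition x_deriv :: "complex set \<Rightarrow> family \<Rightarrow> family \<Rightarrow> bool" where
  "x_deriv \<Omega> f g \<longleftrightarrow>
     (\<forall>z\<in>\<Omega>. \<forall>x\<in>{-1..1}. ((\<lambda>x. f x z) has_vector_derivative g x z) (at x within {-1..1}))"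

text \<open>Mixed derivatives commute: \<open>f y w = prim g y w + f 0 w\<close> reduces the claim
  to the parameter derivative of \<open>prim\<close>.\<close>

lemma x_deriv_dz:
  assumes \<Omega>: "open \<Omega>" and f: "hol_family \<Omega> f" and g: "hol_family \<Omega> g" and fg: "x_deriv \<Omega> f g"
  shows "x_deriv \<Omega> (dz f) (dz g)"
  unfolding x_deriv_def
proof (intro ballI)
  fix z x assume z: "z \<in> \<Omega>" and x: "x \<in> {-1..1::real}"
  have eq: "f y w = prim g y w + f 0 w" if "y \<in> {-1..1}" "w \<in> \<Omega>" for y w
    using prim_eq_antiderivative[of "\<lambda>x. f x w" g w y] that fg by (simp add: x_deriv_def)
  have "dz f y z = prim (dz g) y z + dz f 0 z" if y: "y \<in> {-1..1}" for y
  proof -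
    have "(f y has_field_derivative prim (dz g) y z + dz f 0 z) (at z)"
    proof (rule has_field_derivative_transform_within_open[OF _ \<Omega> z])
      show "((\<lambda>w. prim g y w + f 0 w) has_field_derivative prim (dz g) y z + dz f 0 z) (at z)"
        using hol_family_has_field_derivative[OF \<Omega> hol_family_prim(1)[OF \<Omega> g] y z]
          hol_family_has_field_derivative[OF \<Omega> f _ z, of 0]
        by (auto intro!: derivative_eq_intros simp: hol_family_prim(2)[OF \<Omega> g y z])
    qed (use eq[OF y] in simp)
    thus ?thesis by (simp add: dz_def DERIV_imp_deriv)
  qed
  note eq' = this
  have "((\<lambda>y. prim (dz g) y z + dz f 0 z) has_vector_derivative dz g x z) (at x within {-1..1})"
    by (auto intro!: derivative_eq_intros prim_has_vector_derivative[OF hol_family_dz[OF \<Omega> g] z x])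
  thus "((\<lambda>x. dz f x z) has_vector_derivative dz g x z) (at x within {-1..1})"
    by (rule has_vector_derivative_transform[OF x, rotated]) (rule eq')
qed

lemma x_deriv_rescaled_within:
  assumes "x_deriv \<Omega> f g" "z \<in> \<Omega>" "x \<in> {0..1}"
  shows "((\<lambda>x. f (2 * x - 1) z) has_vector_derivative 2 * g (2 * x - 1) z) (at x within {0..1})"
proof -
  have img: "(\<lambda>x. 2 * x - 1) ` {0..1::real} \<subseteq> {-1..1}" by auto
  have "((\<lambda>x. f x z) has_vector_derivative g (2 * x - 1) z) (at (2 * x - 1) within (\<lambda>x. 2 * x - 1) ` {0..1})"
    using assms by (intro has_vector_derivative_within_subset[OF _ img]) (auto simp: x_deriv_def)
  moreover have "((\<lambda>x. 2 * x - 1) has_vector_derivative 2) (at x within {0..1})"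
    by (auto intro!: derivative_eq_intros)
  ultimately have "((\<lambda>x. f x z) \<circ> (\<lambda>x. 2 * x - 1) has_vector_derivative 2 *\<^sub>R g (2 * x - 1) z) (at x within {0..1})"
    by (intro vector_diff_chain_within)
  thus ?thesis by (simp add: o_def scaleR_conv_of_real)
qed

lemma x_deriv_rescaled:
  assumes "x_deriv \<Omega> f g" "z \<in> \<Omega>" "x \<in> {0<..<1}"
  shows "((\<lambda>x. f (2 * x - 1) z) has_vector_derivative 2 * g (2 * x - 1) z) (at x)"
  using x_deriv_rescaled_within[OF assms(1,2), of x] assms(3) by (simp add: at_within_Icc_at)

lemma continuous_on_rescaled:
  fixes F :: "real \<Rightarrow> complex"
  assumes "continuous_on {-1..1} F"
  shows "continuous_on {0..1} (\<lambda>x. F (2 * x - 1))"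
proof -
  have "continuous_on {0..1} (F \<circ> (\<lambda>x. 2 * x - 1))"
    by (intro continuous_on_compose continuous_intros continuous_on_subset[OF assms]) auto
  thus ?thesis by (simp add: o_def)
qed

text \<open>The derivatives of the curve are the iterated complex derivatives in the parameter.
  Their difference quotients converge uniformly in \<open>x\<close>, and so do those of the two
  \<open>x\<close>-derivatives, which controls the \<open>H^2\<close> norm.\<close>

lemma smooth_hol_family:
  fixes I :: "real set"
  assumes \<Omega>: "open \<Omega>" "of_real ` I \<subseteq> \<Omega>"
    and fam: "hol_family \<Omega> f" "hol_family \<Omega> f1" "hol_family \<Omega> f2" "hol_family \<Omega> g"
    and der: "x_deriv \<Omega> f f1" "x_deriv \<Omega> f1 f2"
  shows "smooth_H2_L2 {0<..<1} I (\<lambda>\<omega> x. f (2 * x - 1) (of_real \<omega>)) (\<lambda>\<omega> x. g (2 * x - 1) (of_real \<omega>))"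
proof -
  let ?S = "{0<..<1::real}"
  define V where "V k \<omega> x = (dz ^^ k) f (2 * x - 1) (of_real \<omega>)" for k \<omega> x
  define W where "W k \<omega> x = (dz ^^ k) g (2 * x - 1) (of_real \<omega>)" for k \<omega> x
  have famk: "hol_family \<Omega> ((dz ^^ k) F)" if "hol_family \<Omega> F" for F k
    by (induction k) (use that hol_family_dz[OF \<Omega>(1)] in auto)
  have derk: "x_deriv \<Omega> ((dz ^^ k) F) ((dz ^^ k) G)"
    if "x_deriv \<Omega> F G" "hol_family \<Omega> F" "hol_family \<Omega> G" for F G k
    by (induction k) (use that x_deriv_dz[OF \<Omega>(1)] famk in auto)
  let ?N = "\<lambda>k t s. H2_L2_norm ?S (\<lambda>x. (V k s x - V k t x) /\<^sub>R (s - t) - V (Suc k) t x)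
                  (\<lambda>x. (W k s x - W k t x) /\<^sub>R (s - t) - W (Suc k) t x)"
  have H2: "V k t \<in> H2_space ?S" and L2: "W k t \<in> L2_space ?S" if t: "t \<in> I" for k t
  proof -
    have t': "of_real t \<in> \<Omega>" using \<Omega> t by auto
    note cont = continuous_on_rescaled[OF hol_family_continuous_x[OF famk t']]
    show "V k t \<in> H2_space ?S"
    proof (rule classical_H2(1))
      show "(V k t has_vector_derivative 2 * (dz ^^ k) f1 (2 * x - 1) t) (at x)" if "x \<in> {0<..<1}" for x
        unfolding V_def[abs_def] by (rule x_deriv_rescaled[OF derk t' that]) (use fam der in auto)
      show "((\<lambda>x. 2 * (dz ^^ k) f1 (2 * x - 1) (of_real t)) has_vector_derivative
               2 * (2 * (dz ^^ k) f2 (2 * x - 1) t)) (at x)" if "x \<in> {0<..<1}" for x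
        by (intro has_vector_derivative_mult_right x_deriv_rescaled[OF derk t' that]) (use fam der in auto)
    qed (unfold V_def[abs_def], auto intro!: continuous_intros cont fam)
    show "W k t \<in> L2_space ?S"
      unfolding W_def[abs_def] by (intro continuous_in_L2_space cont fam)
  qed
  have lim: "((\<lambda>s. ?N k t s) \<longlongrightarrow> 0) (at t within I)"
    if t: "t \<in> I" for k t
  proof (rule tendstoI)
    fix e :: real assume e: "e > 0"
    have t': "of_real t \<in> \<Omega>" using \<Omega> t by auto
    \<comment> \<open>Rescaling to \<open>{0..1}\<close> multiplies the successive
      \<open>x\<close>-derivatives by 1, 2, 4, and the root of 1 + 4 + 16 + 1 is below 5.\<close>
    define \<epsilon> where "\<epsilon> = e / 6"
    have \<epsilon>: "\<epsilon> > 0" using e by (simp add: \<epsilon>_def)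
    define Q where "Q F s y = ((dz ^^ k) F y (of_real s) - (dz ^^ k) F y (of_real t)) /\<^sub>R (s - t) - (dz ^^ Suc k) F y (of_real t)"
      for F s y
    have "\<exists>d>0. \<forall>s\<in>I. s \<noteq> t \<longrightarrow> dist s t < d \<longrightarrow> (\<forall>y\<in>{-1..1}. norm (Q F s y) \<le> \<epsilon>)" if F: "hol_family \<Omega> F" for F
    proof -
      from hol_family_uniform_derivative[OF \<Omega>(1) famk[OF F] t' \<epsilon>, of k]
      obtain d where d: "d > 0" "\<And>s x. s \<noteq> of_real t \<Longrightarrow> dist s (of_real t) < d \<Longrightarrow> x \<in> {-1..1} \<Longrightarrow>
           norm (((dz ^^ k) F x s - (dz ^^ k) F x (of_real t)) / (s - of_real t) - dz ((dz ^^ k) F) x (of_real t)) \<le> \<epsilon>"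
        by metis
      have "norm (Q F s y) \<le> \<epsilon>" if "s \<noteq> t" "dist s t < d" "y \<in> {-1..1}" for s y
        using d(2)[of "of_real s" y] that
        by (simp add: Q_def scaleR_conv_of_real divide_inverse mult.commute dist_of_real)
      thus ?thesis using d(1) by blast
    qed note ex = this
    obtain d0 where d0: "d0 > 0"
      "\<forall>s\<in>I. s \<noteq> t \<longrightarrow> dist s t < d0 \<longrightarrow> (\<forall>y\<in>{-1..1}. norm (Q f s y) \<le> \<epsilon>)"
      using ex[OF fam(1)] by blast
    obtain d1 where d1: "d1 > 0"
      "\<forall>s\<in>I. s \<noteq> t \<longrightarrow> dist s t < d1 \<longrightarrow> (\<forall>y\<in>{-1..1}. norm (Q f1 s y) \<le> \<epsilon>)"
      using ex[OF fam(2)] by blast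
    obtain d2 where d2: "d2 > 0"
      "\<forall>s\<in>I. s \<noteq> t \<longrightarrow> dist s t < d2 \<longrightarrow> (\<forall>y\<in>{-1..1}. norm (Q f2 s y) \<le> \<epsilon>)"
      using ex[OF fam(3)] by blast
    obtain d3 where d3: "d3 > 0"
      "\<forall>s\<in>I. s \<noteq> t \<longrightarrow> dist s t < d3 \<longrightarrow> (\<forall>y\<in>{-1..1}. norm (Q g s y) \<le> \<epsilon>)"
      using ex[OF fam(4)] by blast
    define d where "d = min (min d0 d1) (min d2 d3)"
    have "dist (?N k t s) 0 < e"
      if s: "s \<in> I" "s \<noteq> t" "dist s t < d" for s
    proof -
      have s': "of_real s \<in> \<Omega>" using \<Omega> s by auto
      have contQ: "continuous_on {0..1} (\<lambda>x. Q F s (2 * x - 1))" if "hol_family \<Omega> F" for F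
        unfolding Q_def
        by (intro continuous_intros continuous_on_rescaled[OF hol_family_continuous_x[OF famk[OF that] s']]
              continuous_on_rescaled[OF hol_family_continuous_x[OF famk[OF that] t']])
      have derQ: "((\<lambda>x. Q F s (2 * x - 1)) has_vector_derivative 2 * Q G s (2 * x - 1)) (at x)"
        if "x_deriv \<Omega> F G" "hol_family \<Omega> F" "hol_family \<Omega> G" "x \<in> {0<..<1}" for F G x
      proof -
        note D = x_deriv_rescaled[OF derk[OF that(1-3)] _ that(4)]
        have "((\<lambda>x. inverse (s - t) *\<^sub>R ((dz ^^ k) F (2 * x - 1) (of_real s) - (dz ^^ k) F (2 * x - 1) (of_real t))
                 - (dz ^^ Suc k) F (2 * x - 1) (of_real t)) has_vector_derivative
              inverse (s - t) *\<^sub>R (2 * (dz ^^ k) G (2 * x - 1) (of_real s) - 2 * (dz ^^ k) G (2 * x - 1) (of_real t))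
                 - 2 * (dz ^^ Suc k) G (2 * x - 1) (of_real t)) (at x)"
          using D[OF s', of k] D[OF t', of k] D[OF t', of "Suc k"]
          by (intro has_vector_derivative_diff bounded_linear.has_vector_derivative[OF bounded_linear_scaleR_right])
        thus ?thesis by (simp add: Q_def algebra_simps)
      qed
      have sup: "L2_norm ?S (\<lambda>x. Q f s (2 * x - 1)) \<le> \<epsilon>" "L2_norm ?S (\<lambda>x. 2 * Q f1 s (2 * x - 1)) \<le> 2 * \<epsilon>"
        "L2_norm ?S (\<lambda>x. 2 * (2 * Q f2 s (2 * x - 1))) \<le> 4 * \<epsilon>" "L2_norm ?S (\<lambda>x. Q g s (2 * x - 1)) \<le> \<epsilon>"
        using s d0 d1 d2 d3 fam
        by (auto intro!: L2_norm_le_sup continuous_intros contQ simp: d_def norm_mult)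
      have nn: "L2_norm ?S F \<ge> 0" for F by (simp add: L2_norm_def)
      have "(\<lambda>x. (V k s x - V k t x) /\<^sub>R (s - t) - V (Suc k) t x) = (\<lambda>x. Q f s (2 * x - 1))"
        "(\<lambda>x. (W k s x - W k t x) /\<^sub>R (s - t) - W (Suc k) t x) = (\<lambda>x. Q g s (2 * x - 1))"
        by (simp_all add: V_def W_def Q_def)
      moreover have "H2_norm ?S (\<lambda>x. Q f s (2 * x - 1)) = sqrt ((L2_norm ?S (\<lambda>x. Q f s (2 * x - 1)))\<^sup>2
          + (L2_norm ?S (\<lambda>x. 2 * Q f1 s (2 * x - 1)))\<^sup>2 + (L2_norm ?S (\<lambda>x. 2 * (2 * Q f2 s (2 * x - 1))))\<^sup>2)"
      proof (rule classical_H2(2))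
        show "((\<lambda>x. 2 * Q f1 s (2 * x - 1)) has_vector_derivative 2 * (2 * Q f2 s (2 * x - 1))) (at x)"
          if "x \<in> {0<..<1}" for x
          by (intro has_vector_derivative_mult_right derQ der fam that)
      qed (auto intro!: continuous_intros contQ derQ simp: fam der)
      ultimately have "?N k t s
          = sqrt (((L2_norm ?S (\<lambda>x. Q f s (2 * x - 1)))\<^sup>2 + (L2_norm ?S (\<lambda>x. 2 * Q f1 s (2 * x - 1)))\<^sup>2
              + (L2_norm ?S (\<lambda>x. 2 * (2 * Q f2 s (2 * x - 1))))\<^sup>2) + (L2_norm ?S (\<lambda>x. Q g s (2 * x - 1)))\<^sup>2)"
        by (simp add: H2_L2_norm_def)
      also have "\<dots> \<le> sqrt ((\<epsilon>\<^sup>2 + (2 * \<epsilon>)\<^sup>2 + (4 * \<epsilon>)\<^sup>2) + \<epsilon>\<^sup>2)"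
        by (intro real_sqrt_le_mono add_mono power_mono sup nn)
      also have "\<dots> \<le> 5 * \<epsilon>"
        using \<epsilon> by (intro real_le_lsqrt) (auto simp: power2_eq_square)
      also have "\<dots> < e" using e by (simp add: \<epsilon>_def)
      finally show ?thesis by (simp add: H2_L2_norm_def H2_norm_def)
    qed
    moreover have "d > 0" using d0 d1 d2 d3 by (simp add: d_def)
    ultimately show "eventually (\<lambda>s. dist (?N k t s) 0 < e) (at t within I)"
      unfolding eventually_at by blast
  qed
  show ?thesis
    unfolding smooth_H2_L2_def
  proof (rule exI[of _ V], rule exI[of _ W], intro conjI allI ballI H2 L2 lim)
    show "V 0 = (\<lambda>\<omega> x. f (2 * x - 1) (of_real \<omega>))" "W 0 = (\<lambda>\<omega> x. g (2 * x - 1) (of_real \<omega>))"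
      by (simp_all add: V_def W_def fun_eq_iff)
  qed
qed

section \<open>A contraction principle for families\<close>

text \<open>Here \<sigma> is the parity sign. Reality for real parameters is carried along because
  it is what separates the system into real and imaginary parts; all three properties survive
  uniform limits.\<close>

definition adm :: "real \<Rightarrow> family \<Rightarrow> bool" where
  "adm \<sigma> h \<longleftrightarrow> hol_family (ball 0 1) h \<and>
     (\<forall>x\<in>{-1..1}. \<forall>z\<in>ball 0 1. h (- x) z = of_real \<sigma> * h x z) \<and>
     (\<forall>x\<in>{-1..1}. \<forall>z\<in>ball 0 1. z \<in> \<real> \<longrightarrow> h x z \<in> \<real>)"

lemma adm_hol_family: "adm \<sigma> h \<Longrightarrow> hol_family (ball 0 1) h"
  by (simp add: adm_def)

lemma hol_family_const [intro]:
  assumes "f holomorphic_on \<Omega>"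
  shows "hol_family \<Omega> (\<lambda>x. f)"
proof -
  have "continuous_on ({-1..1} \<times> \<Omega>) (f \<circ> snd)"
    by (intro continuous_on_compose continuous_intros continuous_on_subset[OF holomorphic_on_imp_continuous_on[OF assms]]) auto
  thus ?thesis using assms by (simp add: hol_family_def o_def case_prod_unfold)
qed

lemma hol_family_of_real: "hol_family \<Omega> (\<lambda>x z. of_real x)"
  by (auto simp: hol_family_def case_prod_unfold intro!: continuous_intros holomorphic_intros)

lemma hol_family_add: "hol_family \<Omega> f \<Longrightarrow> hol_family \<Omega> g \<Longrightarrow> hol_family \<Omega> (\<lambda>x z. f x z + g x z)"
  and hol_family_diff: "hol_family \<Omega> f \<Longrightarrow> hol_family \<Omega> g \<Longrightarrow> hol_family \<Omega> (\<lambda>x z. f x z - g x z)"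
  and hol_family_mult: "hol_family \<Omega> f \<Longrightarrow> hol_family \<Omega> g \<Longrightarrow> hol_family \<Omega> (\<lambda>x z. f x z * g x z)"
  by (auto simp: hol_family_def case_prod_unfold intro!: continuous_intros holomorphic_intros)

lemma hol_family_uniform_limit:
  assumes \<Omega>: "open \<Omega>" and h: "\<And>n. hol_family \<Omega> (h n)"
    and lim: "uniform_limit ({-1..1} \<times> \<Omega>) (\<lambda>n (x, z). h n x z) (\<lambda>(x, z). l x z) sequentially"
  shows "hol_family \<Omega> l"
  unfolding hol_family_def
proof (intro conjI ballI)
  show "continuous_on ({-1..1} \<times> \<Omega>) (\<lambda>(x, z). l x z)"
    using h by (intro uniform_limit_theorem[OF _ lim]) (auto simp: hol_family_def)
  fix x :: real assume x: "x \<in> {-1..1}"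
  have lim_x: "uniform_limit \<Omega> (\<lambda>n z. h n x z) (\<lambda>z. l x z) sequentially"
    using lim x unfolding uniform_limit_iff by (fastforce elim: eventually_mono)
  show "l x holomorphic_on \<Omega>"
  proof (rule holomorphic_uniform_sequence[OF \<Omega>])
    show "h n x holomorphic_on \<Omega>" for n using h x by (simp add: hol_family_def)
    fix z assume "z \<in> \<Omega>"
    then obtain d where "d > 0" "cball z d \<subseteq> \<Omega>"
      using \<Omega> open_contains_cball by blast
    thus "\<exists>d>0. cball z d \<subseteq> \<Omega> \<and> uniform_limit (cball z d) (\<lambda>n. h n x) (l x) sequentially"
      using uniform_limit_on_subset[OF lim_x] by blast
  qed
qed

lemma adm_uniform_limit:
  assumes h: "\<And>n. adm \<sigma> (h n)"
    and lim: "uniform_limit ({-1..1} \<times> ball 0 1) (\<lambda>n (x, z). h n x z) (\<lambda>(x, z). l x z) sequentially"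
  shows "adm \<sigma> l"
  unfolding adm_def
proof (intro conjI ballI impI)
  show "hol_family (ball 0 1) l"
    using h by (intro hol_family_uniform_limit[OF _ _ lim]) (auto simp: adm_def)
  have tend: "(\<lambda>n. h n x z) \<longlonglongrightarrow> l x z" if "x \<in> {-1..1}" "z \<in> ball 0 1" for x z
    using tendsto_uniform_limitI[OF lim, of "(x, z)"] that by auto
  fix x :: real and z :: complex assume xz: "x \<in> {-1..1}" "z \<in> ball 0 1"
  have "(\<lambda>n. of_real \<sigma> * h n x z) \<longlonglongrightarrow> l (- x) z"
    using tend[of "- x" z] h xz by (simp add: adm_def)
  moreover have "(\<lambda>n. of_real \<sigma> * h n x z) \<longlonglongrightarrow> of_real \<sigma> * l x z"
    by (intro tendsto_intros tend xz)
  ultimately show "l (- x) z = of_real \<sigma> * l x z"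
    using LIMSEQ_unique by blast
  assume "z \<in> \<real>"
  thus "l x z \<in> \<real>"
    using h xz by (intro closed_sequentially[OF closed_complex_Reals _ tend[OF xz]]) (auto simp: adm_def)
qed

definition in_ball :: "nat \<Rightarrow> (nat \<Rightarrow> real \<Rightarrow> real) \<Rightarrow> real \<Rightarrow> (nat \<Rightarrow> family) \<Rightarrow> bool" where
  "in_ball N w c h \<longleftrightarrow> (\<forall>i<N. \<forall>x\<in>{-1..1}. \<forall>z\<in>ball 0 1. norm (h i x z) \<le> c * w i x)"

text \<open>Picard iteration from 0, with \<open>in_ball\<close> applied to differences in the role
  of the metric. Values outside \<open>{-1..1}\<close> and the disc are not controlled, hence the
  fixed point equation is claimed only there.\<close>

theorem family_contraction:
  fixes T :: "(nat \<Rightarrow> family) \<Rightarrow> nat \<Rightarrow> family"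
  assumes w: "\<And>i x. i < N \<Longrightarrow> x \<in> {-1..1} \<Longrightarrow> w i x \<le> B" and w0: "\<And>i x. i < N \<Longrightarrow> x \<in> {-1..1} \<Longrightarrow> 0 \<le> w i x"
    and \<theta>: "0 \<le> \<theta>" "\<theta> < 1" and \<rho>: "\<rho> \<ge> 0"
    and adm_T: "\<And>h i. (\<And>i. i < N \<Longrightarrow> adm (\<sigma> i) (h i)) \<Longrightarrow> i < N \<Longrightarrow> adm (\<sigma> i) (T h i)"
    and T0: "in_ball N w ((1 - \<theta>) * \<rho>) (T (\<lambda>i x z. 0))"
    and contr: "\<And>h k c. (\<And>i. i < N \<Longrightarrow> adm (\<sigma> i) (h i)) \<Longrightarrow> (\<And>i. i < N \<Longrightarrow> adm (\<sigma> i) (k i)) \<Longrightarrow>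
       in_ball N w \<rho> h \<Longrightarrow> in_ball N w \<rho> k \<Longrightarrow> c \<ge> 0 \<Longrightarrow> in_ball N w c (\<lambda>i x z. h i x z - k i x z) \<Longrightarrow>
       in_ball N w (\<theta> * c) (\<lambda>i x z. T h i x z - T k i x z)"
  obtains h where "\<And>i. i < N \<Longrightarrow> adm (\<sigma> i) (h i)" "in_ball N w \<rho> h"
    "\<And>i x z. i < N \<Longrightarrow> x \<in> {-1..1} \<Longrightarrow> z \<in> ball 0 1 \<Longrightarrow> T h i x z = h i x z"
proof -
  define H where "H n = (T ^^ n) (\<lambda>i x z. 0)" for n
  have H_Suc: "H (Suc n) = T (H n)" for n by (simp add: H_def)
  have adm0: "adm s (\<lambda>x z. 0)" for s by (auto simp: adm_def)
  have admH: "adm (\<sigma> i) (H n i)" if "i < N" for i n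
    using that
  proof (induction n arbitrary: i)
    case (Suc n)
    show ?case unfolding H_Suc by (rule adm_T) (use Suc in auto)
  qed (simp add: H_def adm0)
  have H0: "in_ball N w \<rho> (H 0)"
    using \<rho> w0 by (auto simp: in_ball_def H_def)
  \<comment> \<open>The third conjunct is the partial sum of the geometric series; it is what keeps
    the next iterate in the ball of radius \<rho>.\<close>
  have step: "in_ball N w \<rho> (H n) \<and> in_ball N w (\<theta> ^ n * ((1 - \<theta>) * \<rho>)) (\<lambda>i x z. H (Suc n) i x z - H n i x z)
      \<and> in_ball N w ((1 - \<theta> ^ n) * \<rho>) (H n)" for n
  proof (induction n)
    case 0
    thus ?case using H0 T0 unfolding H_Suc by (auto simp: H_def in_ball_def)
  next
    case (Suc n)
    have "in_ball N w ((1 - \<theta> ^ Suc n) * \<rho>) (H (Suc n))"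
      unfolding in_ball_def
    proof (intro allI impI ballI)
      fix i x z assume *: "i < N" "x \<in> {-1..1::real}" "z \<in> ball (0::complex) 1"
      have "norm (H (Suc n) i x z) \<le> norm (H (Suc n) i x z - H n i x z) + norm (H n i x z)"
        using norm_triangle_ineq[of "H (Suc n) i x z - H n i x z" "H n i x z"] by simp
      also have "\<dots> \<le> \<theta> ^ n * ((1 - \<theta>) * \<rho>) * w i x + (1 - \<theta> ^ n) * \<rho> * w i x"
        using Suc * unfolding in_ball_def by (intro add_mono) auto
      also have "\<dots> = (1 - \<theta> ^ Suc n) * \<rho> * w i x" by (simp add: algebra_simps)
      finally show "norm (H (Suc n) i x z) \<le> (1 - \<theta> ^ Suc n) * \<rho> * w i x" .
    qed
    moreover have "(1 - \<theta> ^ Suc n) * \<rho> \<le> \<rho>"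
      using \<theta> \<rho> by (intro mult_left_le_one_le) (auto simp: power_le_one simp del: power_Suc)
    ultimately have B: "in_ball N w \<rho> (H (Suc n))"
      using w0 unfolding in_ball_def by (meson mult_right_mono order_trans)
    have "in_ball N w (\<theta> * (\<theta> ^ n * ((1 - \<theta>) * \<rho>))) (\<lambda>i x z. T (H (Suc n)) i x z - T (H n) i x z)"
      using Suc B \<theta> \<rho> by (intro contr admH) auto
    thus ?case
      using B \<open>in_ball N w ((1 - \<theta> ^ Suc n) * \<rho>) (H (Suc n))\<close> by (simp add: H_Suc mult.assoc)
  qed
  have geo: "in_ball N w (\<theta> ^ n * \<rho>) (\<lambda>i x z. H (n + m) i x z - H n i x z)" for n m
  proof -
    have "in_ball N w ((\<theta> ^ n - \<theta> ^ (n + m)) * \<rho>) (\<lambda>i x z. H (n + m) i x z - H n i x z)"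
    proof (induction m)
      case (Suc m)
      show ?case unfolding in_ball_def
      proof (intro allI impI ballI)
        fix i x z assume *: "i < N" "x \<in> {-1..1::real}" "z \<in> ball (0::complex) 1"
        have "norm (H (n + Suc m) i x z - H n i x z)
            \<le> norm (H (Suc (n + m)) i x z - H (n + m) i x z) + norm (H (n + m) i x z - H n i x z)"
          using norm_triangle_ineq[of "H (Suc (n + m)) i x z - H (n + m) i x z" "H (n + m) i x z - H n i x z"]
          by simp
        also have "\<dots> \<le> \<theta> ^ (n + m) * ((1 - \<theta>) * \<rho>) * w i x + (\<theta> ^ n - \<theta> ^ (n + m)) * \<rho> * w i x"
          using Suc step[of "n + m"] * unfolding in_ball_def by (intro add_mono) auto
        also have "\<dots> = (\<theta> ^ n - \<theta> ^ (n + Suc m)) * \<rho> * w i x" by (simp add: algebra_simps)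
        finally show "norm (H (n + Suc m) i x z - H n i x z) \<le> (\<theta> ^ n - \<theta> ^ (n + Suc m)) * \<rho> * w i x" .
      qed
    qed (simp add: in_ball_def)
    moreover have "(\<theta> ^ n - \<theta> ^ (n + m)) * \<rho> \<le> \<theta> ^ n * \<rho>"
      using \<theta> \<rho> by (intro mult_right_mono) auto
    ultimately show ?thesis
      using w0 unfolding in_ball_def by (meson mult_right_mono order_trans)
  qed
  define h where "h i x z = lim (\<lambda>n. H n i x z)" for i x z
  have pow0: "(\<lambda>n. \<theta> ^ n * \<rho> * (B + 1)) \<longlonglongrightarrow> 0 * \<rho> * (B + 1)"
    using \<theta> by (intro tendsto_intros LIMSEQ_power_zero) auto
  have conv: "(\<lambda>n. H n i x z) \<longlonglongrightarrow> h i x z" if *: "i < N" "x \<in> {-1..1}" "z \<in> ball 0 1" for i x z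
  proof -
    have "Cauchy (\<lambda>n. H n i x z)"
    proof (rule metric_CauchyI)
      fix e :: real assume e: "e > 0"
      hence "eventually (\<lambda>n. \<theta> ^ n * \<rho> * (B + 1) < e / 2) sequentially"
        using pow0 by (intro order_tendstoD(2)) auto
      then obtain M where M: "\<theta> ^ M * \<rho> * (B + 1) < e / 2"
        unfolding eventually_sequentially by blast
      have "dist (H m i x z) (H M i x z) < e / 2" if "m \<ge> M" for m
      proof -
        have "norm (H (M + (m - M)) i x z - H M i x z) \<le> \<theta> ^ M * \<rho> * w i x"
          using geo[of M "m - M"] * unfolding in_ball_def by blast
        also have "\<dots> \<le> \<theta> ^ M * \<rho> * (B + 1)"
          using \<theta> \<rho> w[OF *(1,2)] by (intro mult_left_mono) auto
        finally show ?thesis using M that by (simp add: dist_norm)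
      qed
      thus "\<exists>M. \<forall>m\<ge>M. \<forall>n\<ge>M. dist (H m i x z) (H n i x z) < e"
        by (meson dist_triangle_half_l dist_commute_lessI)
    qed
    hence "convergent (\<lambda>n. H n i x z)" by (rule Cauchy_convergent)
    thus ?thesis unfolding h_def by (simp only: convergent_LIMSEQ_iff)
  qed
  have dist_h: "in_ball N w (\<theta> ^ n * \<rho>) (\<lambda>i x z. h i x z - H n i x z)" for n
    unfolding in_ball_def
  proof (intro allI impI ballI)
    fix i x z assume *: "i < N" "x \<in> {-1..1::real}" "z \<in> ball (0::complex) 1"
    have "(\<lambda>m. norm (H (m + n) i x z - H n i x z)) \<longlonglongrightarrow> norm (h i x z - H n i x z)"
      by (intro tendsto_intros LIMSEQ_ignore_initial_segment conv *)
    moreover have "norm (H (m + n) i x z - H n i x z) \<le> \<theta> ^ n * \<rho> * w i x" for m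
      using geo[of n m] * by (simp add: in_ball_def add.commute)
    ultimately show "norm (h i x z - H n i x z) \<le> \<theta> ^ n * \<rho> * w i x"
      by (intro LIMSEQ_le_const2) auto
  qed
  have unif: "uniform_limit ({-1..1} \<times> ball 0 1) (\<lambda>n (x, z). H n i x z) (\<lambda>(x, z). h i x z) sequentially"
    if i: "i < N" for i
  proof (rule uniform_limitI)
    fix e :: real assume e: "e > 0"
    hence "eventually (\<lambda>n. \<theta> ^ n * \<rho> * (B + 1) < e) sequentially"
      using pow0 by (intro order_tendstoD(2)) auto
    thus "eventually (\<lambda>n. \<forall>p\<in>{-1..1} \<times> ball 0 1. dist ((\<lambda>(x, z). H n i x z) p) ((\<lambda>(x, z). h i x z) p) < e) sequentially"
    proof (eventually_elim, safe)
      fix n x z assume n: "\<theta> ^ n * \<rho> * (B + 1) < e" and *: "x \<in> {-1..1::real}" "z \<in> ball (0::complex) 1"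
      have "norm (h i x z - H n i x z) \<le> \<theta> ^ n * \<rho> * w i x"
        using dist_h[of n] i * unfolding in_ball_def by blast
      also have "\<dots> \<le> \<theta> ^ n * \<rho> * (B + 1)"
        using \<theta> \<rho> w[OF i *(1)] by (intro mult_left_mono) auto
      finally show "dist (H n i x z) (h i x z) < e"
        using n by (simp add: dist_norm norm_minus_commute)
    qed
  qed
  have admh: "adm (\<sigma> i) (h i)" if "i < N" for i
    by (rule adm_uniform_limit[OF admH[OF that] unif[OF that]])
  have ballh: "in_ball N w \<rho> h"
    using dist_h[of 0] by (simp add: H_def)
  have fixp: "T h i x z = h i x z" if *: "i < N" "x \<in> {-1..1}" "z \<in> ball 0 1" for i x z
  proof -
    have le: "norm (T h i x z - H (Suc n) i x z) \<le> \<theta> ^ n * \<rho> * (B + 1)" for n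
    proof -
      have "in_ball N w (\<theta> * (\<theta> ^ n * \<rho>)) (\<lambda>i x z. T h i x z - T (H n) i x z)"
        using step[of n] dist_h[of n] \<theta> \<rho> by (intro contr admh admH ballh) auto
      hence "norm (T h i x z - H (Suc n) i x z) \<le> \<theta> * (\<theta> ^ n * \<rho>) * w i x"
        using * unfolding in_ball_def H_Suc by blast
      also have "\<dots> \<le> (\<theta> ^ n * \<rho>) * (B + 1)"
        using \<theta> \<rho> w[OF *(1,2)] w0[OF *(1,2)] by (intro mult_mono mult_left_le_one_le) auto
      finally show ?thesis .
    qed
    have "(\<lambda>n. T h i x z - H (Suc n) i x z) \<longlonglongrightarrow> 0"
      by (rule Lim_null_comparison[OF always_eventually[OF allI[OF le]]]) (use pow0 in simp)
    moreover have "(\<lambda>n. T h i x z - H (Suc n) i x z) \<longlonglongrightarrow> T h i x z - h i x z"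
      by (rule tendsto_diff[OF tendsto_const LIMSEQ_Suc[OF conv[OF *]]])
    ultimately show ?thesis
      using LIMSEQ_unique by fastforce
  qed
  show ?thesis
    by (rule that[of h]) (use admh ballh fixp in auto)
qed

section \<open>Bivariate integer polynomials as nested lists\<close>

fun padd :: "int list \<Rightarrow> int list \<Rightarrow> int list" where
  "padd [] q = q"
| "padd (a # p) [] = a # p"
| "padd (a # p) (b # q) = (a + b) # padd p q"

fun psm :: "int \<Rightarrow> int list \<Rightarrow> int list" where
  "psm c [] = []"
| "psm c (a # p) = c * a # psm c p"

fun pmul :: "int list \<Rightarrow> int list \<Rightarrow> int list" where
  "pmul [] q = []"
| "pmul (a # p) q = padd (psm a q) (0 # pmul p q)"

fun l1 :: "int list \<Rightarrow> int" where
  "l1 [] = 0"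
| "l1 (a # p) = \<bar>a\<bar> + l1 p"

text \<open>Outer positions are powers of \<open>x^2 - 1/2\<close>, inner ones powers of
  \<open>t\<close>. Odd functions are stored without their factor \<open>x\<close>, so that all
  products, with \<open>x^2\<close> rewritten in this variable, are again such lists.\<close>

type_synonym bipoly = "int list list"

fun badd :: "bipoly \<Rightarrow> bipoly \<Rightarrow> bipoly" where
  "badd [] Q = Q"
| "badd (p # P) [] = p # P"
| "badd (p # P) (q # Q) = padd p q # badd P Q"

fun bsm :: "int \<Rightarrow> bipoly \<Rightarrow> bipoly" where
  "bsm c [] = []"
| "bsm c (p # P) = psm c p # bsm c P"

fun bpm :: "int list \<Rightarrow> bipoly \<Rightarrow> bipoly" where
  "bpm q [] = []"
| "bpm q (p # P) = pmul q p # bpm q P"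

fun bmul :: "bipoly \<Rightarrow> bipoly \<Rightarrow> bipoly" where
  "bmul [] Q = []"
| "bmul (p # P) Q = badd (bpm p Q) ([] # bmul P Q)"

fun bder :: "bipoly \<Rightarrow> bipoly" where
  "bder [] = []"
| "bder (p # P) = badd P ([] # bder P)"

fun pow4 :: "'a list \<Rightarrow> int" where
  "pow4 [] = 1"
| "pow4 (x # xs) = 4 * pow4 xs"

fun pow2 :: "'a list \<Rightarrow> int" where
  "pow2 [] = 1"
| "pow2 (x # xs) = 2 * pow2 xs"

text \<open>A list \<open>c\<^sub>0 # c\<^sub>1 # \<dots>\<close> also encodes the cosine sum \<open>c\<^sub>0 + \<Sum>\<^sub>k 2 c\<^sub>k cos k\<theta>\<close>;
  \<open>mul_cos\<close> multiplies it by \<open>2 cos \<theta>\<close>.\<close>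

fun dbl_head :: "bipoly \<Rightarrow> bipoly" where
  "dbl_head [] = []"
| "dbl_head (c # C) = psm 2 c # C"

fun mul_cos :: "bipoly \<Rightarrow> bipoly" where
  "mul_cos [] = []"
| "mul_cos (c # C) = badd ([] # c # C) (dbl_head C)"

text \<open>Horner's scheme at \<open>z = cos \<theta> / 2\<close>: as \<open>4 * z\<close> is
  \<open>2 * cos \<theta>\<close>, one factor 4 per row turns each step into \<open>mul_cos\<close>
  and keeps the coefficients integral.\<close>

fun to_cos :: "bipoly \<Rightarrow> bipoly" where
  "to_cos [] = []"
| "to_cos (p # P) = badd (mul_cos (to_cos P)) [psm (pow4 (p # P)) p]"

fun sum_l1 :: "bipoly \<Rightarrow> int" where
  "sum_l1 [] = 0"
| "sum_l1 (p # P) = l1 p + sum_l1 P"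

fun cos_l1 :: "bipoly \<Rightarrow> int" where
  "cos_l1 [] = 0"
| "cos_l1 (p # P) = l1 p + 2 * sum_l1 P"

definition sup_le :: "bipoly \<Rightarrow> int \<Rightarrow> bool" where
  "sup_le P m \<longleftrightarrow> cos_l1 (to_cos P) \<le> m * pow4 P"

text \<open>The value at \<open>z = 1 / 2\<close>, which is the end point \<open>x = 1\<close>, with
  one factor 2 per row to clear denominators.\<close>

fun at_half :: "bipoly \<Rightarrow> int list" where
  "at_half [] = []"
| "at_half (p # P) = padd (psm (pow2 (p # P)) p) (at_half P)"

definition half_le :: "bipoly \<Rightarrow> int \<Rightarrow> bool" where
  "half_le P m \<longleftrightarrow> l1 (at_half P) \<le> m * pow2 P"

text \<open>The second derivative of \<open>L (x^2 - 1/2)\<close> is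
  \<open>4 x^2 L'' + 2 L'\<close>, and that of \<open>x * L (x^2 - 1/2)\<close> is \<open>x\<close>
  times \<open>4 x^2 L'' + 6 L'\<close>. So \<open>e\<close> is 2 or 6, and
  \<open>[[2], [4]]\<close> stands for \<open>4 x^2\<close>.\<close>

definition d2 :: "int \<Rightarrow> bipoly \<Rightarrow> bipoly" where
  "d2 e P = badd (bmul [[2], [4]] (bder (bder P))) (bsm e (bder P))"

text \<open>The residuals with denominators cleared: \<open>D\<close> is the common denominator of
  the lists, \<open>[[33, 34]]\<close> is 16 times omega^2, and 64 combines this 16 with the 4 from
  \<open>y = 2x - 1\<close>. A product of two odd functions brings in \<open>[[1], [2]]\<close>,
  which is \<open>2 x^2\<close>.\<close>

definition res_p where
  "res_p D P Q R S = badd (bsm (64 * D) (d2 2 P)) (badd (bsm D (bmul [[33, 34]] P))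
     (badd (bsm 16 (bmul R P)) (bsm 8 (bmul [[1], [2]] (bmul S Q)))))"

definition res_q where
  "res_q D A P Q R S = badd (bsm (64 * D * D) (d2 6 Q)) (badd (bsm (D * D) (bmul [[33, 34]] Q))
     (badd (bsm 16 (bmul A (bmul S P))) (bsm (- 16 * D) (bmul R Q))))"

definition res_r where
  "res_r D A P Q R = badd (bsm (64 * D * D) (d2 2 R)) (badd (bsm (4 * D * D) (bmul [[33, 34]] R))
     (badd (bsm 16 (bmul A (bmul P P))) (bsm (- 8 * D) (bmul [[1], [2]] (bmul Q Q)))))"

definition res_s where
  "res_s D P Q S = badd (bsm (64 * D) (d2 6 S)) (badd (bsm (4 * D) (bmul [[33, 34]] S))
     (bsm 32 (bmul P Q)))"

definition lin_p where
  "lin_p D P Q R S p q r s = badd (bsm (64 * D) (d2 2 p)) (badd (bsm D (bmul [[33, 34]] p))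
     (badd (bsm 16 (badd (bmul R p) (bmul P r))) (bsm 8 (bmul [[1], [2]] (badd (bmul S q) (bmul Q s))))))"

definition lin_q where
  "lin_q D A P Q R S a p q r s = badd (bsm (64 * D * D) (d2 6 q)) (badd (bsm (D * D) (bmul [[33, 34]] q))
     (badd (bsm 16 (badd (bmul a (bmul S P)) (bmul A (badd (bmul S p) (bmul P s)))))
       (bsm (- 16 * D) (badd (bmul R q) (bmul Q r)))))"

definition lin_r where
  "lin_r D A P Q a p q r = badd (bsm (64 * D * D) (d2 2 r)) (badd (bsm (4 * D * D) (bmul [[33, 34]] r))
     (badd (bsm 16 (badd (bmul a (bmul P P)) (bsm 2 (bmul A (bmul P p)))))
       (bsm (- 16 * D) (bmul [[1], [2]] (bmul Q q)))))"

definition lin_s where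
  "lin_s D P Q p q s = badd (bsm (64 * D) (d2 6 s)) (badd (bsm (4 * D) (bmul [[33, 34]] s))
     (bsm 32 (badd (bmul P q) (bmul Q p))))"

section \<open>Evaluation of the lists and soundness of the sup bounds\<close>

fun evp :: "int list \<Rightarrow> complex \<Rightarrow> complex" where
  "evp [] t = 0"
| "evp (a # p) t = of_int a + t * evp p t"

fun ev :: "bipoly \<Rightarrow> complex \<Rightarrow> complex \<Rightarrow> complex" where
  "ev [] z t = 0"
| "ev (p # P) z t = evp p t + z * ev P z t"

lemma evp_padd [simp]: "evp (padd p q) t = evp p t + evp q t"
  by (induction p q rule: padd.induct) (simp_all add: algebra_simps)

lemma evp_psm [simp]: "evp (psm c p) t = of_int c * evp p t"
  by (induction p) (simp_all add: algebra_simps)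

lemma evp_pmul [simp]: "evp (pmul p q) t = evp p t * evp q t"
  by (induction p) (simp_all add: algebra_simps)

lemma ev_badd [simp]: "ev (badd P Q) z t = ev P z t + ev Q z t"
  by (induction P Q rule: badd.induct) (simp_all add: algebra_simps)

lemma ev_bsm [simp]: "ev (bsm c P) z t = of_int c * ev P z t"
  by (induction P) (simp_all add: algebra_simps)

lemma ev_bpm [simp]: "ev (bpm q P) z t = evp q t * ev P z t"
  by (induction P) (simp_all add: algebra_simps)

lemma ev_bmul [simp]: "ev (bmul P Q) z t = ev P z t * ev Q z t"
  by (induction P) (simp_all add: algebra_simps)

lemma ev_bder: "((\<lambda>z. ev P z t) has_field_derivative ev (bder P) z t) (at z)"
  by (induction P) (auto intro!: derivative_eq_intros)

lemma norm_evp_le: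
  assumes "norm t \<le> 1"
  shows "norm (evp p t) \<le> of_int (l1 p)"
proof (induction p)
  case (Cons a p)
  have "norm (evp (a # p) t) \<le> \<bar>of_int a\<bar> + norm t * norm (evp p t)"
    by (metis evp.simps(2) norm_mult norm_of_int norm_triangle_ineq)
  also have "\<dots> \<le> \<bar>of_int a\<bar> + 1 * of_int (l1 p)"
    using Cons assms by (intro add_mono mult_mono) auto
  finally show ?case by simp
qed simp

fun cos_sum :: "nat \<Rightarrow> bipoly \<Rightarrow> family" where
  "cos_sum k [] \<theta> t = 0"
| "cos_sum k (c # C) \<theta> t = of_real (2 * cos (real k * \<theta>)) * evp c t + cos_sum (Suc k) C \<theta> t"

fun ev_cos :: "bipoly \<Rightarrow> family" where
  "ev_cos [] \<theta> t = 0"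
| "ev_cos (c # C) \<theta> t = evp c t + cos_sum 1 C \<theta> t"

lemma cos_sum_badd [simp]: "cos_sum k (badd C C') \<theta> t = cos_sum k C \<theta> t + cos_sum k C' \<theta> t"
  by (induction C C' arbitrary: k rule: badd.induct) (simp_all add: algebra_simps)

lemma ev_cos_badd [simp]: "ev_cos (badd C C') \<theta> t = ev_cos C \<theta> t + ev_cos C' \<theta> t"
  by (cases C; cases C') (simp_all add: algebra_simps)

lemma cos_sum_mult:
  "of_real (2 * cos \<theta>) * cos_sum (Suc k) C \<theta> t = cos_sum (Suc (Suc k)) C \<theta> t + cos_sum k C \<theta> t"
proof (induction C arbitrary: k)
  case (Cons c C)
  have "2 * cos \<theta> * (2 * cos (real (Suc k) * \<theta>)) = 2 * cos (real (Suc (Suc k)) * \<theta>) + 2 * cos (real k * \<theta>)"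
    using cos_times_cos[of \<theta> "real (Suc k) * \<theta>"] by (simp add: algebra_simps)
  hence "of_real (2 * cos \<theta>) * of_real (2 * cos (real (Suc k) * \<theta>))
      = (of_real (2 * cos (real (Suc (Suc k)) * \<theta>)) + of_real (2 * cos (real k * \<theta>)) :: complex)"
    by (metis of_real_add of_real_mult)
  hence "of_real (2 * cos \<theta>) * (of_real (2 * cos (real (Suc k) * \<theta>)) * evp c t)
      = (of_real (2 * cos (real (Suc (Suc k)) * \<theta>)) + of_real (2 * cos (real k * \<theta>))) * evp c t"
    by (metis mult.assoc)
  thus ?case
    using Cons[of "Suc k"] by (simp only: cos_sum.simps distrib_left distrib_right add_ac)
qed simp

text \<open>Lowering frequencies makes the tail start at frequency 0, where \<open>cos_sum\<close>
  counts the head twice but \<open>ev_cos\<close> once; \<open>dbl_head\<close> compensates.\<close>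

lemma ev_cos_mul_cos: "ev_cos (mul_cos C) \<theta> t = of_real (2 * cos \<theta>) * ev_cos C \<theta> t"
proof (cases C)
  case (Cons c C')
  have "cos_sum 0 C' \<theta> t = ev_cos (dbl_head C') \<theta> t"
    by (cases C') simp_all
  thus ?thesis
    using cos_sum_mult[of \<theta> 0 C' t] by (simp add: Cons algebra_simps)
qed simp

lemma ev_cos_to_cos: "ev_cos (to_cos P) \<theta> t = of_int (pow4 P) * ev P (of_real (cos \<theta> / 2)) t"
  by (induction P) (simp_all add: ev_cos_mul_cos algebra_simps)

lemma norm_cos_sum_le:
  assumes "norm t \<le> 1"
  shows "norm (cos_sum k C \<theta> t) \<le> 2 * of_int (sum_l1 C)"
proof (induction C arbitrary: k)
  case (Cons c C)
  have "norm (cos_sum k (c # C) \<theta> t)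
      \<le> norm (of_real (2 * cos (real k * \<theta>)) * evp c t) + norm (cos_sum (Suc k) C \<theta> t)"
    by (simp add: norm_triangle_ineq)
  also have "\<dots> \<le> 2 * of_int (l1 c) + 2 * of_int (sum_l1 C)"
  proof (rule add_mono[OF _ Cons])
    have "norm (of_real (2 * cos (real k * \<theta>)) * evp c t) = (2 * \<bar>cos (real k * \<theta>)\<bar>) * norm (evp c t)"
      by (simp add: norm_mult)
    also have "\<dots> \<le> (2 * 1) * of_int (l1 c)"
      using norm_evp_le[OF assms, of c] by (intro mult_mono) auto
    finally show "norm (of_real (2 * cos (real k * \<theta>)) * evp c t) \<le> 2 * of_int (l1 c)" by simp
  qed
  finally show ?case by simp
qed simp

lemma norm_ev_cos_le:
  assumes "norm t \<le> 1"
  shows "norm (ev_cos C \<theta> t) \<le> of_int (cos_l1 C)"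
proof (cases C)
  case (Cons c C')
  have "norm (ev_cos C \<theta> t) \<le> norm (evp c t) + norm (cos_sum 1 C' \<theta> t)"
    by (simp add: Cons norm_triangle_ineq)
  also have "\<dots> \<le> of_int (l1 c) + 2 * of_int (sum_l1 C')"
    by (intro add_mono norm_evp_le norm_cos_sum_le assms)
  finally show ?thesis by (simp add: Cons)
qed simp

lemma pow4_pos: "pow4 P > 0" and pow2_pos: "pow2 P > 0"
  by (induction P) auto

text \<open>Points of \<open>[-1, 1]\<close> enter the polynomials through \<open>\<zeta> = x\<^sup>2 - 1/2 \<in> [-1/2, 1/2]\<close>.\<close>

definition zt :: "real \<Rightarrow> complex" where "zt x = of_real (x\<^sup>2 - 1 / 2)"

text \<open>\<open>cos (k * \<theta>)\<close> is the Chebyshev polynomial of degree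
  \<open>2 * k\<close> in \<open>x\<close>. Absolute sums lose much less in this basis than for
  powers, whose large coefficients cancel.\<close>

lemma sup_leD:
  assumes "sup_le P m" "x \<in> {-1..1}" "norm t \<le> 1"
  shows "norm (ev P (zt x) t) \<le> of_int m"
proof -
  have "\<bar>x\<bar> \<le> 1" using assms(2) by auto
  hence x: "x\<^sup>2 \<le> 1" by (simp add: abs_square_le_1)
  hence range: "\<bar>2 * (x\<^sup>2 - 1 / 2)\<bar> \<le> 1" by (simp add: abs_le_iff)
  define \<theta> where "\<theta> = arccos (2 * (x\<^sup>2 - 1 / 2))"
  have "x\<^sup>2 - 1 / 2 = cos \<theta> / 2"
    unfolding \<theta>_def using range by (subst cos_arccos_abs) auto
  hence "of_int (pow4 P) * ev P (zt x) t = ev_cos (to_cos P) \<theta> t"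
    by (simp only: ev_cos_to_cos zt_def)
  hence "of_int (pow4 P) * norm (ev P (zt x) t) = norm (ev_cos (to_cos P) \<theta> t)"
    using pow4_pos[of P] by (metis abs_of_pos norm_mult norm_of_int of_int_0_less_iff)
  also have "\<dots> \<le> of_int (cos_l1 (to_cos P))"
    by (rule norm_ev_cos_le[OF assms(3)])
  also have "\<dots> \<le> of_int (m * pow4 P)"
    using assms(1) unfolding sup_le_def by (rule of_int_le_iff[THEN iffD2])
  finally have "of_int (pow4 P) * norm (ev P (zt x) t) \<le> of_int (pow4 P) * of_int m"
    by (simp add: mult.commute)
  thus ?thesis
    using pow4_pos[of P] by simp
qed

lemma ev_at_half: "evp (at_half P) t = of_int (pow2 P) * ev P (1 / 2) t"
  by (induction P) (simp_all add: algebra_simps)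

lemma half_leD:
  assumes "half_le P m" "norm t \<le> 1"
  shows "norm (ev P (1 / 2) t) \<le> of_int m"
proof -
  have "of_int (pow2 P) * norm (ev P (1 / 2) t) = norm (evp (at_half P) t)"
    using pow2_pos[of P] unfolding ev_at_half by (metis abs_of_pos norm_mult norm_of_int of_int_0_less_iff)
  also have "\<dots> \<le> of_int (l1 (at_half P))"
    by (rule norm_evp_le[OF assms(2)])
  also have "\<dots> \<le> of_int (m * pow2 P)"
    using assms(1) unfolding half_le_def by (rule of_int_le_iff[THEN iffD2])
  finally have "of_int (pow2 P) * norm (ev P (1 / 2) t) \<le> of_int (pow2 P) * of_int m"
    by (simp add: mult.commute)
  thus ?thesis
    using pow2_pos[of P] by simp
qed

section \<open>Algebra of admissible families\<close>

lemma adm_add: "adm \<sigma> f \<Longrightarrow> adm \<sigma> g \<Longrightarrow> adm \<sigma> (\<lambda>x z. f x z + g x z)"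
  by (auto simp: adm_def hol_family_add algebra_simps)

lemma adm_diff: "adm \<sigma> f \<Longrightarrow> adm \<sigma> g \<Longrightarrow> adm \<sigma> (\<lambda>x z. f x z - g x z)"
  by (auto simp: adm_def hol_family_diff algebra_simps)

lemma adm_mult: "adm \<sigma> f \<Longrightarrow> adm \<tau> g \<Longrightarrow> \<rho> = \<sigma> * \<tau> \<Longrightarrow> adm \<rho> (\<lambda>x z. f x z * g x z)"
  by (auto simp: adm_def hol_family_mult)

lemma adm_const:
  assumes "f holomorphic_on ball 0 1" "\<And>z. z \<in> ball 0 1 \<Longrightarrow> z \<in> \<real> \<Longrightarrow> f z \<in> \<real>"
  shows "adm 1 (\<lambda>x. f)"
  using assms by (auto simp: adm_def)

lemma adm_of_real: "adm 1 (\<lambda>x z. of_real c)"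
  by (rule adm_const) auto

lemma adm_uminus: "adm \<sigma> f \<Longrightarrow> adm \<sigma> (\<lambda>x z. - f x z)"
  using adm_mult[OF adm_of_real[of "-1"]] by fastforce

lemma adm_x: "adm (- 1) (\<lambda>x z. of_real x)"
  by (auto simp: adm_def hol_family_of_real)

lemma adm_sum:
  assumes "\<And>i. i \<in> I \<Longrightarrow> adm \<sigma> (f i)" "finite I"
  shows "adm \<sigma> (\<lambda>x z. \<Sum>i\<in>I. f i x z)"
proof -
  have zero: "adm \<sigma> (\<lambda>x z. 0)" by (auto simp: adm_def)
  from assms(2,1) show ?thesis
    by (induction I rule: finite_induct) (auto intro: adm_add zero)
qed

lemma adm_at_point: "adm \<sigma> h \<Longrightarrow> x0 \<in> {-1..1} \<Longrightarrow> adm 1 (\<lambda>x. h x0)"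
  by (rule adm_const) (auto simp: adm_def hol_family_def)

lemma integral_Reals:
  fixes f :: "real \<Rightarrow> complex"
  assumes "\<And>x. x \<in> S \<Longrightarrow> f x \<in> \<real>"
  shows "integral S f \<in> \<real>"
proof -
  have "cnj (integral S f) = integral S (\<lambda>x. cnj (f x))"
    by (rule integral_cnj)
  also have "\<dots> = integral S f"
    using assms by (intro integral_cong) (auto simp: Reals_cnj_iff)
  finally show ?thesis by (simp add: Reals_cnj_iff)
qed

lemma adm_prim:
  assumes "adm \<sigma> h"
  shows "adm (- \<sigma>) (prim h)"
proof -
  note in_I = scale_in_Icc
  have "prim h (- x) z = of_real (- \<sigma>) * prim h x z" if "x \<in> {-1..1}" "z \<in> ball 0 1" for x z
  proof -
    have "integral {0..1} (\<lambda>\<tau>. h (\<tau> * - x) z) = integral {0..1} (\<lambda>\<tau>. of_real \<sigma> * h (\<tau> * x) z)"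
      using assms in_I[OF _ that(1)] that(2) by (intro integral_cong) (simp add: adm_def)
    thus ?thesis by (simp add: prim_def)
  qed
  moreover have "prim h x z \<in> \<real>" if "x \<in> {-1..1}" "z \<in> ball 0 1" "z \<in> \<real>" for x z
    unfolding prim_def using assms in_I[OF _ that(1)] that
    by (intro Reals_mult integral_Reals) (auto simp: adm_def)
  ultimately show ?thesis
    using assms by (auto simp: adm_def hol_family_prim(1))
qed

lemma evp_holomorphic: "evp p holomorphic_on A"
  by (induction p) (auto intro!: holomorphic_intros)

lemma evp_Reals: "z \<in> \<real> \<Longrightarrow> evp p z \<in> \<real>"
  by (induction p) auto

lemma adm_evp: "adm 1 (\<lambda>x. evp p)"
  by (intro adm_const evp_holomorphic evp_Reals)

lemma adm_zt: "adm 1 (\<lambda>x z. zt x)"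
proof -
  have "adm 1 (\<lambda>x z. of_real x * of_real x)"
    by (rule adm_mult[OF adm_x adm_x]) simp
  from adm_diff[OF this adm_of_real[of "1/2"]] show ?thesis
    by (simp add: zt_def power2_eq_square)
qed

lemma adm_ev: "adm 1 (\<lambda>x. ev P (zt x))"
proof (induction P)
  case Nil
  show ?case using adm_of_real[of 0] by simp
next
  case (Cons p P)
  have "adm 1 (\<lambda>x z. zt x * ev P (zt x) z)"
    by (rule adm_mult[OF adm_zt Cons]) simp
  from adm_add[OF adm_evp this] show ?case by simp
qed

text \<open>Indices 4 to 7 carry the amplitudes of a state. They are read off at
  \<open>x = 0\<close> and count as even.\<close>

definition par :: "nat \<Rightarrow> real" where "par f = (if odd f \<and> f < 4 then - 1 else 1)"

definition om :: "nat \<Rightarrow> real \<Rightarrow> complex" where "om f x = (if odd f then of_real x else 1)"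

text \<open>The \<open>f\<close>-th component of an approximation: even in \<open>x\<close> for \<open>f = 0, 2\<close>, odd for \<open>f = 1, 3\<close>.\<close>

definition cpt :: "nat \<Rightarrow> bipoly \<Rightarrow> real \<Rightarrow> family" where
  "cpt f L D x t = om f x * ev L (zt x) t / of_real D"

definition cpt_d1 :: "nat \<Rightarrow> bipoly \<Rightarrow> real \<Rightarrow> family" where
  "cpt_d1 f L D x t =
     (if odd f then ev L (zt x) t + 2 * of_real (x\<^sup>2) * ev (bder L) (zt x) t
      else 2 * of_real x * ev (bder L) (zt x) t) / of_real D"

definition cpt_d2 :: "nat \<Rightarrow> bipoly \<Rightarrow> real \<Rightarrow> family" where
  "cpt_d2 f L = cpt f (d2 (if odd f then 6 else 2) L)"

lemma adm_cpt: "f < 4 \<Longrightarrow> adm (par f) (cpt f L D)"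
proof -
  assume f: "f < 4"
  have "adm (par f) (\<lambda>x z. om f x)"
    using f adm_x adm_of_real[of 1] by (auto simp: par_def om_def)
  have "adm (par f) (\<lambda>x z. om f x * ev L (zt x) z)"
    by (rule adm_mult[OF \<open>adm (par f) (\<lambda>x z. om f x)\<close> adm_ev]) simp
  from adm_mult[OF this adm_of_real[of "1 / D"], of "par f"]
  show "adm (par f) (cpt f L D)"
    by (simp add: cpt_def[abs_def])
qed

lemma ev_zeta_has_field_derivative:
  "((\<lambda>w. ev P (w\<^sup>2 - 1 / 2) t) has_field_derivative 2 * w * ev (bder P) (w\<^sup>2 - 1 / 2) t) (at w)"
proof -
  have "((\<lambda>w::complex. w\<^sup>2 - 1 / 2) has_field_derivative 2 * w) (at w)"
    by (auto intro!: derivative_eq_intros)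
  from DERIV_chain2[OF ev_bder this, of P t] show ?thesis
    by (simp add: mult.commute)
qed

lemma cpt_derivs:
  "((\<lambda>x. cpt f L D x t) has_vector_derivative cpt_d1 f L D x t) (at x within A)"
  "((\<lambda>x. cpt_d1 f L D x t) has_vector_derivative cpt_d2 f L D x t) (at x within A)"
proof -
  let ?e = "\<lambda>P w. ev P (w\<^sup>2 - 1 / 2) t"
  let ?o = "\<lambda>w::complex. if odd f then w else 1"
  let ?d1 = "\<lambda>w. if odd f then ?e L w + 2 * w\<^sup>2 * ?e (bder L) w else 2 * w * ?e (bder L) w"
  note E = ev_zeta_has_field_derivative
  have sq: "((\<lambda>w. 2 * w\<^sup>2) has_field_derivative 4 * w) (at w)" and two: "((\<lambda>w. 2 * w) has_field_derivative 2) (at w)"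
    for w :: complex
    by (auto intro!: derivative_eq_intros)
  have "((\<lambda>w. ?o w * ?e L w) has_field_derivative ?d1 w) (at w)" for w
  proof (cases "odd f")
    case True
    from DERIV_mult[OF DERIV_ident E[of L t w]] show ?thesis
      using True by (simp add: power2_eq_square algebra_simps)
  qed (use E[of L t w] in simp)
  from DERIV_cdivide[OF this]
  have "((\<lambda>w. ?o w * ?e L w / of_real D) has_field_derivative ?d1 w / of_real D) (at w)" for w .
  from has_vector_derivative_real_field[OF this, of x A]
  show "((\<lambda>x. cpt f L D x t) has_vector_derivative cpt_d1 f L D x t) (at x within A)"
    by (cases "odd f") (simp_all add: cpt_def om_def cpt_d1_def zt_def)
  have "(?d1 has_field_derivative ?o w * ?e (d2 (if odd f then 6 else 2) L) w) (at w)" for w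
  proof (cases "odd f")
    case True
    from DERIV_add[OF E[of L t w] DERIV_mult[OF sq E[of "bder L" t w]]] show ?thesis
      using True by (simp add: d2_def power2_eq_square algebra_simps)
  next
    case False
    from DERIV_mult[OF two E[of "bder L" t w]] show ?thesis
      using False by (simp add: d2_def power2_eq_square algebra_simps)
  qed
  from DERIV_cdivide[OF this]
  have "((\<lambda>w. ?d1 w / of_real D) has_field_derivative
      ?o w * ?e (d2 (if odd f then 6 else 2) L) w / of_real D) (at w)" for w .
  from has_vector_derivative_real_field[OF this, of x A]
  show "((\<lambda>x. cpt_d1 f L D x t) has_vector_derivative cpt_d2 f L D x t) (at x within A)"
    by (cases "odd f") (simp_all add: cpt_d2_def cpt_def om_def cpt_d1_def zt_def)
qed

subsection \<open>Exponentially weighted bounds\<close>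

lemma integral_norm_le_primitive:
  fixes f :: "real \<Rightarrow> complex" and \<phi> :: "real \<Rightarrow> real"
  assumes "continuous_on {0..1} f" "(\<phi> has_integral J) {0..1}" "\<And>\<tau>. \<tau> \<in> {0..1} \<Longrightarrow> norm (f \<tau>) \<le> \<phi> \<tau>"
  shows "norm (integral {0..1} f) \<le> J"
proof -
  have "norm (integral {0..1} f) \<le> integral {0..1} \<phi>"
    by (rule integral_norm_bound_integral[OF integrable_continuous_real[OF assms(1)] _ assms(3)])
       (use assms(2) in \<open>auto intro: has_integral_integrable\<close>)
  thus ?thesis using assms(2) by (simp add: integral_unique)
qed

lemma prim_norm_bounds:
  assumes h: "hol_family \<Omega> h" and z: "z \<in> \<Omega>" and x: "x \<in> {-1..1}"
  shows "(\<And>y. y \<in> {-1..1} \<Longrightarrow> norm (h y z) \<le> C * cosh (6 * y)) \<Longrightarrow> norm (prim h x z) \<le> C * (sinh (6 * \<bar>x\<bar>) / 6)"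
    and "(\<And>y. y \<in> {-1..1} \<Longrightarrow> norm (h y z) \<le> C * (sinh (6 * \<bar>y\<bar>) / 6)) \<Longrightarrow> norm (prim h x z) \<le> C * ((cosh (6 * x) - 1) / 36)"
proof -
  note in_I = scale_in_Icc[OF _ x]
  have cont: "continuous_on {0..1} (\<lambda>\<tau>. of_real x * h (\<tau> * x) z)"
  proof -
    have "continuous_on {0..1} ((\<lambda>x. h x z) \<circ> (\<lambda>\<tau>. \<tau> * x))"
      using in_I by (intro continuous_on_compose continuous_intros
          continuous_on_subset[OF hol_family_continuous_x[OF h z]]) auto
    thus ?thesis by (auto simp: o_def intro!: continuous_intros)
  qed
  have eq: "prim h x z = integral {0..1} (\<lambda>\<tau>. of_real x * h (\<tau> * x) z)"
    by (simp add: prim_def)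
  {
    assume b: "\<And>y. y \<in> {-1..1} \<Longrightarrow> norm (h y z) \<le> C * cosh (6 * y)"
    have "((\<lambda>\<tau>. C * (\<bar>x\<bar> * cosh (6 * (\<tau> * \<bar>x\<bar>)))) has_integral
        C * (sinh (6 * (1 * \<bar>x\<bar>)) / 6) - C * (sinh (6 * (0 * \<bar>x\<bar>)) / 6)) {0..1}"
      by (rule fundamental_theorem_of_calculus)
         (auto intro!: derivative_eq_intros simp flip: has_real_derivative_iff_has_vector_derivative)
    hence int: "((\<lambda>\<tau>. C * (\<bar>x\<bar> * cosh (6 * (\<tau> * \<bar>x\<bar>)))) has_integral C * (sinh (6 * \<bar>x\<bar>) / 6)) {0..1}"
      by simp
    show "norm (prim h x z) \<le> C * (sinh (6 * \<bar>x\<bar>) / 6)"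
      unfolding eq
    proof (rule integral_norm_le_primitive[OF cont int])
      fix \<tau> :: real assume \<tau>: "\<tau> \<in> {0..1}"
      have "norm (of_real x * h (\<tau> * x) z) \<le> \<bar>x\<bar> * (C * cosh (6 * (\<tau> * x)))"
        using b[OF in_I[OF \<tau>]] by (simp add: norm_mult mult_left_mono)
      also have "cosh (6 * (\<tau> * x)) = cosh (6 * (\<tau> * \<bar>x\<bar>))"
        using \<tau> cosh_real_abs[of "6 * (\<tau> * x)"] by (simp add: abs_mult)
      finally show "norm (of_real x * h (\<tau> * x) z) \<le> C * (\<bar>x\<bar> * cosh (6 * (\<tau> * \<bar>x\<bar>)))"
        by (simp add: mult_ac)
    qed
  }
  {
    assume b: "\<And>y. y \<in> {-1..1} \<Longrightarrow> norm (h y z) \<le> C * (sinh (6 * \<bar>y\<bar>) / 6)"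
    have "((\<lambda>\<tau>. C * (\<bar>x\<bar> * (sinh (6 * (\<tau> * \<bar>x\<bar>)) / 6))) has_integral
        C * (cosh (6 * (1 * \<bar>x\<bar>)) / 36) - C * (cosh (6 * (0 * \<bar>x\<bar>)) / 36)) {0..1}"
      by (rule fundamental_theorem_of_calculus)
         (auto intro!: derivative_eq_intros simp flip: has_real_derivative_iff_has_vector_derivative)
    moreover have "cosh (6 * \<bar>x\<bar>) = cosh (6 * x)"
      using cosh_real_abs[of "6 * x"] by (simp add: abs_mult)
    ultimately have int: "((\<lambda>\<tau>. C * (\<bar>x\<bar> * (sinh (6 * (\<tau> * \<bar>x\<bar>)) / 6))) has_integral C * ((cosh (6 * x) - 1) / 36)) {0..1}"
      by (simp add: algebra_simps diff_divide_distrib)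
    show "norm (prim h x z) \<le> C * ((cosh (6 * x) - 1) / 36)"
      unfolding eq
    proof (rule integral_norm_le_primitive[OF cont int])
      fix \<tau> :: real assume \<tau>: "\<tau> \<in> {0..1}"
      have "norm (of_real x * h (\<tau> * x) z) \<le> \<bar>x\<bar> * (C * (sinh (6 * \<bar>\<tau> * x\<bar>) / 6))"
        using mult_left_mono[OF b[OF in_I[OF \<tau>]], of "\<bar>x\<bar>"] by (simp add: norm_mult)
      thus "norm (of_real x * h (\<tau> * x) z) \<le> C * (\<bar>x\<bar> * (sinh (6 * (\<tau> * \<bar>x\<bar>)) / 6))"
        using \<tau> by (simp add: abs_mult mult_ac)
    qed
  }
qed

text \<open>The weighted bound feeds the contraction; the two unweighted ones bound the size of the
  solution and its boundary values. The number 203 bounds both \<open>cosh 6 - 1\<close> and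
  \<open>sinh 6\<close>, because \<open>exp 6 < 2.72^6 < 406\<close>.\<close>

lemma prim_prim_norm_bounds:
  assumes h: "hol_family (ball 0 1) h" and z: "z \<in> ball 0 1"
    and b: "\<And>y. y \<in> {-1..1} \<Longrightarrow> norm (h y z) \<le> C * cosh (6 * y)" and x: "x \<in> {-1..1}"
  shows "norm (prim (prim h) x z) \<le> C * (cosh (6 * x) / 36)"
    and "norm (prim (prim h) x z) \<le> C * (203 / 36)"
    and "norm (prim h x z) \<le> C * (203 / 6)"
proof -
  have e: "exp 6 \<le> (406 :: real)"
  proof -
    have "exp (6 * 1) = (exp 1 :: real) ^ (6::nat)" using exp_of_nat_mult[of 6 "1::real"] by simp
    also have "\<dots> \<le> (272 / 100) ^ (6::nat)" using e_less_272 by (intro power_mono) auto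
    also have "\<dots> \<le> (406 :: real)" by (simp add: power_divide field_simps)
    finally show ?thesis by simp
  qed
  have C: "C \<ge> 0"
    using order_trans[OF norm_ge_zero b[of 0]] by simp
  have \<open>\<bar>x\<bar> \<le> 1\<close> using x by auto
  have c1: "cosh (6 * x) \<le> 204 \<and> cosh (6 * x) \<ge> 1"
  proof -
    have "exp (6 * x) + exp (- (6 * x)) \<le> 406 + 1"
    proof (cases "x \<ge> 0")
      case True
      hence "exp (6 * x) \<le> exp 6" "exp (- (6 * x)) \<le> 1" using x by auto
      thus ?thesis using e by linarith
    next
      case False
      hence "exp (- (6 * x)) \<le> exp 6" "exp (6 * x) \<le> 1" using x by auto
      thus ?thesis using e by linarith
    qed
    hence "cosh (6 * x) \<le> 204" by (simp add: cosh_def)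
    thus ?thesis by (simp add: cosh_real_ge_1)
  qed
  have s1: "sinh (6 * \<bar>x\<bar>) \<le> 203"
  proof -
    have "exp (6 * \<bar>x\<bar>) \<le> exp 6" "exp (- (6 * \<bar>x\<bar>)) \<ge> 0" using \<open>\<bar>x\<bar> \<le> 1\<close> by auto
    hence "exp (6 * \<bar>x\<bar>) - exp (- (6 * \<bar>x\<bar>)) \<le> 406" using e by linarith
    thus ?thesis by (simp add: sinh_def)
  qed
  note p1 = prim_norm_bounds(1)[OF h z _ b]
  note p2 = prim_norm_bounds(2)[OF hol_family_prim(1)[OF _ h] z x p1]
  have "norm (prim (prim h) x z) \<le> C * ((cosh (6 * x) - 1) / 36)"
    by (rule p2) auto
  moreover have "C * ((cosh (6 * x) - 1) / 36) \<le> C * (cosh (6 * x) / 36)"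
    "C * ((cosh (6 * x) - 1) / 36) \<le> C * (203 / 36)"
    using C c1 by (auto intro!: mult_left_mono)
  ultimately show "norm (prim (prim h) x z) \<le> C * (cosh (6 * x) / 36)"
    "norm (prim (prim h) x z) \<le> C * (203 / 36)" by linarith+
  have "norm (prim h x z) \<le> C * (sinh (6 * \<bar>x\<bar>) / 6)"
    by (rule p1[OF x])
  also have "\<dots> \<le> C * (203 / 6)" using C s1 by (auto intro!: mult_left_mono)
  finally show "norm (prim h x z) \<le> C * (203 / 6)" .
qed

lemma prim_diff:
  assumes "hol_family \<Omega> f" "hol_family \<Omega> g" "z \<in> \<Omega>" "x \<in> {-1..1}"
  shows "prim (\<lambda>x z. f x z - g x z) x z = prim f x z - prim g x z"
proof -
  have "prim (\<lambda>x z. f x z - g x z) x z = (\<lambda>x. prim f x z - prim g x z) x - (\<lambda>x. prim f x z - prim g x z) 0"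
    by (rule prim_eq_antiderivative[OF _ assms(4)])
       (intro has_vector_derivative_diff prim_has_vector_derivative[OF assms(1,3)]
         prim_has_vector_derivative[OF assms(2,3)])
  thus ?thesis by (simp add: prim_def)
qed

section \<open>The contraction\<close>

definition mu :: "complex \<Rightarrow> complex" where "mu t = (33 + 34 * t) / 16"

text \<open>\<open>nl f\<close> is minus the right-hand side of the \<open>f\<close>-th equation of the rescaled system for
  \<open>u\<^sub>1 = \<surd>A p + \<i> q\<close>, \<open>u\<^sub>2 = r + \<i> \<surd>A s\<close> on \<open>[-1, 1]\<close>; \<open>nl_lin f\<close> is its linearisation.\<close>

definition nl :: "nat \<Rightarrow> complex \<Rightarrow> complex \<Rightarrow> (nat \<Rightarrow> complex) \<Rightarrow> complex" where
  "nl f m A u =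
     (if f = 0 then (m * u 0 + u 2 * u 0 + u 3 * u 1) / 4
      else if f = 1 then (m * u 1 + A * (u 3 * u 0) - u 2 * u 1) / 4
      else if f = 2 then (4 * m * u 2 + A * (u 0 * u 0) - u 1 * u 1) / 4
      else (4 * m * u 3 + 2 * (u 0 * u 1)) / 4)"

definition nl_lin :: "nat \<Rightarrow> complex \<Rightarrow> complex \<Rightarrow> (nat \<Rightarrow> complex) \<Rightarrow> complex \<Rightarrow> (nat \<Rightarrow> complex) \<Rightarrow> complex" where
  "nl_lin f m A u a v =
     [(m * v 0 + (u 2 * v 0 + u 0 * v 2) + (u 3 * v 1 + u 1 * v 3)) / 4,
      (m * v 1 + (a * (u 3 * u 0) + A * (u 3 * v 0 + u 0 * v 3)) - (u 2 * v 1 + u 1 * v 2)) / 4,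
      (4 * m * v 2 + (a * (u 0 * u 0) + 2 * A * (u 0 * v 0)) - 2 * (u 1 * v 1)) / 4,
      (4 * m * v 3 + 2 * (u 0 * v 1 + u 1 * v 0)) / 4] ! f"

text \<open>The second order remainder of \<open>nl\<close> at \<open>u\<close>, arranged so that each summand contains one difference
  of the two arguments and one small distance to \<open>u\<close>.\<close>

definition nl_rem :: "nat \<Rightarrow> complex \<Rightarrow> (nat \<Rightarrow> complex) \<Rightarrow> complex \<Rightarrow> (nat \<Rightarrow> complex) \<Rightarrow> complex \<Rightarrow> (nat \<Rightarrow> complex) \<Rightarrow> complex" where
  "nl_rem f A u A1 u1 A2 u2 =
     [((u1 2 - u 2) * (u1 0 - u2 0) + (u2 0 - u 0) * (u1 2 - u2 2)
        + ((u1 3 - u 3) * (u1 1 - u2 1) + (u2 1 - u 1) * (u1 3 - u2 3))) / 4,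
      ((A1 - A2) * ((u1 3 - u 3) * u1 0 + u 3 * (u1 0 - u 0))
        + (u1 3 - u2 3) * ((A2 - A) * u1 0 + A * (u1 0 - u 0))
        + (u1 0 - u2 0) * ((A2 - A) * u2 3 + A * (u2 3 - u 3))
        - ((u1 2 - u 2) * (u1 1 - u2 1) + (u2 1 - u 1) * (u1 2 - u2 2))) / 4,
      ((A1 - A2) * ((u1 0 - u 0) * (u1 0 + u 0))
        + (u1 0 - u2 0) * ((A2 - A) * (u1 0 + u2 0) + A * ((u1 0 - u 0) + (u2 0 - u 0)))
        - (u1 1 - u2 1) * ((u1 1 - u 1) + (u2 1 - u 1))) / 4,
      ((u1 0 - u 0) * (u1 1 - u2 1) + (u2 1 - u 1) * (u1 0 - u2 0)) / 2] ! f"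

lemma less_4_cases: "f < 4 \<Longrightarrow> (f = 0 \<Longrightarrow> P) \<Longrightarrow> (f = 1 \<Longrightarrow> P) \<Longrightarrow> (f = 2 \<Longrightarrow> P) \<Longrightarrow> (f = 3 \<Longrightarrow> P) \<Longrightarrow> P"
  for f :: nat
  by linarith

lemma less_4_iff: "f < 4 \<longleftrightarrow> f = 0 \<or> f = 1 \<or> f = 2 \<or> f = (3::nat)"
  by auto

lemma nth_4 [simp]:
  "[a, b, c, d] ! 0 = a" "[a, b, c, d] ! 1 = b" "[a, b, c, d] ! Suc 0 = b" "[a, b, c, d] ! 2 = c" "[a, b, c, d] ! 3 = d"
  by (simp_all add: eval_nat_numeral)

text \<open>Exact, since \<open>nl\<close> is a polynomial, and valid for every base point
  \<open>(A, u)\<close>. It will be the coarse branch, where linearised residuals are cheap to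
  evaluate.\<close>

lemma nl_diff:
  "f < 4 \<Longrightarrow> nl f m A1 u1 - nl f m A2 u2
     = nl_lin f m A u (A1 - A2) (\<lambda>i. u1 i - u2 i) + nl_rem f A u A1 u1 A2 u2"
  unfolding less_4_iff nl_def nl_lin_def nl_rem_def by (elim disjE) (simp_all add: field_simps)

lemma nl_lin_add:
  "f < 4 \<Longrightarrow> nl_lin f m A u a (\<lambda>i. v i + w i) = nl_lin f m A u a v + nl_lin f m A u 0 w"
  unfolding less_4_iff nl_lin_def by (elim disjE) (simp_all add: field_simps)

lemma nl_lin_sum:
  "f < 4 \<Longrightarrow> nl_lin f m A u (\<Sum>i\<in>I. d i * a i) (\<lambda>j. \<Sum>i\<in>I. d i * v i j) = (\<Sum>i\<in>I. d i * nl_lin f m A u (a i) (v i))"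
  unfolding less_4_iff nl_lin_def
  by (elim disjE)
     (auto simp: sum_distrib_left sum_distrib_right sum_divide_distrib sum.distrib[symmetric]
      sum_subtractf[symmetric] algebra_simps add_divide_distrib diff_divide_distrib intro!: sum.cong)

text \<open>Chained by \<open>rule\<close>, these produce a bound with the same syntax tree as the
  bounded expression, which dictates the shape of the numerical terms in the next estimates.\<close>

lemma nb_add: "norm a \<le> A \<Longrightarrow> norm b \<le> B \<Longrightarrow> norm (a + b :: complex) \<le> A + B"
  and nb_diff: "norm a \<le> A \<Longrightarrow> norm b \<le> B \<Longrightarrow> norm (a - b :: complex) \<le> A + B"
  and nb_mult: "norm a \<le> A \<Longrightarrow> norm b \<le> B \<Longrightarrow> norm (a * b :: complex) \<le> A * B"
  and nb_div4: "norm a \<le> A \<Longrightarrow> norm (a / 4 :: complex) \<le> A / 4"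
  and nb_div2: "norm a \<le> A \<Longrightarrow> norm (a / 2 :: complex) \<le> A / 2"
  and nb_num: "norm (numeral n :: complex) \<le> numeral n"
  and nb_zero: "norm (0 :: complex) \<le> 0"
  using norm_ge_zero[of a]
  by (auto simp: norm_mult norm_divide norm_triangle_mono intro: norm_triangle_le_diff mult_mono order_trans[OF norm_ge_zero])

text \<open>Weights of the four functions (\<open>wt\<close>) and of the four amplitudes (\<open>dt\<close>) in the norm of the
  contraction. For states in the ball of radius \<open>rho\<close>: size of the solution (\<open>nb\<close>) and its distance to the
  coarse branch (\<open>zb\<close>); \<open>yb\<close> bounds the change of the solution per unit change of the state.\<close>

definition wt :: "nat \<Rightarrow> real" where "wt f = [1, 20, 23, 6 / 5] ! f"
definition dt :: "nat \<Rightarrow> real" where "dt i = [148, 8, 890, 47] ! i"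
definition nb :: "nat \<Rightarrow> real" where "nb f = [11 / 10, 116 / 5, 189 / 10, 99 / 100] ! f"
definition yb :: "nat \<Rightarrow> real" where "yb f = [37, 1140, 980, 68] ! f"
definition zb :: "nat \<Rightarrow> real" where "zb f = [8 / 10^5, 22 / 10^4, 2 / 10^3, 12 / 10^5] ! f"

text \<open>The right-hand sides are the rows of a nonnegative matrix applied to \<open>wt\<close>.
  The weights are close to its Perron vector: the quotients of the rows by \<open>wt\<close> all lie
  between 23 and 24.01, hence below \<open>36 * 67 / 100\<close>. This is what calls for an exponent
  as large as 6 in the weight.\<close>

lemma nl_lin_bound:
  assumes f: "f < 4" and m: "norm m \<le> 67 / 16" and A: "norm A \<le> 382"
    and u: "\<And>i. i < 4 \<Longrightarrow> norm (u i) \<le> nb i" and k: "\<And>i. i < 4 \<Longrightarrow> norm (k i) \<le> C * wt i"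
  shows "norm (nl_lin f m A u 0 k) \<le> C * (36 * (67 / 100) * wt f)"
proof -
  have C: "C \<ge> 0"
    using order_trans[OF norm_ge_zero k[of 0]] by (simp add: wt_def)
  have u': "norm (u 0) \<le> 11 / 10" "norm (u 1) \<le> 116 / 5" "norm (u 2) \<le> 189 / 10" "norm (u 3) \<le> 99 / 100"
    using u[of 0] u[of 1] u[of 2] u[of 3] by (simp_all add: nb_def)
  have k': "norm (k 0) \<le> C" "norm (k 1) \<le> C * 20" "norm (k 2) \<le> C * 23" "norm (k 3) \<le> C * (6 / 5)"
    using k[of 0] k[of 1] k[of 2] k[of 3] by (simp_all add: wt_def)
  note I = m A u' k' nb_add nb_diff nb_mult nb_div4 nb_num nb_zero
  from f show ?thesis
  proof (rule less_4_cases)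
    assume "f = 0"
    have "norm (nl_lin f m A u 0 k) \<le>
        (67 / 16 * C + (189 / 10 * C + 11 / 10 * (C * 23)) + (99 / 100 * (C * 20) + 116 / 5 * (C * (6 / 5)))) / 4"
      unfolding \<open>f = 0\<close> nl_lin_def nth_4 by (rule I)+
    also have "\<dots> \<le> C * (36 * (67 / 100) * wt f)" using C \<open>f = 0\<close> by (simp add: wt_def)
    finally show ?thesis .
  next
    assume "f = 1"
    have "norm (nl_lin f m A u 0 k) \<le>
        (67 / 16 * (C * 20) + (0 * (99 / 100 * (11 / 10)) + 382 * (99 / 100 * C + 11 / 10 * (C * (6 / 5)))) + (189 / 10 * (C * 20) + 116 / 5 * (C * 23))) / 4"
      unfolding \<open>f = 1\<close> nl_lin_def nth_4 by (rule I)+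
    also have "\<dots> \<le> C * (36 * (67 / 100) * wt f)" using C \<open>f = 1\<close> by (simp add: wt_def)
    finally show ?thesis .
  next
    assume "f = 2"
    have "norm (nl_lin f m A u 0 k) \<le>
        (4 * (67 / 16) * (C * 23) + (0 * (11 / 10 * (11 / 10)) + 2 * 382 * (11 / 10 * C)) + 2 * (116 / 5 * (C * 20))) / 4"
      unfolding \<open>f = 2\<close> nl_lin_def nth_4 by (rule I)+
    also have "\<dots> \<le> C * (36 * (67 / 100) * wt f)" using C \<open>f = 2\<close> by (simp add: wt_def)
    finally show ?thesis .
  next
    assume "f = 3"
    have "norm (nl_lin f m A u 0 k) \<le>
        (4 * (67 / 16) * (C * (6 / 5)) + 2 * (11 / 10 * (C * 20) + 116 / 5 * C)) / 4"
      unfolding \<open>f = 3\<close> nl_lin_def nth_4 by (rule I)+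
    also have "\<dots> \<le> C * (36 * (67 / 100) * wt f)" using C \<open>f = 3\<close> by (simp add: wt_def)
    finally show ?thesis .
  qed
qed

definition qb :: "nat \<Rightarrow> real" where "qb f = [12 / 100, 42 / 10, 35 / 10, 9 / 100] ! f"

text \<open>Up to bounded factors, each summand pairs a difference of states, bounded by
  \<open>c * yb\<close> or by \<open>c * 21900\<close> for \<open>A\<close>, with a distance to the
  coarse branch, bounded by \<open>zb\<close> or by \<open>33 / 1000\<close> for \<open>A\<close>.
  The resulting \<open>qb\<close> stays below a quarter of \<open>wt\<close>.\<close>

lemma nl_rem_bound:
  assumes f: "f < 4" and A: "norm A \<le> 382" and A2: "norm (A2 - A) \<le> 33 / 1000" and dA: "norm (A1 - A2) \<le> c * 21900"
    and u: "\<And>i. i < 4 \<Longrightarrow> norm (u i) \<le> nb i" "\<And>i. i < 4 \<Longrightarrow> norm (u1 i) \<le> nb i" "\<And>i. i < 4 \<Longrightarrow> norm (u2 i) \<le> nb i"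
    and d1: "\<And>i. i < 4 \<Longrightarrow> norm (u1 i - u i) \<le> zb i" and d2: "\<And>i. i < 4 \<Longrightarrow> norm (u2 i - u i) \<le> zb i"
    and d: "\<And>i. i < 4 \<Longrightarrow> norm (u1 i - u2 i) \<le> c * yb i"
  shows "norm (nl_rem f A u A1 u1 A2 u2) \<le> c * qb f"
proof -
  have c: "c \<ge> 0"
    using order_trans[OF norm_ge_zero dA] by simp
  have u': "norm (u 0) \<le> 11 / 10" "norm (u1 0) \<le> 11 / 10" "norm (u2 0) \<le> 11 / 10" "norm (u 3) \<le> 99 / 100" "norm (u2 3) \<le> 99 / 100"
    using u(1)[of 0] u(2)[of 0] u(3)[of 0] u(1)[of 3] u(3)[of 3] by (simp_all add: nb_def)
  have d1': "norm (u1 0 - u 0) \<le> 8 / 10^5" "norm (u1 1 - u 1) \<le> 22 / 10^4" "norm (u1 2 - u 2) \<le> 2 / 10^3" "norm (u1 3 - u 3) \<le> 12 / 10^5"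
    using d1[of 0] d1[of 1] d1[of 2] d1[of 3] by (simp_all add: zb_def)
  have d2': "norm (u2 0 - u 0) \<le> 8 / 10^5" "norm (u2 1 - u 1) \<le> 22 / 10^4" "norm (u2 3 - u 3) \<le> 12 / 10^5"
    using d2[of 0] d2[of 1] d2[of 3] by (simp_all add: zb_def)
  have d': "norm (u1 0 - u2 0) \<le> c * 37" "norm (u1 1 - u2 1) \<le> c * 1140" "norm (u1 2 - u2 2) \<le> c * 980" "norm (u1 3 - u2 3) \<le> c * 68"
    using d[of 0] d[of 1] d[of 2] d[of 3] by (simp_all add: yb_def)
  note I = nb_mult A A2 dA u' d1' d2' d' nb_add nb_diff nb_div4 nb_div2
  from f show ?thesis
  proof (rule less_4_cases)
    assume "f = 0"
    have "norm (nl_rem f A u A1 u1 A2 u2) \<le> (2 / 10^3 * (c * 37) + 8 / 10^5 * (c * 980)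
        + (12 / 10^5 * (c * 1140) + 22 / 10^4 * (c * 68))) / 4"
      unfolding \<open>f = 0\<close> nl_rem_def nth_4 by (rule I)+
    also have "\<dots> \<le> c * qb f" using c \<open>f = 0\<close> by (simp add: qb_def)
    finally show ?thesis .
  next
    assume "f = 1"
    have "norm (nl_rem f A u A1 u1 A2 u2) \<le> (c * 21900 * (12 / 10^5 * (11 / 10) + 99 / 100 * (8 / 10^5))
        + c * 68 * (33 / 1000 * (11 / 10) + 382 * (8 / 10^5))
        + c * 37 * (33 / 1000 * (99 / 100) + 382 * (12 / 10^5))
        + (2 / 10^3 * (c * 1140) + 22 / 10^4 * (c * 980))) / 4"
      unfolding \<open>f = 1\<close> nl_rem_def nth_4 by (rule I)+
    also have "\<dots> \<le> c * qb f" using c \<open>f = 1\<close> by (simp add: qb_def)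
    finally show ?thesis .
  next
    assume "f = 2"
    have "norm (nl_rem f A u A1 u1 A2 u2) \<le> (c * 21900 * (8 / 10^5 * (11 / 10 + 11 / 10))
        + c * 37 * (33 / 1000 * (11 / 10 + 11 / 10) + 382 * (8 / 10^5 + 8 / 10^5))
        + c * 1140 * (22 / 10^4 + 22 / 10^4)) / 4"
      unfolding \<open>f = 2\<close> nl_rem_def nth_4 by (rule I)+
    also have "\<dots> \<le> c * qb f" using c \<open>f = 2\<close> by (simp add: qb_def)
    finally show ?thesis .
  next
    assume "f = 3"
    have "norm (nl_rem f A u A1 u1 A2 u2) \<le> (8 / 10^5 * (c * 1140) + 22 / 10^4 * (c * 37)) / 2"
      unfolding \<open>f = 3\<close> nl_rem_def nth_4 by (rule I)+
    also have "\<dots> \<le> c * qb f" using c \<open>f = 3\<close> by (simp add: qb_def)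
    finally show ?thesis .
  qed
qed

section \<open>The approximate branch\<close>

text \<open>Rounded floating point approximations; the entry in row \<open>i\<close> and column \<open>j\<close> is the
  coefficient of \<open>(x\<^sup>2 - 1/2)\<^sup>i t\<^sup>j\<close>. The lists with suffix \<open>0\<close> are the approximate branch, scaled by
  \<open>2\<^sup>3\<^sup>1\<close>. Scaled by \<open>2\<^sup>1\<^sup>9\<close> are those with suffix \<open>c\<close>, a coarser version of the branch that
  keeps the linearised residuals cheap to evaluate, and those with suffix \<open>v1\<close> to \<open>v4\<close>, approximate
  solutions of the linearised system for which one of \<open>r(1), s(1), r'(1), s'(1)\<close> is 1 and the
  others are 0.\<close>

definition P0 :: bipoly where
  "P0 =
    [[172663328, -85572052, -13213875, -1493046, -142958, -9234, 309, 263, 65, 12], [-3113432384, -177433645,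
    -16098831, -1676534, -115615, 6949, 5132, 1404, 297, 53, 8], [1232403581, 65563768, 18919644, 2631340,
    334378, 44671, 6515, 1039, 174, 29, 5], [-631972999, 85504779, -4270811, -809516, -149350, -35215, -8646,
    -1986, -414, -78, -13], [362005368, -98754703, -2473357, -907624, -149758, -20545, -1998, -11, 52, 15,
    3], [-212568891, 64225733, 1127331, 1257463, 235649, 46415, 9147, 1769, 340, 65, 12], [91274110,
    -30362782, 3093050, -475649, -65319, -15201, -3919, -1013, -254, -61, -14], [-32592097, 17658292,
    -3756957, 33820, -46120, -8414, -1272, -77, 36, 19, 6], [11597948, -10650788, 2389756, -33997, 52293,
    10131, 2123, 389, 59, 7], [-4951843, 5645745, -1258618, 106455, -25515, -3997, -960, -211, -43, -8],
    [2219533, -2680473, 748592, -125171, 11201, -460, 11], [-1000664, 1336666, -518729, 106900, -9608, 1774,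
    215, 69, 16], [323044, -477219, 219546, -48232, 5379, -949, -94, -35]]"

definition Q0 :: bipoly where
  "Q0 =
    [[43846411711, -502368356, -9343152, 7450416, -1021727, -658758, -172360, -33676, -5484, -763, -88],
    [6875701871, -1658631682, 300303461, 69662353, 13325568, 2404876, 389890, 54026, 5492, 62, -167],
    [-6408118255, -3173621244, -331438765, -92178035, -20165277, -3643562, -587588, -84319, -9994, -685, 96],
    [-547940519, 3232297177, 411099622, 88895532, 20817636, 4122959, 731275, 118662, 17363, 2154, 178],
    [3030395121, -1749131188, -256467712, -58939496, -13698429, -2905456, -560815, -99882, -16517, -2505,
    -334], [-1133568107, 431270283, 55597258, 22070769, 4628594, 1021830, 219577, 43941, 8305, 1493, 254],
    [246562392, -200767122, 29589690, -4580257, -724088, -152456, -41943, -10862, -2588, -570, -116],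
    [-52879007, 117336701, -20980694, 1068413, -21083, 15589, 8967, 3234, 936, 225, 46], [30966683,
    -54308967, 9721689, -1658391, -46713, -47381, -15376, -4030, -959, -203], [-14307018, 17813202, -5855365,
    1470869, 79864, 51547, 15823, 4080, 962, 206], [4525021, -6665391, 4505123, -901258, -1048, -29737,
    -8561, -2360, -588, -134], [-1526441, 3828166, -2976073, 559867, -67651, 12306, 2007, 664], [545952,
    -1562265, 1148625, -246947, 45437, -3576]]"

definition R0 :: bipoly where
  "R0 =
    [[7777556129, -244423708, 136305848, 29237170, 5304916, 985880, 177676, 30263, 4775, 675], [-33312106685,
    1865195491, -443670691, -91620286, -15616619, -2809252, -503009, -86601, -13986, -2056, -259],
    [40467998517, -5263819811, 85042291, -12068786, -6909237, -1749531, -344853, -57599, -8277, -960, -61],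
    [-11316664721, 6903887195, 613077385, 223348122, 47392913, 9596072, 1817726, 318312, 51336, 7485, 934],
    [3637083167, -4777768274, -155223250, -159417590, -31468634, -6403663, -1257261, -233035, -40743, -6698,
    -1025], [-2129656932, 2505579889, -155835919, 61359583, 8625591, 1819965, 358623, 68542, 12810, 2338,
    418], [1175306130, -1164819197, 198199054, -22455108, 1429887, 210385, 68239, 17762, 3943, 787, 142],
    [-459793926, 526122467, -150659472, 12240041, -3281014, -553913, -148876, -35535, -7939, -1682, -340],
    [167558091, -256196347, 93183823, -9553110, 2330672, 295868, 89690, 21848, 5068, 1132, 244], [-70893570,
    124280075, -50568428, 7186830, -1319573, -65233, -31904, -7768, -1847, -433, -99], [34050433, -58664833,
    27541125, -5417154, 881221, -39579, 9167, 1462, 373], [-16052615, 28342785, -16261502, 4136038, -720851,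
    71104, -6272], [5178342, -9781943, 6373913, -1832084, 342100, -39287, 3697]]"

definition S0 :: bipoly where
  "S0 =
    [[412149576, 54640038, 6819221, 945789, 107379, 5433, -1534, -655, -164, -33, -6], [-1716147721,
    -255334791, -32230629, -4263765, -459146, -17982, 8240, 3186, 774, 154, 26], [1921036120, 359319659,
    47118308, 5587999, 492290, -7036, -17279, -5347, -1192, -221, -35], [-281100667, -113505627, -18370525,
    -1146565, 175534, 85055, 22106, 4603, 814, 120, 13], [21023774, -62484337, -6943819, -1902449, -554529,
    -125019, -24072, -4132, -629, -80, -7], [-26960437, 51207672, 9773289, 2135180, 490460, 103623, 19912,
    3515, 572, 85, 11], [25969027, -23659138, -4055542, -1141233, -259361, -54909, -11053, -2098, -377, -64,
    -10], [-11290805, 9747006, 463103, 329156, 74766, 15390, 3188, 647, 128, 25, 5], [4315530, -5132277,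
    417373, -38207, -2257, 482, 208, 51, 9], [-1960493, 2687460, -316149, 9177, -7115, -2185, -563, -137,
    -31, -7], [995941, -1265452, 213565, -26439, 2681, 481, 120, 33, 9], [-467621, 588790, -176787, 29050,
    -1160, 446, 118, 31], [147583, -203041, 83863, -13725, 765, -299, -76, -22]]"

definition A0 :: bipoly where
  "A0 =
    [[380963955216, -403617797817, 30248779994, -4381978042, -652143735, -108764318, -18109524, -2980980,
    -473605, -70079, -9107]]"

definition Pc :: bipoly where
  "Pc =
    [[42154, -20892, -3226, -365, -35], [-760115, -43319, -3930, -409, -28], [300880, 16007, 4619, 642, 82,
    11, 2], [-154290, 20875, -1043, -198, -36, -9, -2], [88380, -24110, -604, -222, -37, -5], [-51897, 15680,
    275, 307, 58, 11, 2], [22284, -7413, 755, -116, -16, -4], [-7957, 4311, -917, 8, -11], [2832, -2600, 583,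
    -8, 13], [-1209, 1378, -307, 26], [542, -654, 183, -31], [-244, 326, -127, 26], [79, -117, 54]]"

definition Qc :: bipoly where
  "Qc =
    [[10704690, -122649, -2281, 1819, -249], [1678638, -404939, 73316, 17007, 3253, 587, 95], [-1564482,
    -774810, -80918, -22504, -4923, -890, -143], [-133775, 789135, 100366, 21703, 5082, 1007, 179, 29],
    [739843, -427034, -62614, -14390, -3344, -709, -137], [-276750, 105291, 13574, 5388, 1130, 249, 54],
    [60196, -49015, 7224, -1118, -177], [-12910, 28647, -5122, 261], [7560, -13259, 2373, -405], [-3493,
    4349, -1430, 359], [1105, -1627, 1100], [0, 935, -727]]"

definition Rc :: bipoly where
  "Rc =
    [[1898817, -59674, 33278, 7138, 1295], [-8132839, 455370, -108318, -22368, -3813, -686, -123], [9879882,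
    -1285112, 20762, -2946, -1687, -427, -84], [-2762858, 1685519, 149677, 54528, 11571, 2343, 444, 78],
    [887960, -1166447, -37896, -38920, -7683, -1563, -307, -57], [-519936, 611714, -38046, 14980, 2106, 444,
    88], [286940, -284380, 48388, -5482, 349], [-112254, 128448, -36782, 2988, -801, -135], [40908, -62548,
    22750, -2332, 569], [-17308, 30342, -12346, 1755, -322], [8313, -14322, 6724, -1323], [-3919, 6920,
    -3970, 1010], [1264, -2388, 1556]]"

definition Sc :: bipoly where
  "Sc =
    [[100622, 13340, 1665, 231, 26], [-418981, -62338, -7869, -1041, -112, -4], [469003, 87725, 11503, 1364,
    120, -2, -4], [-68628, -27711, -4485, -280, 43, 21, 5], [5133, -15255, -1695, -464, -135, -31, -6],
    [-6582, 12502, 2386, 521, 120, 25, 5], [6340, -5776, -990, -279, -63, -13], [-2757, 2380, 113, 80, 18],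
    [1054, -1253, 102, -9], [-479, 656, -77], [243, -309, 52], [-114, 144, -43], [0, -50]]"

definition Ac :: bipoly where
  "Ac =
    [[93008778, -98539501, 7384956, -1069819, -159215, -26554, -4421]]"

definition Pv1 :: bipoly where
  "Pv1 =
    [[1553, 353, 33], [-126, -216, -73, -16, -3], [764, -185, -25, 2, 1], [8776, 2113, 318, 36, 3], [-7446,
    -1935, -332, -43, -4], [5688, 821, 113, 14], [-3640, -263, 33, 15, 4, 1], [1347, 7, -37, -14, -3, -1]]"

definition Qv1 :: bipoly where
  "Qv1 =
    [[-292456, 118284, 3895, -352, -79], [281251, 52474, -5378, -107, 67, 18], [114466, -27372, -9162, -474,
    -69, -22, -6], [31563, -12754, 9732, 1227, 137, 26, 6], [-100143, 11696, -4694, -876, -110, -14], [58366,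
    -2345, 223, -12, 5], [-20031, 3674, 88, 376, 49, 9], [4847, -2752, 36, -166, -24]]"

definition Rv1 :: bipoly where
  "Rv1 =
    [[432827, 9222, -510, -48], [476430, -11798, 1621, 215], [-831731, -75328, -2354, -325, -17], [549627,
    145232, 6388, 256, 18], [-157118, -33534, -7769, -65, 59, 13], [100734, -27623, -2413, -512, -191, -42,
    -8], [-68061, 25905, 3987, 822, 195, 43, 8], [26706, -11478, -1528, -399, -88, -19]]"

definition Sv1 :: bipoly where
  "Sv1 =
    [[-2624, 797, 169, 21, 2], [12265, -2886, -731, -97, -10, -1], [-18071, 1812, 838, 136, 15, 2], [9292,
    1923, 27, -39, -6], [-3122, -779, -340, -37, -3], [1912, -14, 149, 25, 2], [-1413, 203, -15, 6, 2, 1],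
    [594, -115, -14, -10, -2]]"

definition Av1 :: bipoly where
  "Av1 =
    [[-13976225, -390052, 129384, 24624, 2821, 243]]"

definition Pv2 :: bipoly where
  "Pv2 =
    [[48218, -119692, -7548, -236, 76], [-136585, -166532, -8239, 516, 367, 95, 20], [-369037, 86741, 17303,
    1604, 245, 55, 14], [133884, -56518, -921, -1206, -436, -124, -31], [-78226, 74998, -8959, -698, 11, 24,
    8], [61885, -69886, 9701, 892, 262, 63, 15], [-37824, 43489, -7362, 573, -73, -29, -11], [12969, -15960,
    4384, -616, -15]]"

definition Qv2 :: bipoly where
  "Qv2 =
    [[-1346281, 1228291, 96103, -37569, -12164, -2500], [-3557449, 3108599, 266003, 81261, 18662, 3126, 391],
    [3502316, -2517419, -721730, -151146, -29047, -5066, -763], [-481906, -351116, 626732, 150262, 29797,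
    5774, 1023], [-664417, 1027220, -259070, -89068, -19656, -4224, -846], [350305, -421452, 47891, 19690,
    6604, 1712, 403], [-47119, 107940, -60996, 2854, -1432, -561, -163], [510, -38845, 38664, -1772, 398]]"

definition Rv2 :: bipoly where
  "Rv2 =
    [[-802577, 514180, 212471, 31575, 7337, 1588], [3119502, -2262539, -605237, -88508, -20039, -4457, -919],
    [-2938194, 3185309, -291937, -61369, -16031, -3106, -469], [107659, -2247765, 1715293, 305530, 72828,
    15852, 3055], [-873737, 2173639, -1048890, -174426, -45228, -10560, -2240], [802179, -1449573, 623841,
    5100, 14279, 2942, 657], [-508850, 886087, -433993, 55284, -2316, 711, 201], [178649, -337412, 197162,
    -36712, 313, -903, -235]]"

definition Sv2 :: bipoly where
  "Sv2 =
    [[677535, 42427, 5067, 240, -114, -47], [-339669, -169190, -23174, -1013, 546, 220, 56], [50615, 159811,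
    29511, 683, -933, -340, -83], [14352, 34054, -83, 2294, 953, 251, 52], [42418, -32553, -18479, -4510,
    -1023, -212, -39], [-16678, -4466, 12060, 3593, 798, 169, 33], [-266, 10665, -5376, -1568, -405, -95,
    -21], [1812, -4472, 1866, 324, 103, 27]]"

definition Av2 :: bipoly where
  "Av2 =
    [[-29142863, 74137488, -40313245, -3451201, -738503, -142564, -28532]]"

definition Pv3 :: bipoly where
  "Pv3 =
    [[-158, -102, -23, -3], [-1293, -328, -51, -5], [-1637, -207, -12], [1308, 273, 31, 3], [679, 134, 26, 5,
    1], [-991, -334, -63, -12, -2], [591, 266, 54, 11, 2], [-205, -99, -21, -4, -1]]"

definition Qv3 :: bipoly where
  "Qv3 =
    [[219611, -9689, -1530, -116], [-42661, -20784, 504, 325, 84, 18, 4], [-20932, -4019, 660, -181, -85,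
    -22, -5], [8167, 12136, -65, 46, 53, 17, 4], [30824, -6835, 73, 69, -4, -6, -2], [-15467, -1135, -360,
    -62, -15, -1], [4576, 8, 449, 4, 2], [-806, 524, -115, 14, 4]]"

definition Rv3 :: bipoly where
  "Rv3 =
    [[-79743, -6280, -316, 6, 9], [33294, 13719, 890, -20, -24, -8, -2], [303780, 23907, 1173, 67, -12, -7,
    -2], [-112358, -59666, -5448, -275, 43, 24, 7], [22948, 14790, 4459, 425, 18, -6, -3], [-12739, 57, -369,
    -129, -6, 1], [12722, -1847, -738, -122, -28, -6], [-4930, 514, 436, 93, 21, 5]]"

definition Sv3 :: bipoly where
  "Sv3 =
    [[2230, 251, 18, 1], [-9492, -1252, -102, -6], [11284, 2010, 203, 11, -1, -1], [-2642, -1011, -162, -10,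
    2, 1], [547, -68, 39, 4, -1, -1], [-457, 131, 3, 0, 1], [403, -42, 6], [-147, 7, -6]]"

definition Av3 :: bipoly where
  "Av3 =
    [[3021056, 522240, 38097, -839, -1056, -310, -73]]"

definition Pv4 :: bipoly where
  "Pv4 =
    [[-124613, 15456, 2500, 299, 17], [-124631, 26105, 4036, 479, 24, -5, -2], [154999, 3023, -2344, -291,
    -26, -1], [-131753, 5562, -723, -168, -22, 0, 1], [75016, -20556, 229, 104, 13, 1], [-57263, 26461, 478,
    234, 41, 7, 1], [32669, -18457, 501, -364, -65, -14, -3], [-11530, 8159, -815, 175, 29, 7, 2]]"

definition Qv4 :: bipoly where
  "Qv4 =
    [[2094048, -147068, -71289, -7311, 0, 211], [1835609, -333263, -10199, -6269, -2592, -654, -134],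
    [-1369354, -7996, 48915, 19362, 5053, 1110, 218], [-105994, 397112, -18025, -15646, -4462, -1080, -232],
    [789232, -497947, -28320, 2705, 1390, 455, 117], [-336679, 204694, 21426, 3312, 338, 0, -18], [91581,
    -109524, 10592, -1913, -236], [-19432, 44225, -9721, 149, -44]]"

definition Rv4 :: bipoly where
  "Rv4 =
    [[680905, 118333, -14374, -1697, -470, -134], [-3014956, -187699, 50512, 5983, 1258, 333, 87], [4032421,
    -880278, -39106, -3427, 825, 397, 94], [-1849268, 2116387, 5711, -2670, -3269, -1288, -338], [1095413,
    -1447421, -6306, -5017, 536, 489, 157], [-807425, 911103, -88268, 10192, 152, -25], [499272, -562022,
    119335, -9703, 712, 29], [-178365, 229009, -66960, 5393, -731, -46]]"

definition Sv4 :: bipoly where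
  "Sv4 =
    [[-100914, -9920, -1771, -303, -38], [134935, 36650, 7868, 1367, 171, 10, -2], [146626, -27437, -10020,
    -1794, -211, -6, 5], [-24510, -11544, 2345, 441, 7, -18, -7], [-2413, -5120, 647, 310, 107, 30, 7],
    [-2732, 10516, 540, -182, -71, -21, -5], [7492, -8945, -613, -34, 12, 6, 2], [-3460, 3612, 142, 42, 4]]"

definition Av4 :: bipoly where
  "Av4 =
    [[45663594, -54060984, 3479609, 310560, 74686, 14149, 2833]]"

definition LU :: "nat \<Rightarrow> bipoly" where "LU f = [P0, Q0, R0, S0] ! f"
definition LO :: "nat \<Rightarrow> bipoly" where "LO f = [Pc, Qc, Rc, Sc] ! f"
definition LV :: "nat \<Rightarrow> nat \<Rightarrow> bipoly" where
  "LV i f = [[Pv1, Qv1, Rv1, Sv1],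
     [Pv2, Qv2, Rv2, Sv2],
     [Pv3, Qv3, Rv3, Sv3],
     [Pv4, Qv4, Rv4, Sv4]] ! i ! f"
definition LA :: "nat \<Rightarrow> bipoly" where "LA i = [Av1, Av2, Av3, Av4] ! i"

text \<open>Bounds by component \<open>f\<close>, variation \<open>i\<close> and boundary condition \<open>k\<close>: residual of the branch
  (\<open>e0b\<close>), distance to its coarse version (\<open>epb\<close>), size of the variations (\<open>vb\<close>, and \<open>ab\<close> for
  the \<open>A\<close>-component), their linearised residuals (\<open>eib\<close>), and boundary defects of the branch
  (\<open>bb\<close>) and of the variations (\<open>cb\<close>).\<close>

definition e0b :: "nat \<Rightarrow> real" where "e0b f = [7 / 100000000, 13 / 10000000, 7 / 5000000, 11 / 100000000] ! f"
definition epb :: "nat \<Rightarrow> real" where "epb f = [1 / 50000, 1 / 2000, 3 / 5000, 1 / 50000] ! f"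
definition vb :: "nat \<Rightarrow> nat \<Rightarrow> real" where
  "vb i f = [[17 / 2500, 2811 / 2500, 7363 / 5000, 173 / 5000], [1599 / 2500, 24527 / 2000, 126223 / 10000, 10017 / 5000], [29 / 10000, 1257 / 2500, 191 / 1000, 113 / 5000], [231 / 500, 65223 / 10000, 15213 / 2000, 4043 / 10000]] ! i ! f"
definition ab :: "nat \<Rightarrow> real" where "ab i = [139 / 5, 2823 / 10, 69 / 10, 1977 / 10] ! i"
definition eib :: "nat \<Rightarrow> nat \<Rightarrow> real" where
  "eib i f = [[123 / 1000000, 1189 / 1000000, 2083 / 1000000, 203 / 1000000], [1773 / 1000000, 3763 / 250000, 10219 / 200000, 1501 / 1000000], [59 / 1000000, 21 / 62500, 507 / 1000000, 157 / 1000000], [901 / 1000000, 861 / 125000, 5671 / 250000, 547 / 1000000]] ! i ! f"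
definition bb :: "nat \<Rightarrow> real" where "bb k = [1 / 10000000, 1 / 100000000, 1 / 10000000, 1 / 10000000] ! k"
definition cb :: "nat \<Rightarrow> nat \<Rightarrow> real" where
  "cb k i = [[3 / 250000, 731 / 1000000, 3 / 250000, 151 / 1000000], [1 / 200000, 29 / 1000000, 1 / 200000, 1 / 100000], [39 / 1000000, 53 / 500000, 7 / 500000, 1 / 10000], [9 / 500000, 31 / 1000000, 7 / 500000, 9 / 500000]] ! k ! i"

text \<open>The integer is the entry of \<open>e0b\<close> times the denominator
  \<open>64 * 2^62\<close>, rounded down; for \<open>q\<close> and \<open>r\<close> the denominator
  is \<open>64 * 2^93\<close>. The bounds for the variations arise likewise from \<open>eib\<close>,
  with \<open>2^19\<close> in place of \<open>2^31\<close>.\<close>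

lemma res_p_sup: "sup_le (res_p (2 ^ 31) P0 Q0 R0 S0) 20660353362554"
  by code_simp

lemma res_q_sup: "sup_le (res_q (2 ^ 31) A0 P0 Q0 R0 S0) 823972890148349110972857"
  by code_simp

lemma res_r_sup: "sup_le (res_r (2 ^ 31) A0 P0 Q0 R0) 887355420159760581047692"
  by code_simp

lemma res_s_sup: "sup_le (res_s (2 ^ 31) P0 Q0 S0) 32466269569728"
  by code_simp

lemma lin_p_sup1: "sup_le (lin_p (2 ^ 19) Pc Qc Rc Sc Pv1 Qv1 Rv1 Sv1) 2163838883"
  by code_simp

lemma lin_q_sup1: "sup_le (lin_q (2 ^ 19) Ac Pc Qc Rc Sc Av1 Pv1 Qv1 Rv1 Sv1) 10966589351820328"
  by code_simp

lemma lin_r_sup1: "sup_le (lin_r (2 ^ 19) Ac Pc Qc Av1 Pv1 Qv1 Rv1) 19212283952768498"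
  by code_simp

lemma lin_s_sup1: "sup_le (lin_s (2 ^ 19) Pc Qc Pv1 Qv1 Sv1) 3571213767"
  by code_simp

lemma lin_p_sup2: "sup_le (lin_p (2 ^ 19) Pc Qc Rc Sc Pv2 Qv2 Rv2 Sv2) 31190945856"
  by code_simp

lemma lin_q_sup2: "sup_le (lin_q (2 ^ 19) Ac Pc Qc Rc Sc Av2 Pv2 Qv2 Rv2 Sv2) 138830195898738085"
  by code_simp

lemma lin_r_sup2: "sup_le (lin_r (2 ^ 19) Ac Pc Qc Av2 Pv2 Qv2 Rv2) 471268194223094769"
  by code_simp

lemma lin_s_sup2: "sup_le (lin_s (2 ^ 19) Pc Qc Pv2 Qv2 Sv2) 26405871252"
  by code_simp

lemma lin_p_sup3: "sup_le (lin_p (2 ^ 19) Pc Qc Rc Sc Pv3 Qv3 Rv3 Sv3) 1037938976"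
  by code_simp

lemma lin_q_sup3: "sup_le (lin_q (2 ^ 19) Ac Pc Qc Rc Sc Av3 Pv3 Qv3 Rv3 Sv3) 3099053004383204"
  by code_simp

lemma lin_r_sup3: "sup_le (lin_r (2 ^ 19) Ac Pc Qc Av3 Pv3 Qv3 Rv3) 4676249622685371"
  by code_simp

lemma lin_s_sup3: "sup_le (lin_s (2 ^ 19) Pc Qc Pv3 Qv3 Sv3) 2761973208"
  by code_simp

lemma lin_p_sup4: "sup_le (lin_p (2 ^ 19) Pc Qc Rc Sc Pv4 Qv4 Rv4 Sv4) 15850559626"
  by code_simp

lemma lin_q_sup4: "sup_le (lin_q (2 ^ 19) Ac Pc Qc Rc Sc Av4 Pv4 Qv4 Rv4 Sv4) 63530586589855695"
  by code_simp

lemma lin_r_sup4: "sup_le (lin_r (2 ^ 19) Ac Pc Qc Av4 Pv4 Qv4 Rv4) 209222971284013734"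
  by code_simp

lemma lin_s_sup4: "sup_le (lin_s (2 ^ 19) Pc Qc Pv4 Qv4 Sv4) 9622925766"
  by code_simp

lemma approx_sup: "sup_le Pc 571473 \<and>
   sup_le Qc 12137267 \<and>
   sup_le Rc 9882828 \<and>
   sup_le Sc 515899 \<and>
   sup_le Ac 200225587"
  by code_simp

text \<open>The factor \<open>2^12\<close> brings the coarse lists to the denominator
  \<open>2^31\<close>.\<close>

lemma diff_sup: "sup_le (badd P0 (bsm (- (2 ^ 12)) Pc)) 42949 \<and>
   sup_le (badd Q0 (bsm (- (2 ^ 12)) Qc)) 1073741 \<and>
   sup_le (badd R0 (bsm (- (2 ^ 12)) Rc)) 1288490 \<and>
   sup_le (badd S0 (bsm (- (2 ^ 12)) Sc)) 42949 \<and>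
   sup_le (badd A0 (bsm (- (2 ^ 12)) Ac)) 4294967"
  by code_simp

lemma var_sup: "sup_le Pv1 3565 \<and>
   sup_le Qv1 589509 \<and>
   sup_le Rv1 772066 \<and>
   sup_le Sv1 18140 \<and>
   sup_le Pv2 335334 \<and>
   sup_le Qv2 6429605 \<and>
   sup_le Rv2 6617720 \<and>
   sup_le Sv2 1050358 \<and>
   sup_le Pv3 1520 \<and>
   sup_le Qv3 263612 \<and>
   sup_le Rv3 100139 \<and>
   sup_le Sv3 11848 \<and>
   sup_le Pv4 242221 \<and>
   sup_le Qv4 3419563 \<and>
   sup_le Rv4 3987996 \<and>
   sup_le Sv4 211969 \<and>
   sup_le Av1 14575206 \<and>
   sup_le Av2 148006502 \<and>
   sup_le Av3 3617587 \<and>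
   sup_le Av4 103651737"
  by code_simp

lemma bc_half: "half_le R0 214 \<and>
   half_le S0 21 \<and>
   half_le (bsm 2 (bder R0)) 214 \<and>
   half_le (badd S0 (bsm 2 (bder S0))) 214"
  by code_simp

lemma bc_var_half: "half_le (badd Rv1 [[- (2 ^ 19)]]) 6 \<and>
   half_le Rv2 383 \<and>
   half_le Rv3 6 \<and>
   half_le Rv4 79 \<and>
   half_le Sv1 2 \<and>
   half_le (badd Sv2 [[- (2 ^ 19)]]) 15 \<and>
   half_le Sv3 2 \<and>
   half_le Sv4 5 \<and>
   half_le (bsm 2 (bder Rv1)) 20 \<and>
   half_le (bsm 2 (bder Rv2)) 55 \<and>
   half_le (badd (bsm 2 (bder Rv3)) [[- (2 ^ 19)]]) 7 \<and>
   half_le (bsm 2 (bder Rv4)) 52 \<and>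
   half_le (badd Sv1 (bsm 2 (bder Sv1))) 9 \<and>
   half_le (badd Sv2 (bsm 2 (bder Sv2))) 16 \<and>
   half_le (badd Sv3 (bsm 2 (bder Sv3))) 7 \<and>
   half_le (badd (badd Sv4 (bsm 2 (bder Sv4))) [[- (2 ^ 19)]]) 9"
  by code_simp

text \<open>Since \<open>1048576 = 2 * 2^19\<close>, the coarse \<open>q\<close> stays within 2 of
  21 at \<open>x = 1\<close> for every \<open>t\<close> in the disc.\<close>

lemma q_half: "half_le (badd Qc [[- (21 * 2 ^ 19)]]) 1048576"
  by code_simp

text \<open>A list with one row is a function of \<open>t\<close> alone, so the scalar
  \<open>A\<close> can share the machinery for functions of \<open>x\<close>, evaluated at any
  point.\<close>

lemma single_lists: "ev A0 z t = ev A0 z' t" "ev Ac z t = ev Ac z' t" "i < 4 \<Longrightarrow> ev (LA i) z t = ev (LA i) z' t"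
  by (auto simp: A0_def Ac_def LA_def Av1_def Av2_def Av3_def Av4_def less_4_iff)

lemma ev_double_square: "ev [[1], [2]] (zt x) t = 2 * (of_real x * of_real x)"
  by (simp add: zt_def power2_eq_square)

lemma res_eq:
  fixes d x :: real and t :: complex and D :: int and P Q R S :: bipoly
  assumes d: "d = of_int D" and D: "D \<noteq> 0"
  defines "u \<equiv> \<lambda>i. cpt i ([P, Q, R, S] ! i) d x t"
  shows "cpt_d2 0 P d x t + nl 0 (mu t) (cpt 0 A d x t) u
      = om 0 x * ev (res_p D P Q R S) (zt x) t / of_real (64 * d ^ 2)"
    and "cpt_d2 1 Q d x t + nl 1 (mu t) (cpt 0 A d x t) u
      = om 1 x * ev (res_q D A P Q R S) (zt x) t / of_real (64 * d ^ 3)"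
    and "cpt_d2 2 R d x t + nl 2 (mu t) (cpt 0 A d x t) u
      = om 2 x * ev (res_r D A P Q R) (zt x) t / of_real (64 * d ^ 3)"
    and "cpt_d2 3 S d x t + nl 3 (mu t) (cpt 0 A d x t) u
      = om 3 x * ev (res_s D P Q S) (zt x) t / of_real (64 * d ^ 2)"
  using D unfolding res_p_def res_q_def res_r_def res_s_def ev_badd ev_bsm ev_bmul ev_double_square u_def d
  by (simp_all add: cpt_d2_def cpt_def om_def nl_def mu_def field_simps power2_eq_square power3_eq_cube)

lemma lin_eq:
  fixes d x :: real and t :: complex and D :: int and P Q R S p q r s :: bipoly
  assumes d: "d = of_int D" and D: "D \<noteq> 0"
  defines "u \<equiv> \<lambda>i. cpt i ([P, Q, R, S] ! i) d x t"
    and "v \<equiv> \<lambda>i. cpt i ([p, q, r, s] ! i) d x t"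
  shows "cpt_d2 0 p d x t + nl_lin 0 (mu t) (cpt 0 A d x t) u (cpt 0 a d x t) v
      = om 0 x * ev (lin_p D P Q R S p q r s) (zt x) t / of_real (64 * d ^ 2)"
    and "cpt_d2 1 q d x t + nl_lin 1 (mu t) (cpt 0 A d x t) u (cpt 0 a d x t) v
      = om 1 x * ev (lin_q D A P Q R S a p q r s) (zt x) t / of_real (64 * d ^ 3)"
    and "cpt_d2 2 r d x t + nl_lin 2 (mu t) (cpt 0 A d x t) u (cpt 0 a d x t) v
      = om 2 x * ev (lin_r D A P Q a p q r) (zt x) t / of_real (64 * d ^ 3)"
    and "cpt_d2 3 s d x t + nl_lin 3 (mu t) (cpt 0 A d x t) u (cpt 0 a d x t) v
      = om 3 x * ev (lin_s D P Q p q s) (zt x) t / of_real (64 * d ^ 2)"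
  using D unfolding lin_p_def lin_q_def lin_r_def lin_s_def ev_badd ev_bsm ev_bmul ev_double_square u_def v_def d
  by (simp_all add: cpt_d2_def cpt_def om_def nl_lin_def mu_def field_simps power2_eq_square power3_eq_cube)

section \<open>From integer certificates to bounds on the functions\<close>

definition nlob :: "nat \<Rightarrow> real" where "nlob f = [109 / 100, 463 / 20, 377 / 20, 123 / 125] ! f"

lemma norm_om_le: "x \<in> {-1..1} \<Longrightarrow> norm (om f x) \<le> 1"
  by (auto simp: om_def)

lemma norm_om_ev_le:
  assumes "sup_le L m" "x \<in> {-1..1}" "norm t \<le> 1" "of_int m / C \<le> B" "C > 0"
  shows "norm (om f x * ev L (zt x) t / of_real C) \<le> B"
proof -
  have "norm (om f x * ev L (zt x) t) \<le> 1 * of_int m"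
    unfolding norm_mult
    by (intro mult_mono norm_om_le assms(2) sup_leD[OF assms(1-3)]) (auto intro: order_trans[OF norm_ge_zero sup_leD[OF assms(1-3)]])
  hence "norm (om f x * ev L (zt x) t) / C \<le> of_int m / C"
    using assms(5) by (intro divide_right_mono) auto
  thus ?thesis
    using assms(4,5) by (simp add: norm_divide)
qed

lemma norm_cpt_le:
  assumes "sup_le L m" "x \<in> {-1..1}" "norm t \<le> 1" "of_int m / D \<le> B" "D > 0"
  shows "norm (cpt f L D x t) \<le> B"
  unfolding cpt_def by (rule norm_om_ev_le[OF assms])

lemma norm_cpt_diff_le:
  assumes "sup_le (badd L (bsm (- k) L')) m" "x \<in> {-1..1}" "norm t \<le> 1" "of_int m / D \<le> B" "D > 0" "D = of_int k * D'"
  shows "norm (cpt f L D x t - cpt f L' D' x t) \<le> B"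
proof -
  have "of_int k \<noteq> (0::real)" "D' \<noteq> 0" using assms(5,6) by auto
  hence "cpt f L D x t - cpt f L' D' x t = cpt f (badd L (bsm (- k) L')) D x t"
    using assms(6) by (simp add: cpt_def field_simps)
  thus ?thesis
    using norm_cpt_le[OF assms(1-5)] by simp
qed

definition DU :: real where "DU = 2 ^ 31"
definition DV :: real where "DV = 2 ^ 19"

abbreviation "u0 \<equiv> \<lambda>f. cpt f (LU f) DU"
abbreviation "ulo \<equiv> \<lambda>f. cpt f (LO f) DV"
abbreviation "vv \<equiv> \<lambda>i f. cpt f (LV i f) DV"
abbreviation "a0 \<equiv> cpt 0 A0 DU 0"
abbreviation "alo \<equiv> cpt 0 Ac DV 0"
abbreviation "av \<equiv> \<lambda>i. cpt 0 (LA i) DV 0"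

lemma cpt_single:
  "cpt 0 A0 D 0 t = cpt 0 A0 D x t" "cpt 0 Ac D 0 t = cpt 0 Ac D x t"
  "i < 4 \<Longrightarrow> cpt 0 (LA i) D 0 t = cpt 0 (LA i) D x t"
  unfolding cpt_def om_def
  using single_lists(1,2)[of "zt 0" t "zt x"] single_lists(3)[of i "zt 0" t "zt x"] by simp_all

context
  fixes x :: real and t :: complex
  assumes x: "x \<in> {-1..1}" and t: "norm t \<le> 1"
begin

lemma ulo_bound:
  assumes "f < 4"
  shows "norm (ulo f x t) \<le> nlob f"
  using assms approx_sup unfolding less_4_iff
  apply (elim disjE conjE)
  by (hypsubst, simp only: LO_def nlob_def nth_4, rule norm_cpt_le[OF _ x t], assumption, simp add: DV_def, simp add: DV_def)+

lemma diff_bound: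
  assumes "f < 4"
  shows "norm (u0 f x t - ulo f x t) \<le> epb f"
  using assms diff_sup unfolding less_4_iff
  apply (elim disjE conjE)
  by (hypsubst, simp only: LU_def LO_def epb_def nth_4, rule norm_cpt_diff_le[OF _ x t], assumption, simp add: DU_def, simp add: DU_def, simp add: DU_def DV_def)+

lemma a_bounds: "norm (alo t) \<le> 3819 / 10" "norm (a0 t - alo t) \<le> 2 / 1000"
  using approx_sup diff_sup
proof -
  have a: "sup_le Ac 200225587" "sup_le (badd A0 (bsm (- (2 ^ 12)) Ac)) 4294967"
    using approx_sup diff_sup by blast+
  show "norm (alo t) \<le> 3819 / 10"
    by (rule norm_cpt_le[OF a(1) _ t]) (simp_all add: DV_def)
  show "norm (a0 t - alo t) \<le> 2 / 1000"
    by (rule norm_cpt_diff_le[OF a(2) _ t]) (simp_all add: DU_def DV_def)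
qed

lemma v_bound:
  assumes "i < 4" "f < 4"
  shows "norm (vv i f x t) \<le> vb i f"
  using assms var_sup unfolding less_4_iff
  apply (elim disjE conjE)
  by (hypsubst, simp only: LV_def vb_def nth_4, rule norm_cpt_le[OF _ x t], assumption, simp add: DV_def, simp add: DV_def)+

lemma av_bound:
  assumes "i < 4"
  shows "norm (av i t) \<le> ab i"
  using assms var_sup unfolding less_4_iff
  apply (elim disjE conjE)
  by (hypsubst, simp only: LA_def ab_def nth_4, rule norm_cpt_le[OF _ _ t], assumption, simp, simp add: DV_def, simp add: DV_def)+

lemma res_bound:
  assumes f: "f < 4"
  shows "norm (cpt_d2 f (LU f) DU x t + nl f (mu t) (a0 t) (\<lambda>i. u0 i x t)) \<le> e0b f"
proof -
  have d: "DU = of_int (2 ^ 31)" and D: "(2::int) ^ 31 \<noteq> 0" by (simp_all add: DU_def)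
  note E = res_eq[OF d D, where P = P0 and Q = Q0 and R = R0 and S = S0 and A = A0 and x = x and t = t]
  note B = norm_om_ev_le[OF res_p_sup x t] norm_om_ev_le[OF res_q_sup x t]
    norm_om_ev_le[OF res_r_sup x t] norm_om_ev_le[OF res_s_sup x t]
  show ?thesis
    using f unfolding less_4_iff cpt_single(1)[of _ t x] LU_def e0b_def
    apply (elim disjE)
    by (hypsubst, simp only: nth_4 E, rule B, simp add: DU_def, simp add: DU_def)+
qed

lemma lin_bound:
  assumes i: "i < 4" and f: "f < 4"
  shows "norm (cpt_d2 f (LV i f) DV x t
           + nl_lin f (mu t) (alo t) (\<lambda>j. ulo j x t) (av i t) (\<lambda>j. vv i j x t)) \<le> eib i f"
proof -
  have d: "DV = of_int (2 ^ 19)" and D: "(2::int) ^ 19 \<noteq> 0" by (simp_all add: DV_def)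
  note E = lin_eq[OF d D, where P = Pc and Q = Qc and R = Rc and S = Sc and A = Ac and x = x and t = t]
  note B = lin_p_sup1 lin_p_sup2 lin_p_sup3 lin_p_sup4 lin_q_sup1 lin_q_sup2 lin_q_sup3 lin_q_sup4
    lin_r_sup1 lin_r_sup2 lin_r_sup3 lin_r_sup4 lin_s_sup1 lin_s_sup2 lin_s_sup3 lin_s_sup4
  show ?thesis
    unfolding cpt_single(2)[of _ t x] cpt_single(3)[OF i, of _ t x]
    using f i unfolding less_4_iff LV_def LO_def LA_def eib_def
    apply (elim disjE)
    by (hypsubst, simp only: nth_4 E, rule norm_om_ev_le[OF _ x t], rule B, simp add: DV_def, simp add: DV_def)+
qed

end

text \<open>The four boundary values \<open>r(1), s(1), r'(1), s'(1)\<close> of an approximation.\<close>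

definition bdry :: "nat \<Rightarrow> (nat \<Rightarrow> bipoly) \<Rightarrow> family" where
  "bdry k L D t = (if k < 2 then cpt (k + 2) (L (k + 2)) D 1 t else cpt_d1 k (L k) D 1 t)"

lemma zt_1: "zt 1 = 1 / 2" by (simp add: zt_def)

text \<open>At \<open>x = 1\<close> the \<open>x\<close>-derivative of \<open>L\<close> is
  \<open>2 L'\<close> and that of \<open>x * L\<close> is \<open>L + 2 L'\<close>, so all four
  boundary values are values of lists at \<open>1 / 2\<close>.\<close>

lemma bdry_eqs:
  "bdry 0 L D t = ev (L 2) (1 / 2) t / of_real D"
  "bdry 1 L D t = ev (L 3) (1 / 2) t / of_real D"
  "bdry 2 L D t = ev (bsm 2 (bder (L 2))) (1 / 2) t / of_real D"
  "bdry 3 L D t = ev (badd (L 3) (bsm 2 (bder (L 3)))) (1 / 2) t / of_real D"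
  by (simp_all add: bdry_def cpt_def cpt_d1_def om_def zt_1 del: add_2_eq_Suc add_2_eq_Suc' One_nat_def)

lemma norm_half_le:
  assumes "half_le L m" "norm t \<le> 1" "of_int m / D \<le> B" "D > 0"
  shows "norm (ev L (1 / 2) t / of_real D) \<le> B"
  using half_leD[OF assms(1,2)] assms(3,4)
  by (auto simp: norm_divide intro: order_trans[OF divide_right_mono])

lemma bdry_bound:
  assumes t: "norm t \<le> 1" and k: "k < 4"
  shows "norm (bdry k LU DU t) \<le> bb k"
  using k bc_half unfolding less_4_iff
  apply (elim disjE conjE)
  by (hypsubst, simp only: bdry_eqs LU_def bb_def nth_4, rule norm_half_le[OF _ t], assumption, simp add: DU_def, simp add: DU_def)+

lemma DV_int: "DV = of_int (2 ^ 19)"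
  by (simp add: DV_def)

lemma bdry_var_diag:
  assumes "half_le (badd L [[- k]]) m" "norm t \<le> 1" "of_int m / D \<le> B" "D > 0" "D = of_int k"
  shows "norm (ev L (1 / 2) t / of_real D - 1) \<le> B"
proof -
  have "ev L (1 / 2) t / of_real D - 1 = ev (badd L [[- k]]) (1 / 2) t / of_real D"
    using assms(4,5) by (simp add: field_simps)
  thus ?thesis using norm_half_le[OF assms(1-4)] by simp
qed

lemma num_ineqs:
  "(0::nat) = 1 \<longleftrightarrow> False" "(1::nat) = 0 \<longleftrightarrow> False" "(0::nat) = 2 \<longleftrightarrow> False" "(2::nat) = 0 \<longleftrightarrow> False"
  "(0::nat) = 3 \<longleftrightarrow> False" "(3::nat) = 0 \<longleftrightarrow> False" "(1::nat) = 2 \<longleftrightarrow> False" "(2::nat) = 1 \<longleftrightarrow> False"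
  "(1::nat) = 3 \<longleftrightarrow> False" "(3::nat) = 1 \<longleftrightarrow> False" "(2::nat) = 3 \<longleftrightarrow> False" "(3::nat) = 2 \<longleftrightarrow> False"
  by simp_all

lemma bdry_var_bound:
  assumes t: "norm t \<le> 1" and k: "k < 4" and i: "i < 4"
  shows "norm (bdry k (LV i) DV t - (if i = k then 1 else 0)) \<le> cb k i"
  using k i bc_var_half unfolding less_4_iff
  apply (elim disjE conjE)
  by (hypsubst, simp only: bdry_eqs LV_def cb_def nth_4 if_True if_False refl num_ineqs diff_zero simp_thms, rule norm_half_le[OF _ t] bdry_var_diag[OF _ t], assumption,
      simp add: DV_def, simp add: DV_def, (rule DV_int)?)+

text \<open>The double primitive and its derivative vanish at \<open>x = 0\<close>: the initial data
  are moved by the amplitudes alone.\<close>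

definition Uf :: "(nat \<Rightarrow> family) \<Rightarrow> nat \<Rightarrow> family" where
  "Uf h f x t = u0 f x t + (\<Sum>i<4. h (4 + i) 0 t * vv i f x t) + prim (prim (h f)) x t"

definition Af :: "(nat \<Rightarrow> family) \<Rightarrow> complex \<Rightarrow> complex" where
  "Af h t = a0 t + (\<Sum>i<4. h (4 + i) 0 t * av i t)"

text \<open>Contribution of the double primitives to the boundary values, indexed as in
  \<open>bdry\<close>: \<open>k = 0, 1\<close> for the values of \<open>r, s\<close> and
  \<open>k = 2, 3\<close> for their derivatives.\<close>

definition bK :: "(nat \<Rightarrow> family) \<Rightarrow> nat \<Rightarrow> complex \<Rightarrow> complex" where
  "bK h k t = (if k < 2 then prim (prim (h (k + 2))) 1 t else prim (h k) 1 t)"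

text \<open>A state consists of the second derivatives \<open>h f\<close> (\<open>f < 4\<close>) of the corrections and the
  amplitudes \<open>h (4 + i) 0\<close> of the four approximate variations.\<close>

definition Top :: "(nat \<Rightarrow> family) \<Rightarrow> nat \<Rightarrow> family" where
  "Top h j x t =
     (if j < 4 then - (nl j (mu t) (Af h t) (\<lambda>f. Uf h f x t) + cpt_d2 j (LU j) DU x t
                       + (\<Sum>i<4. h (4 + i) 0 t * cpt_d2 j (LV i j) DV x t))
      else - (bdry (j - 4) LU DU t
              + (\<Sum>i<4. h (4 + i) 0 t * (bdry (j - 4) (LV i) DV t - (if i = j - 4 then 1 else 0)))
              + bK h (j - 4) t))"

definition Wt :: "nat \<Rightarrow> real \<Rightarrow> real" where
  "Wt j x = (if j < 4 then wt j * cosh (6 * x) else dt (j - 4))"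

text \<open>Large enough that 7/100 of it covers the residuals, the fourth equation being the
  tightest, and small enough that \<open>rho * yb\<close> fits into \<open>zb\<close>.\<close>

definition rho :: real where "rho = 14 / 10 ^ 7"

section \<open>Numerical inequalities between the constants\<close>

lemma sum_4: "(\<Sum>i<(4::nat). F i) = F 0 + F 1 + F 2 + F 3"
  by (simp add: eval_nat_numeral)

lemma wt_pos: "f < 4 \<Longrightarrow> wt f > 0" and dt_pos: "f < 4 \<Longrightarrow> dt f > 0"
  by (auto simp: less_4_iff wt_def dt_def)

lemma num_y: "f < 4 \<Longrightarrow> (\<Sum>i<4. dt i * vb i f) + wt f * (203 / 36) \<le> yb f"
  by (auto simp: sum_4 less_4_iff dt_def vb_def wt_def yb_def)

lemma num_ya: "(\<Sum>i<4. dt i * ab i) \<le> 21900"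
  by (simp add: sum_4 dt_def ab_def)

lemma num_z: "f < 4 \<Longrightarrow> epb f + rho * yb f \<le> zb f"
  by (auto simp: less_4_iff yb_def epb_def zb_def rho_def)

lemma num_nb: "f < 4 \<Longrightarrow> nlob f + zb f \<le> nb f"
  by (auto simp: less_4_iff nlob_def zb_def nb_def)

text \<open>The budget of the differential equations: feedback of the amplitudes, quadratic
  remainder, and the 67/100 of the linear part. As \<open>dt\<close> reaches 890, the feedback is
  affordable only because the linearised residuals \<open>eib\<close> are small.\<close>

lemma num_tot: "f < 4 \<Longrightarrow> (\<Sum>i<4. dt i * eib i f) + qb f + 67 / 100 * wt f \<le> 93 / 100 * wt f"
  by (auto simp: sum_4 less_4_iff dt_def eib_def qb_def wt_def)

text \<open>The boundary values of the double primitives come without a small factor;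
  \<open>dt\<close> is chosen so that they fit into 93/100 of it, which makes it a little larger
  than \<open>wt * 203 / 36\<close> or \<open>wt * 203 / 6\<close>.\<close>

lemma num_delta:
  "k < 4 \<Longrightarrow> (\<Sum>i<4. dt i * cb k i) + (if k < 2 then wt (k + 2) * (203 / 36) else wt k * (203 / 6)) \<le> 93 / 100 * dt k"
  by (auto simp: sum_4 less_4_iff dt_def cb_def wt_def simp del: add_2_eq_Suc add_2_eq_Suc' One_nat_def)

lemma num_0: "f < 4 \<Longrightarrow> e0b f \<le> (1 - 93 / 100) * rho * wt f" "f < 4 \<Longrightarrow> bb f \<le> (1 - 93 / 100) * rho * dt f"
  by (auto simp: less_4_iff e0b_def wt_def rho_def bb_def dt_def)

subsection \<open>Admissibility\<close>

lemma adm_scaled: "adm 1 (\<lambda>x. d) \<Longrightarrow> adm \<sigma> f \<Longrightarrow> adm \<sigma> (\<lambda>x t. d t * f x t)"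
  by (rule adm_mult[of 1 "\<lambda>x. d"]) simp_all

lemma adm_at_half: "adm 1 (\<lambda>x. ev L (1 / 2))"
  using adm_at_point[OF adm_ev, of 1 L] by (simp add: zt_1)

lemma adm_bdry:
  assumes "k < 4"
  shows "adm 1 (\<lambda>x. bdry k L D)"
proof -
  have "\<exists>L'. \<forall>t. bdry k L D t = ev L' (1 / 2) t / of_real D"
    using assms unfolding less_4_iff by (elim disjE) (metis bdry_eqs)+
  then obtain L' where "bdry k L D = (\<lambda>t. ev L' (1 / 2) t / of_real D)"
    by (auto simp: fun_eq_iff)
  thus ?thesis
    using adm_mult[OF adm_at_half adm_of_real[of "1 / D"], of 1 L'] by simp
qed

context
  fixes h :: "nat \<Rightarrow> family"
  assumes h: "\<And>i. i < 8 \<Longrightarrow> adm (par i) (h i)"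
begin

lemma adm_amp: "i < 4 \<Longrightarrow> adm 1 (\<lambda>x. h (4 + i) 0)"
  by (rule adm_at_point[OF h]) auto

lemma adm_prim2: "f < 4 \<Longrightarrow> adm (par f) (prim (prim (h f)))"
  using adm_prim[OF adm_prim[OF h]] by simp

lemma adm_Uf: "f < 4 \<Longrightarrow> adm (par f) (Uf h f)"
  unfolding Uf_def[abs_def] by (intro adm_add adm_sum adm_scaled adm_amp adm_cpt adm_prim2) auto

lemma adm_Af: "adm 1 (\<lambda>x. Af h)"
proof -
  have "adm 1 (\<lambda>x. cpt 0 L D 0)" for L D
    using adm_at_point[OF adm_cpt, of 0 0 L D] by simp
  thus ?thesis
    unfolding Af_def[abs_def] by (intro adm_add adm_sum adm_scaled adm_amp) auto
qed

lemma adm_mu: "adm 1 (\<lambda>x. mu)"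
proof (rule adm_const)
  show "mu holomorphic_on ball 0 1" unfolding mu_def[abs_def] by (intro holomorphic_intros) auto
  show "z \<in> \<real> \<Longrightarrow> mu z \<in> \<real>" for z unfolding mu_def by auto
qed

lemma adm_nl: "f < 4 \<Longrightarrow> adm (par f) (\<lambda>x t. nl f (mu t) (Af h t) (\<lambda>i. Uf h i x t))"
proof -
  have U: "adm 1 (Uf h 0)" "adm (- 1) (Uf h 1)" "adm 1 (Uf h 2)" "adm (- 1) (Uf h 3)"
    using adm_Uf[of 0] adm_Uf[of 1] adm_Uf[of 2] adm_Uf[of 3] by (simp_all add: par_def)
  have uu: "adm 1 (\<lambda>x t. Uf h 2 x t * Uf h 0 x t)" "adm 1 (\<lambda>x t. Uf h 3 x t * Uf h 1 x t)"
    "adm (- 1) (\<lambda>x t. Uf h 3 x t * Uf h 0 x t)" "adm (- 1) (\<lambda>x t. Uf h 2 x t * Uf h 1 x t)"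
    "adm 1 (\<lambda>x t. Uf h 0 x t * Uf h 0 x t)" "adm 1 (\<lambda>x t. Uf h 1 x t * Uf h 1 x t)"
    "adm (- 1) (\<lambda>x t. Uf h 0 x t * Uf h 1 x t)"
    by (rule adm_mult[OF U(3) U(1)] adm_mult[OF U(4) U(2)] adm_mult[OF U(4) U(1)] adm_mult[OF U(3) U(2)]
        adm_mult[OF U(1) U(1)] adm_mult[OF U(2) U(2)] adm_mult[OF U(1) U(2)]; simp)+
  have c: "adm \<sigma> f \<Longrightarrow> adm \<sigma> (\<lambda>x t. of_real r * f x t)" "adm \<sigma> f \<Longrightarrow> adm \<sigma> (\<lambda>x t. f x t / 4)" for \<sigma> f r
    using adm_scaled[OF adm_of_real[of r]] adm_scaled[OF adm_of_real[of "1 / 4"]] by simp_all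
  have mm: "adm 1 (\<lambda>x t. 4 * mu t)" using c(1)[OF adm_mu, of 4] by simp
  have two: "adm \<sigma> f \<Longrightarrow> adm \<sigma> (\<lambda>x t. 2 * f x t)" for \<sigma> f using c(1)[of \<sigma> f 2] by simp
  show "adm (par f) (\<lambda>x t. nl f (mu t) (Af h t) (\<lambda>i. Uf h i x t))" if "f < 4"
    using that unfolding less_4_iff
    by (elim disjE; hypsubst; simp add: nl_def par_def;
        intro c(2) adm_add adm_diff two adm_scaled[OF adm_mu] adm_scaled[OF mm] adm_scaled[OF adm_Af] U uu
          U[unfolded One_nat_def] uu[unfolded One_nat_def])
qed

lemma adm_Top: "j < 8 \<Longrightarrow> adm (par j) (Top h j)"
proof (cases "j < 4")
  case True
  have "adm (par j) (\<lambda>x t. - (nl j (mu t) (Af h t) (\<lambda>f. Uf h f x t) + cpt_d2 j (LU j) DU x t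
                       + (\<Sum>i<4. h (4 + i) 0 t * cpt_d2 j (LV i j) DV x t)))"
    using True unfolding cpt_d2_def
    by (intro adm_uminus adm_add adm_sum adm_scaled adm_amp adm_nl adm_cpt) auto
  thus ?thesis using True by (simp add: Top_def[abs_def])
next
  case False
  moreover assume "j < 8"
  ultimately have k: "j - 4 < 4" by auto
  have b: "adm 1 (\<lambda>x. bK h (j - 4))"
  proof (cases "j - 4 < 2")
    case True
    have "adm 1 (\<lambda>x. prim (prim (h (j - 4 + 2))) 1)"
      by (rule adm_at_point[OF adm_prim[OF adm_prim[OF h]]]) (use True in auto)
    thus ?thesis using True by (simp add: bK_def[abs_def])
  next
    case False
    have "adm 1 (\<lambda>x. prim (h (j - 4)) 1)"
      by (rule adm_at_point[OF adm_prim[OF h]]) (use k in auto)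
    thus ?thesis using False by (simp add: bK_def[abs_def])
  qed
  have one: "adm 1 (\<lambda>x z. if P then 1 else 0)" for P
    using adm_of_real[of 1] adm_of_real[of 0] by simp
  have "adm 1 (\<lambda>x t. - (bdry (j - 4) LU DU t
              + (\<Sum>i<4. h (4 + i) 0 t * (bdry (j - 4) (LV i) DV t - (if i = j - 4 then 1 else 0)))
              + bK h (j - 4) t))"
    using k by (intro adm_uminus adm_add adm_sum adm_scaled adm_amp adm_diff adm_bdry b one) auto
  thus ?thesis using False by (simp add: Top_def[abs_def] par_def)
qed

end

subsection \<open>Estimates\<close>

lemma prim2_diff:
  assumes "hol_family (ball 0 1) f" "hol_family (ball 0 1) g" "z \<in> ball 0 1" "x \<in> {-1..1}"
  shows "prim (prim (\<lambda>x z. f x z - g x z)) x z = prim (prim f) x z - prim (prim g) x z"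
proof -
  note P = hol_family_prim(1)[OF open_ball]
  have "prim (prim (\<lambda>x z. f x z - g x z)) x z
      = (\<lambda>x. prim (prim f) x z - prim (prim g) x z) x - (\<lambda>x. prim (prim f) x z - prim (prim g) x z) 0"
  proof (rule prim_eq_antiderivative[OF _ assms(4)])
    fix y :: real assume y: "y \<in> {-1..1}"
    show "((\<lambda>x. prim (prim f) x z - prim (prim g) x z) has_vector_derivative prim (\<lambda>x z. f x z - g x z) y z)
        (at y within {-1..1})"
      unfolding prim_diff[OF assms(1-3) y]
      by (intro has_vector_derivative_diff prim_has_vector_derivative[OF P assms(3) y] assms)
  qed
  thus ?thesis by (simp add: prim_def)
qed

lemma in_ball_cosh:
  assumes "in_ball 8 Wt c h" "f < 4" "x \<in> {-1..1}" "t \<in> ball 0 1"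
  shows "norm (h f x t) \<le> c * wt f * cosh (6 * x)"
proof -
  have "norm (h f x t) \<le> c * Wt f x"
    using assms unfolding in_ball_def by (auto dest!: spec[of _ f])
  thus ?thesis using assms(2) by (simp add: Wt_def mult.assoc)
qed

lemma in_ball_amp:
  assumes "in_ball 8 Wt c h" "i < 4" "t \<in> ball 0 1"
  shows "norm (h (4 + i) 0 t) \<le> c * dt i"
  using assms unfolding in_ball_def Wt_def by (auto dest!: spec[of _ "4 + i"] bspec[of _ _ 0] bspec[of _ _ t])

lemma sum_amp_bound:
  fixes d :: "nat \<Rightarrow> complex"
  assumes "\<And>i. i < 4 \<Longrightarrow> norm (d i) \<le> c * dt i" "\<And>i. i < 4 \<Longrightarrow> norm (v i) \<le> b i"
  shows "norm (\<Sum>i<4. d i * v i) \<le> c * (\<Sum>i<4. dt i * b i)"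
proof -
  have "norm (\<Sum>i<4. d i * v i) \<le> (\<Sum>i<4. c * dt i * b i)"
    using assms by (intro sum_norm_le nb_mult) auto
  thus ?thesis by (simp add: sum_distrib_left mult.assoc)
qed

context
  fixes c :: real and h :: "nat \<Rightarrow> family" and x :: real and t :: complex
  assumes h: "\<And>i. i < 8 \<Longrightarrow> adm (par i) (h i)" and ball: "in_ball 8 Wt c h"
    and x: "x \<in> {-1..1}" and t: "t \<in> ball 0 1"
begin

lemma fam: "f < 4 \<Longrightarrow> hol_family (ball 0 1) (h f)"
  by (rule adm_hol_family[OF h]) auto

lemma prim2_bounds:
  assumes f: "f < 4"
  shows "norm (prim (prim (h f)) x t) \<le> c * wt f * (cosh (6 * x) / 36)"
    and "norm (prim (prim (h f)) x t) \<le> c * wt f * (203 / 36)"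
    and "norm (prim (h f) x t) \<le> c * wt f * (203 / 6)"
  using prim_prim_norm_bounds[OF fam[OF f] t in_ball_cosh[OF ball f _ t] x] by auto

lemma correction_bound:
  assumes f: "f < 4"
  shows "norm ((\<Sum>i<4. h (4 + i) 0 t * vv i f x t) + prim (prim (h f)) x t) \<le> c * yb f"
proof -
  have t': "norm t \<le> 1" using t by simp
  have c: "c \<ge> 0"
    using order_trans[OF norm_ge_zero in_ball_amp[OF ball _ t, of 0]] dt_pos[of 0] by (simp add: zero_le_mult_iff)
  have "norm ((\<Sum>i<4. h (4 + i) 0 t * vv i f x t) + prim (prim (h f)) x t)
      \<le> c * (\<Sum>i<4. dt i * vb i f) + c * wt f * (203 / 36)"
    by (intro nb_add sum_amp_bound in_ball_amp[OF ball _ t] v_bound[OF x t' _ f] prim2_bounds(2)[OF f])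
  also have "\<dots> = c * ((\<Sum>i<4. dt i * vb i f) + wt f * (203 / 36))"
    by (simp add: algebra_simps)
  also have "\<dots> \<le> c * yb f"
    using num_y[OF f] c by (rule mult_left_mono)
  finally show ?thesis .
qed

lemma amplitude_bound: "norm (\<Sum>i<4. h (4 + i) 0 t * av i t) \<le> c * 21900"
proof -
  have t': "norm t \<le> 1" using t by simp
  have c: "c \<ge> 0"
    using order_trans[OF norm_ge_zero in_ball_amp[OF ball _ t, of 0]] dt_pos[of 0] by (simp add: zero_le_mult_iff)
  have "norm (\<Sum>i<4. h (4 + i) 0 t * av i t) \<le> c * (\<Sum>i<4. dt i * ab i)"
    by (intro sum_amp_bound in_ball_amp[OF ball _ t] av_bound[OF x t'])
  also have "\<dots> \<le> c * 21900"
    using num_ya c by (rule mult_left_mono)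
  finally show ?thesis .
qed

lemma bK_bound:
  assumes k: "k < 4" and x1: "x = 1"
  shows "norm (bK h k t) \<le> c * (if k < 2 then wt (k + 2) * (203 / 36) else wt k * (203 / 6))"
  using prim2_bounds(2)[of "k + 2"] prim2_bounds(3)[of k] k x1 by (auto simp: bK_def mult.assoc)

end

lemma Uf_bounds:
  assumes h: "\<And>i. i < 8 \<Longrightarrow> adm (par i) (h i)" and ball: "in_ball 8 Wt rho h"
    and x: "x \<in> {-1..1}" and t: "t \<in> ball 0 1"
  shows "f < 4 \<Longrightarrow> norm (Uf h f x t - ulo f x t) \<le> zb f" "f < 4 \<Longrightarrow> norm (Uf h f x t) \<le> nb f"
    and "norm (Af h t - alo t) \<le> 33 / 1000"
proof -
  have t': "norm t \<le> 1" using t by simp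
  show z: "norm (Uf h f x t - ulo f x t) \<le> zb f" if f: "f < 4" for f
  proof -
    have "Uf h f x t - ulo f x t = (u0 f x t - ulo f x t)
        + ((\<Sum>i<4. h (4 + i) 0 t * vv i f x t) + prim (prim (h f)) x t)"
      by (simp add: Uf_def)
    also have "norm \<dots> \<le> epb f + rho * yb f"
      by (intro nb_add diff_bound[OF x t' f] correction_bound[OF h ball x t f])
    finally show ?thesis using num_z[OF f] by linarith
  qed
  show "norm (Uf h f x t) \<le> nb f" if f: "f < 4" for f
  proof -
    have "norm (ulo f x t + (Uf h f x t - ulo f x t)) \<le> nlob f + zb f"
      by (intro nb_add ulo_bound[OF x t' f] z f)
    thus ?thesis using num_nb[OF f] by simp
  qed
  \<comment> \<open>Here \<open>rho * 21900\<close> is \<open>0.03066\<close>, the main part of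
    \<open>33 / 1000\<close>.\<close>
  have "norm ((a0 t - alo t) + (\<Sum>i<4. h (4 + i) 0 t * av i t)) \<le> 2 / 1000 + rho * 21900"
    by (intro nb_add a_bounds(2)[OF x t'] amplitude_bound[OF h ball x t])
  thus "norm (Af h t - alo t) \<le> 33 / 1000"
    by (simp add: Af_def rho_def algebra_simps)
qed

lemma nb_nonneg_ulo: "x \<in> {-1..1} \<Longrightarrow> norm t \<le> 1 \<Longrightarrow> f < 4 \<Longrightarrow> norm (ulo f x t) \<le> nb f"
  using ulo_bound[of x t f] num_nb[of f] by (auto simp: less_4_iff zb_def)

lemma mu_bound: "norm t \<le> 1 \<Longrightarrow> norm (mu t) \<le> 67 / 16"
proof -
  assume t: "norm t \<le> 1"
  have "norm (33 + 34 * t) \<le> 33 + 34 * 1"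
    by (intro nb_add nb_mult nb_num t)
  thus ?thesis by (simp add: mu_def norm_divide)
qed

text \<open>In the differential equations, the difference of two images consists of amplitudes times
  linearised residuals, the linear part applied to double primitives, and the quadratic remainder.
  The second dominates, and it is the one that profits from the factor 36.\<close>

lemma Top_contraction:
  assumes h: "\<And>i. i < 8 \<Longrightarrow> adm (par i) (h i)" and k: "\<And>i. i < 8 \<Longrightarrow> adm (par i) (k i)"
    and hb: "in_ball 8 Wt rho h" and kb: "in_ball 8 Wt rho k" and c: "c \<ge> 0"
    and diff: "in_ball 8 Wt c (\<lambda>i x z. h i x z - k i x z)"
  shows "in_ball 8 Wt (93 / 100 * c) (\<lambda>i x z. Top h i x z - Top k i x z)"
  unfolding in_ball_def
proof (intro allI impI ballI)
  fix j :: nat and x t assume j: "j < 8" and x: "x \<in> {-1..1::real}" and t: "t \<in> ball (0::complex) 1"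
  have t': "norm t \<le> 1" using t by simp
  let ?e = "\<lambda>i x z. h i x z - k i x z"
  define \<delta> where "\<delta> i = h (4 + i) 0 t - k (4 + i) 0 t" for i
  have e: "adm (par i) (?e i)" if "i < 8" for i
    by (intro adm_diff h k that)
  note fh = adm_hol_family[OF h] and fk = adm_hol_family[OF k]
  have \<delta>: "norm (\<delta> i) \<le> c * dt i" if "i < 4" for i
    using in_ball_amp[OF diff that t] by (simp add: \<delta>_def)
  have K2: "prim (prim (?e f)) y t = prim (prim (h f)) y t - prim (prim (k f)) y t" if "f < 4" "y \<in> {-1..1}" for f y
    using that by (intro prim2_diff fh fk t) auto
  show "norm (Top h j x t - Top k j x t) \<le> 93 / 100 * c * Wt j x"
  proof (cases "j < 4")
    case True
    let ?u = "\<lambda>f. ulo f x t"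
    define \<kappa> where "\<kappa> f = prim (prim (h f)) x t - prim (prim (k f)) x t" for f
    have \<kappa>: "norm (\<kappa> f) \<le> c * (cosh (6 * x) / 36) * wt f" if "f < 4" for f
      using prim2_bounds(1)[OF e diff x t that] K2[OF that x] by (simp add: \<kappa>_def mult_ac)
    have dU: "Uf h f x t - Uf k f x t = (\<Sum>i<4. \<delta> i * vv i f x t) + \<kappa> f" for f
      by (simp add: Uf_def \<delta>_def \<kappa>_def sum_4 algebra_simps)
    have dA: "Af h t - Af k t = (\<Sum>i<4. \<delta> i * av i t)"
      by (simp add: Af_def \<delta>_def sum_4 algebra_simps)
    have dUb: "norm (Uf h f x t - Uf k f x t) \<le> c * yb f" if "f < 4" for f
      using correction_bound[OF e diff x t that] K2[OF that x] unfolding dU by (simp add: \<delta>_def \<kappa>_def)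
    have dAb: "norm (Af h t - Af k t) \<le> c * 21900"
      using amplitude_bound[OF e diff x t] unfolding dA by (simp add: \<delta>_def)
    let ?rem = "nl_rem j (alo t) ?u (Af h t) (\<lambda>f. Uf h f x t) (Af k t) (\<lambda>f. Uf k f x t)"
    have "Top h j x t - Top k j x t = - ((nl j (mu t) (Af h t) (\<lambda>f. Uf h f x t) - nl j (mu t) (Af k t) (\<lambda>f. Uf k f x t))
        + (\<Sum>i<4. \<delta> i * cpt_d2 j (LV i j) DV x t))"
      using True by (simp add: Top_def \<delta>_def sum_4 algebra_simps)
    also have "nl j (mu t) (Af h t) (\<lambda>f. Uf h f x t) - nl j (mu t) (Af k t) (\<lambda>f. Uf k f x t)
        = (\<Sum>i<4. \<delta> i * nl_lin j (mu t) (alo t) ?u (av i t) (\<lambda>f. vv i f x t))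
          + nl_lin j (mu t) (alo t) ?u 0 \<kappa> + ?rem"
      unfolding nl_diff[OF True, where A = "alo t" and u = ?u] dA dU nl_lin_add[OF True] nl_lin_sum[OF True] ..
    \<comment> \<open>The second derivatives of the variations are grouped with their linear terms:
      the smallness in \<open>lin_bound\<close> is the cancellation between the two.\<close>
    finally have "Top h j x t - Top k j x t = - ((\<Sum>i<4. \<delta> i * (cpt_d2 j (LV i j) DV x t
          + nl_lin j (mu t) (alo t) ?u (av i t) (\<lambda>f. vv i f x t)))
        + nl_lin j (mu t) (alo t) ?u 0 \<kappa> + ?rem)"
      by (simp add: sum_4 algebra_simps)
    hence "norm (Top h j x t - Top k j x t) = norm ((\<Sum>i<4. \<delta> i * (cpt_d2 j (LV i j) DV x t
          + nl_lin j (mu t) (alo t) ?u (av i t) (\<lambda>f. vv i f x t)))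
        + nl_lin j (mu t) (alo t) ?u 0 \<kappa> + ?rem)"
      by (simp only: norm_minus_cancel)
    also have "\<dots> \<le> c * (\<Sum>i<4. dt i * eib i j) + c * (cosh (6 * x) / 36) * (36 * (67 / 100) * wt j) + c * qb j"
    proof (intro nb_add sum_amp_bound \<delta>)
      show "norm (cpt_d2 j (LV i j) DV x t + nl_lin j (mu t) (alo t) ?u (av i t) (\<lambda>f. vv i f x t)) \<le> eib i j"
        if "i < 4" for i by (rule lin_bound[OF x t' that True])
      have A: "norm (alo t) \<le> 382" using a_bounds(1)[OF x t'] by simp
      show "norm (nl_lin j (mu t) (alo t) ?u 0 \<kappa>) \<le> c * (cosh (6 * x) / 36) * (36 * (67 / 100) * wt j)"
        by (rule nl_lin_bound[OF True mu_bound[OF t'] A nb_nonneg_ulo[OF x t'] \<kappa>])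
      show "norm ?rem \<le> c * qb j"
        by (rule nl_rem_bound[OF True A Uf_bounds(3)[OF k kb x t] dAb nb_nonneg_ulo[OF x t']
              Uf_bounds(2)[OF h hb x t] Uf_bounds(2)[OF k kb x t] Uf_bounds(1)[OF h hb x t]
              Uf_bounds(1)[OF k kb x t] dUb])
    qed
    also have "\<dots> = c * ((\<Sum>i<4. dt i * eib i j) + qb j) * 1 + c * (67 / 100 * wt j) * cosh (6 * x)"
      by (simp add: algebra_simps)
    \<comment> \<open>The unweighted terms are absorbed into the weighted bound by
      \<open>cosh \<ge> 1\<close>.\<close>
    also have "\<dots> \<le> c * ((\<Sum>i<4. dt i * eib i j) + qb j) * cosh (6 * x) + c * (67 / 100 * wt j) * cosh (6 * x)"
    proof (intro add_right_mono mult_left_mono mult_nonneg_nonneg c cosh_real_ge_1)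
      show "(\<Sum>i<4. dt i * eib i j) + qb j \<ge> 0"
        using True by (auto simp: less_4_iff sum_4 dt_def eib_def qb_def)
    qed
    also have "\<dots> = c * cosh (6 * x) * ((\<Sum>i<4. dt i * eib i j) + qb j + 67 / 100 * wt j)"
      by (simp add: algebra_simps)
    also have "\<dots> \<le> c * cosh (6 * x) * (93 / 100 * wt j)"
      using c cosh_real_nonneg[of "6 * x"] num_tot[OF True] by (intro mult_left_mono mult_nonneg_nonneg) auto
    finally show ?thesis using True by (simp add: Wt_def mult_ac)
  next
    case False
    define l where "l = j - 4"
    have l: "l < 4" using j False by (auto simp: l_def)
    have one: "(1::real) \<in> {-1..1}" by simp
    have "prim (?e l) 1 t = prim (h l) 1 t - prim (k l) 1 t"
      using l by (intro prim_diff[OF fh fk t]) auto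
    hence "bK ?e l t = bK h l t - bK k l t"
      using l K2[of "l + 2" 1] by (auto simp: bK_def)
    hence "Top h j x t - Top k j x t = - ((\<Sum>i<4. \<delta> i * (bdry l (LV i) DV t - (if i = l then 1 else 0))) + bK ?e l t)"
      using False by (simp add: Top_def \<delta>_def l_def sum_4 algebra_simps)
    hence "norm (Top h j x t - Top k j x t)
        = norm ((\<Sum>i<4. \<delta> i * (bdry l (LV i) DV t - (if i = l then 1 else 0))) + bK ?e l t)"
      by (simp only: norm_minus_cancel)
    also have "\<dots> \<le> c * (\<Sum>i<4. dt i * cb l i) + c * (if l < 2 then wt (l + 2) * (203 / 36) else wt l * (203 / 6))"
      by (intro nb_add sum_amp_bound \<delta> bdry_var_bound[OF t' l] bK_bound[OF e diff one t l refl])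
    also have "\<dots> \<le> c * (93 / 100 * dt l)"
      unfolding distrib_left[symmetric] using num_delta[OF l] c by (rule mult_left_mono)
    finally show ?thesis using False by (simp add: Wt_def l_def)
  qed
qed

text \<open>At the zero state \<open>Uf\<close> and \<open>Af\<close> are the approximate branch, so
  only its residuals and boundary defects remain.\<close>

lemma Top_zero: "in_ball 8 Wt ((1 - 93 / 100) * rho) (Top (\<lambda>i x z. 0))"
  unfolding in_ball_def
proof (intro allI impI ballI)
  fix j :: nat and x t assume j: "j < 8" and x: "x \<in> {-1..1::real}" and t: "t \<in> ball (0::complex) 1"
  have t': "norm t \<le> 1" using t by simp
  have p0: "prim (\<lambda>x z. 0) = (\<lambda>x z. 0)" by (simp add: prim_def[abs_def])
  show "norm (Top (\<lambda>i x z. 0) j x t) \<le> (1 - 93 / 100) * rho * Wt j x"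
  proof (cases "j < 4")
    case True
    have "norm (Top (\<lambda>i x z. 0) j x t)
        = norm (- (cpt_d2 j (LU j) DU x t + nl j (mu t) (a0 t) (\<lambda>i. u0 i x t)))"
      using True by (simp only: Top_def Af_def Uf_def p0) (simp add: add.commute)
    also have "\<dots> \<le> e0b j"
      using res_bound[OF x t' True] by (simp only: norm_minus_cancel)
    also have "\<dots> \<le> (1 - 93 / 100) * rho * wt j * 1"
      using num_0(1)[OF True] by simp
    also have "\<dots> \<le> (1 - 93 / 100) * rho * wt j * cosh (6 * x)"
      using wt_pos[OF True] by (intro mult_left_mono cosh_real_ge_1) (auto simp: rho_def)
    finally show ?thesis using True by (simp add: Wt_def)
  next
    case False
    have l: "j - 4 < 4" using j False by auto
    have "norm (Top (\<lambda>i x z. 0) j x t) = norm (bdry (j - 4) LU DU t)"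
      using False by (simp only: Top_def bK_def p0) simp
    also have "\<dots> \<le> (1 - 93 / 100) * rho * dt (j - 4)"
      by (rule order_trans[OF bdry_bound[OF t' l] num_0(2)[OF l]])
    finally show ?thesis using False by (simp add: Wt_def)
  qed
qed

text \<open>\<open>B\<close> is any finite bound for the weights; 23 and 890 are the largest values
  of \<open>wt\<close> and \<open>dt\<close>.\<close>

lemma solution_family:
  obtains h where "\<And>i. i < 8 \<Longrightarrow> adm (par i) (h i)" "in_ball 8 Wt rho h"
    "\<And>i x z. i < 8 \<Longrightarrow> x \<in> {-1..1} \<Longrightarrow> z \<in> ball 0 1 \<Longrightarrow> Top h i x z = h i x z"
proof (rule family_contraction[where T = Top and N = 8 and w = Wt and \<theta> = "93 / 100" and \<rho> = rho
        and \<sigma> = par and B = "23 * cosh 6 + 890"])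
  fix i :: nat and x :: real assume i: "i < 8" and x: "x \<in> {-1..1}"
  have "\<bar>6 * x\<bar> \<le> \<bar>6\<bar>" using x by auto
  hence "cosh (6 * x) \<le> cosh 6"
    by (metis cosh_real_abs cosh_real_nonneg_le_iff abs_ge_zero)
  moreover have "cosh (6 * x) \<ge> 1" by (rule cosh_real_ge_1)
  moreover have "i - 4 < 4" using i by auto
  ultimately show "Wt i x \<le> 23 * cosh 6 + 890" "0 \<le> Wt i x"
    by (auto simp: Wt_def less_4_iff wt_def dt_def)
qed (use adm_Top Top_zero Top_contraction that in \<open>auto simp: rho_def\<close>)

section \<open>The solution branch\<close>

lemma adm_cpt_d1: "f < 4 \<Longrightarrow> adm (- par f) (cpt_d1 f L D)"
proof -
  assume f: "f < 4"
  have x2: "adm 1 (\<lambda>x z. 2 * of_real (x\<^sup>2))"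
    using adm_mult[OF adm_of_real[of 2] adm_mult[OF adm_x adm_x refl] refl] by (simp add: power2_eq_square)
  have x1: "adm (- 1) (\<lambda>x z. 2 * of_real x)"
    using adm_mult[OF adm_of_real[of 2] adm_x, of "- 1"] by simp
  have d: "adm \<sigma> f \<Longrightarrow> adm \<sigma> (\<lambda>x z. f x z / of_real D)" for \<sigma> f
    using adm_mult[OF adm_of_real[of "1 / D"], of \<sigma> f \<sigma>] by simp
  have odd: "adm 1 (\<lambda>x t. (ev L (zt x) t + 2 * of_real (x\<^sup>2) * ev (bder L) (zt x) t) / of_real D)"
    by (intro d adm_add adm_ev adm_mult[OF x2 adm_ev]) simp
  have even: "adm (- 1) (\<lambda>x t. 2 * of_real x * ev (bder L) (zt x) t / of_real D)"
    by (intro d adm_mult[OF x1 adm_ev]) simp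
  show ?thesis
    using f odd even by (auto simp: cpt_d1_def[abs_def] par_def)
qed

text \<open>Reads the fixed point back: components 0 to 3 say that the second derivatives satisfy
  the equations, components 4 to 7 that the boundary values vanish. Weights and states do not occur
  any more.\<close>

lemma branch:
  obtains U U1 U2 :: "nat \<Rightarrow> family" and A :: "complex \<Rightarrow> complex"
  where "\<And>f. f < 4 \<Longrightarrow> adm (par f) (U f)" "\<And>f. f < 4 \<Longrightarrow> adm (- par f) (U1 f)" "\<And>f. f < 4 \<Longrightarrow> adm (par f) (U2 f)"
    "\<And>f. f < 4 \<Longrightarrow> x_deriv (ball 0 1) (U f) (U1 f)" "\<And>f. f < 4 \<Longrightarrow> x_deriv (ball 0 1) (U1 f) (U2 f)"
    "adm 1 (\<lambda>x. A)" "\<And>t. t \<in> ball 0 1 \<Longrightarrow> norm (A t - alo t) \<le> 33 / 1000"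
    "\<And>t. t \<in> ball 0 1 \<Longrightarrow> norm (U 1 1 t - ulo 1 1 t) \<le> 22 / 10 ^ 4"
    "\<And>f x t. f < 4 \<Longrightarrow> x \<in> {-1..1} \<Longrightarrow> t \<in> ball 0 1 \<Longrightarrow> U2 f x t = - nl f (mu t) (A t) (\<lambda>i. U i x t)"
    "\<And>t. t \<in> ball 0 1 \<Longrightarrow> U 2 1 t = 0 \<and> U 3 1 t = 0 \<and> U1 2 1 t = 0 \<and> U1 3 1 t = 0"
proof -
  from solution_family obtain h where h: "\<And>i. i < 8 \<Longrightarrow> adm (par i) (h i)" and hb: "in_ball 8 Wt rho h"
    and fp: "\<And>i x z. i < 8 \<Longrightarrow> x \<in> {-1..1} \<Longrightarrow> z \<in> ball 0 1 \<Longrightarrow> Top h i x z = h i x z" by blast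
  define U1 where "U1 f x t = cpt_d1 f (LU f) DU x t + (\<Sum>i<4. h (4 + i) 0 t * cpt_d1 f (LV i f) DV x t) + prim (h f) x t" for f x t
  define U2 where "U2 f x t = cpt_d2 f (LU f) DU x t + (\<Sum>i<4. h (4 + i) 0 t * cpt_d2 f (LV i f) DV x t) + h f x t" for f x t
  have one: "(1::real) \<in> {-1..1}" by simp
  have fam: "hol_family (ball 0 1) (h f)" if "f < 4" for f
    using that by (intro adm_hol_family[OF h]) auto
  have S: "((\<lambda>x. \<Sum>i<4. h (4 + i) 0 t * F i x t) has_vector_derivative (\<Sum>i<4. h (4 + i) 0 t * G i x t)) (at x within {-1..1})"
    if "\<And>i. ((\<lambda>x. F i x t) has_vector_derivative G i x t) (at x within {-1..1})" for F G t x
    by (intro has_vector_derivative_sum has_vector_derivative_mult_right that)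
  show ?thesis
  proof (rule that[of "Uf h" U1 U2 "Af h"])
    show "adm (par f) (Uf h f)" if "f < 4" for f by (rule adm_Uf[OF h that])
    show "adm (- par f) (U1 f)" if "f < 4" for f
      unfolding U1_def[abs_def] using that h
      by (intro adm_add adm_sum adm_scaled adm_amp adm_cpt_d1 adm_prim) auto
    show "adm (par f) (U2 f)" if "f < 4" for f
      unfolding U2_def[abs_def] cpt_d2_def using that h
      by (intro adm_add adm_sum adm_scaled adm_amp adm_cpt) auto
    show "x_deriv (ball 0 1) (Uf h f) (U1 f)" if "f < 4" for f
      unfolding x_deriv_def Uf_def U1_def
      by (intro ballI has_vector_derivative_add S cpt_derivs
          prim_has_vector_derivative[OF hol_family_prim(1)[OF open_ball fam[OF that]]])
    show "x_deriv (ball 0 1) (U1 f) (U2 f)" if "f < 4" for f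
      unfolding x_deriv_def U1_def U2_def
      by (intro ballI has_vector_derivative_add S cpt_derivs prim_has_vector_derivative[OF fam[OF that]])
    show "adm 1 (\<lambda>x. Af h)" by (rule adm_Af[OF h])
    fix t :: complex assume t: "t \<in> ball 0 1"
    show "norm (Af h t - alo t) \<le> 33 / 1000" by (rule Uf_bounds(3)[OF h hb one t])
    show "norm (Uf h 1 1 t - ulo 1 1 t) \<le> 22 / 10 ^ 4"
      using Uf_bounds(1)[OF h hb one t, of 1] by (simp add: zb_def)
    show "U2 f x t = - nl f (mu t) (Af h t) (\<lambda>i. Uf h i x t)" if "f < 4" "x \<in> {-1..1}" for f x
    proof -
      have "Top h f x t = h f x t" by (rule fp) (use that t in auto)
      hence "h f x t = - (nl f (mu t) (Af h t) (\<lambda>f. Uf h f x t) + cpt_d2 f (LU f) DU x t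
                       + (\<Sum>i<4. h (4 + i) 0 t * cpt_d2 f (LV i f) DV x t))"
        using that by (simp add: Top_def)
      thus ?thesis by (simp add: U2_def)
    qed
    \<comment> \<open>The Kronecker term in \<open>Top\<close> reproduces
      \<open>h (4 + k) 0 t\<close>, which cancels against the left-hand side of the fixed point
      equation and leaves the total boundary value.\<close>
    have bc: "bdry k LU DU t + (\<Sum>i<4. h (4 + i) 0 t * bdry k (LV i) DV t) + bK h k t = 0" if k: "k < 4" for k
    proof -
      have "Top h (4 + k) 0 t = h (4 + k) 0 t" by (rule fp) (use k t in auto)
      moreover have "Top h (4 + k) 0 t = - (bdry k LU DU t
              + (\<Sum>i<4. h (4 + i) 0 t * (bdry k (LV i) DV t - (if i = k then 1 else 0))) + bK h k t)"
        by (simp add: Top_def)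
      moreover have "(\<Sum>i<4. h (4 + i) 0 t * (bdry k (LV i) DV t - (if i = k then 1 else 0)))
          = (\<Sum>i<4. h (4 + i) 0 t * bdry k (LV i) DV t) - (\<Sum>i<4. h (4 + i) 0 t * (if i = k then 1 else 0))"
        by (simp add: right_diff_distrib sum_subtractf)
      moreover have "(\<Sum>i<4. h (4 + i) 0 t * (if i = k then 1 else 0)) = h (4 + k) 0 t"
        using k by (simp add: if_distrib[of "\<lambda>x. _ * x"] cong: if_cong)
      ultimately show ?thesis by (simp add: algebra_simps)
    qed
    have "Uf h 2 1 t = 0" "Uf h 3 1 t = 0"
      using bc[of 0] bc[of 1] by (simp_all add: bdry_def bK_def Uf_def del: add_2_eq_Suc add_2_eq_Suc' One_nat_def)
    moreover have "U1 2 1 t = 0" "U1 3 1 t = 0"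
      using bc[of 2] bc[of 3] by (simp_all add: bdry_def bK_def U1_def)
    ultimately show "Uf h 2 1 t = 0 \<and> Uf h 3 1 t = 0 \<and> U1 2 1 t = 0 \<and> U1 3 1 t = 0" by simp
  qed
qed

section \<open>From the parameter t back to omega\<close>

definition tpar :: "complex \<Rightarrow> complex" where "tpar w = (16 * w\<^sup>2 - 33) / 34"

lemma mu_tpar: "mu (tpar w) = w\<^sup>2"
  by (simp add: mu_def tpar_def field_simps)

text \<open>The value 0 goes to -33/34 and 2.03 to slightly less than 97/100, so the whole interval
  lands inside the open disc.\<close>

lemma tpar_real:
  fixes \<omega> :: real
  assumes "\<omega> \<in> {0..2.03}"
  obtains \<tau> where "tpar (of_real \<omega>) = of_real \<tau>" "-1 < \<tau>" "\<tau> \<le> 97 / 100"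
proof (rule that[of "(16 * \<omega>\<^sup>2 - 33) / 34"])
  have "\<omega>\<^sup>2 \<le> 2.03\<^sup>2" using assms by (intro power_mono) auto
  thus "(16 * \<omega>\<^sup>2 - 33) / 34 \<le> 97 / 100" by (simp add: power2_eq_square)
  have "- 1 < 16 * \<omega>\<^sup>2" by (rule less_le_trans[of _ 0]) auto
  thus "- 1 < (16 * \<omega>\<^sup>2 - 33) / 34" by (simp add: field_simps)
qed (simp add: tpar_def)

text \<open>The quadratic part is at least its value at 97/100, and the higher powers are at most 1.
  The margin 1 exceeds the distance \<open>33 / 1000\<close> between \<open>A\<close> and its
  approximation.\<close>

lemma alo_pos:
  assumes "-1 < \<tau>" "\<tau> \<le> 97 / 100"
  shows "Re (alo (of_real \<tau>)) > 1"
proof -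
  let ?P = "93008778 - 98539501 * \<tau> + 7384956 * \<tau>\<^sup>2 - (1069819 * \<tau> ^ 3 + 159215 * \<tau> ^ 4 + 26554 * \<tau> ^ 5 + 4421 * \<tau> ^ 6)"
  have "alo (of_real \<tau>) = of_real (?P / 2 ^ 19)"
    by (simp add: cpt_def om_def Ac_def DV_def algebra_simps power2_eq_square power_numeral_reduce)
  hence "Re (alo (of_real \<tau>)) = ?P / 2 ^ 19" by (simp only: Re_complex_of_real)
  moreover have "\<tau> ^ n \<le> 1" for n
  proof -
    have "\<bar>\<tau>\<bar> ^ n \<le> 1" by (rule power_le_one) (use assms in auto)
    thus ?thesis using abs_ge_self[of "\<tau> ^ n"] by (simp add: power_abs)
  qed
  from this[of 3] this[of 4] this[of 5] this[of 6]
  have "1069819 * \<tau> ^ 3 + 159215 * \<tau> ^ 4 + 26554 * \<tau> ^ 5 + 4421 * \<tau> ^ 6 \<le> 1260009"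
    by linarith
  \<comment> \<open>The product is the quadratic part minus its value at 97/100.\<close>
  moreover have "0 \<le> (\<tau> - 97 / 100) * (7384956 * (\<tau> + 97 / 100) - 98539501)"
    by (rule mult_nonpos_nonpos) (use assms in auto)
  ultimately show ?thesis
    by (simp add: field_simps power2_eq_square)
qed

lemma hol_family_compose:
  assumes "hol_family A h" "\<phi> holomorphic_on \<Omega>" "\<phi> ` \<Omega> \<subseteq> A"
  shows "hol_family \<Omega> (\<lambda>x z. h x (\<phi> z))"
  unfolding hol_family_def
proof (intro conjI ballI)
  have "continuous_on ({-1..1} \<times> \<Omega>) ((\<lambda>(x, z). h x z) \<circ> (\<lambda>p. (fst p, \<phi> (snd p))))"
    using assms
    by (intro continuous_on_compose continuous_intros continuous_on_compose2[OF holomorphic_on_imp_continuous_on[OF assms(2)]])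
       (auto simp: hol_family_def elim!: continuous_on_subset)
  thus "continuous_on ({-1..1} \<times> \<Omega>) (\<lambda>(x, z). h x (\<phi> z))"
    by (simp add: o_def case_prod_unfold)
  fix x :: real assume "x \<in> {-1..1}"
  thus "(\<lambda>z. h x (\<phi> z)) holomorphic_on \<Omega>"
    using holomorphic_on_compose_gen[OF assms(2) hol_family_holomorphic[OF assms(1)] assms(3)] by (simp add: o_def)
qed

lemma L2_norm_eq_integral:
  assumes "continuous_on {0..1} f"
  shows "L2_norm {0<..<1} f = sqrt (integral {0..1} (\<lambda>x. (norm (f x))\<^sup>2))"
proof -
  have "integrable (lebesgue_on {0<..<1}) (\<lambda>x. (cmod (f x))\<^sup>2)"
    by (intro integrable_unit_interval continuous_intros assms)
  hence "(\<integral>x. (cmod (f x))\<^sup>2 \<partial>lebesgue_on {0<..<1}) = integral {0<..<1} (\<lambda>x. (cmod (f x))\<^sup>2)"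
    by (intro lebesgue_integral_eq_integral) auto
  also have "\<dots> = integral {0..1} (\<lambda>x. (cmod (f x))\<^sup>2)"
    by (simp add: integral_open_interval_real)
  finally show ?thesis by (simp add: L2_norm_def)
qed

lemma H2_L2_norm_ge: "L2_norm S f \<le> H2_L2_norm S f g"
proof -
  have "L2_norm S f \<le> H2_norm S f"
    unfolding H2_norm_def by (rule real_le_rsqrt) auto
  also have "\<dots> \<le> H2_L2_norm S f g"
    unfolding H2_L2_norm_def by (rule real_le_rsqrt) auto
  finally show ?thesis .
qed

text \<open>The squared norm is continuous in the parameter and attains its minimum. The minimum is
  positive because a continuous function that is nonzero at one point, even an end point, has
  positive norm.\<close>

lemma L2_norm_pos_uniform:
  fixes f :: family
  assumes f: "hol_family \<Omega> f" and I: "of_real ` {a..b} \<subseteq> \<Omega>" "a \<le> b"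
    and nz: "\<And>\<omega>. \<omega> \<in> {a..b} \<Longrightarrow> f 1 (of_real \<omega>) \<noteq> 0"
  shows "\<exists>c>0. \<forall>\<omega>\<in>{a..b}. L2_norm {0<..<1} (\<lambda>x. f (2 * x - 1) (of_real \<omega>)) \<ge> c"
proof -
  define N where "N \<omega> = integral {0..1} (\<lambda>x. (norm (f (2 * x - 1) (of_real \<omega>)))\<^sup>2)" for \<omega> :: real
  have contx: "continuous_on {0..1} (\<lambda>x. f (2 * x - 1) (of_real \<omega>))" if "\<omega> \<in> {a..b}" for \<omega>
    using I that by (intro continuous_on_rescaled hol_family_continuous_x[OF f]) auto
  have "continuous_on ({a..b} \<times> cbox 0 1) ((\<lambda>(x, z). f x z) \<circ> (\<lambda>p. (2 * snd p - 1, of_real (fst p))))"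
    using f I by (intro continuous_on_compose continuous_intros) (auto simp: hol_family_def elim!: continuous_on_subset)
  hence "continuous_on ({a..b} \<times> cbox 0 1) (\<lambda>p. (norm (f (2 * snd p - 1) (of_real (fst p))))\<^sup>2)"
    by (intro continuous_intros) (simp add: o_def)
  hence "continuous_on {a..b} (\<lambda>\<omega>. integral (cbox 0 1) (\<lambda>x. (norm (f (2 * x - 1) (of_real \<omega>)))\<^sup>2))"
    by (intro integral_continuous_on_param) (simp add: case_prod_unfold)
  hence "continuous_on {a..b} N" by (simp add: N_def[abs_def])
  then obtain \<omega>0 where \<omega>0: "\<omega>0 \<in> {a..b}" "\<And>\<omega>. \<omega> \<in> {a..b} \<Longrightarrow> N \<omega>0 \<le> N \<omega>"
    using continuous_attains_inf[of "{a..b}" N] I(2) by auto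
  have "N \<omega>0 > 0"
  proof (rule ccontr)
    assume "\<not> N \<omega>0 > 0"
    moreover have "N \<omega>0 \<ge> 0" unfolding N_def by (rule integral_nonneg) (auto intro!: integrable_continuous_real continuous_intros contx \<omega>0)
    ultimately have "N \<omega>0 = 0" by simp
    moreover have c: "continuous_on {0..1} (\<lambda>x. (norm (f (2 * x - 1) (of_real \<omega>0)))\<^sup>2)"
      by (intro continuous_intros contx \<omega>0)
    ultimately have "((\<lambda>x. (norm (f (2 * x - 1) (of_real \<omega>0)))\<^sup>2) has_integral 0) (cbox 0 1)"
      unfolding N_def using integrable_integral[OF integrable_continuous_real[OF c]] by simp
    \<comment> \<open>A continuous nonnegative integrand with integral 0 vanishes on the closed
      interval, in particular at the right end.\<close>
    hence "(norm (f (2 * 1 - 1) (of_real \<omega>0)))\<^sup>2 = 0"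
      by (rule has_integral_0_cbox_imp_0[rotated 2]) (use c in auto)
    thus False using nz[OF \<omega>0(1)] by simp
  qed
  moreover have "L2_norm {0<..<1} (\<lambda>x. f (2 * x - 1) (of_real \<omega>)) = sqrt (N \<omega>)" if "\<omega> \<in> {a..b}" for \<omega>
    unfolding N_def by (rule L2_norm_eq_integral[OF contx[OF that]])
  ultimately show ?thesis
    using \<omega>0 by (intro exI[of _ "sqrt (N \<omega>0)"]) auto
qed

lemma q_end_nonzero:
  assumes "norm t \<le> 1"
  shows "norm (ulo 1 1 t) > 1"
proof -
  have "norm (ev Qc (1 / 2) t - 11010048) \<le> 1048576"
    using half_leD[OF q_half assms] by simp
  moreover have "norm (11010048 :: complex) \<le> norm (ev Qc (1 / 2) t) + norm (ev Qc (1 / 2) t - 11010048)"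
    by (rule norm_triangle_sub[of 11010048 "ev Qc (1 / 2) t", unfolded norm_minus_commute[of 11010048]])
  ultimately have "norm (ev Qc (1 / 2) t) \<ge> 9961472" by simp
  thus ?thesis
    by (simp add: cpt_def om_def zt_1 LO_def DV_def norm_divide del: One_nat_def)
qed

text \<open>For real data, the real part of the first equation and the imaginary part of the second
  carry a common factor \<open>a\<close>, which leaves only \<open>a^2\<close> in \<open>nl\<close>.
  The leading 4 comes from \<open>y = 2x - 1\<close>.\<close>

lemma system_identities:
  fixes a m p q r s :: real and u :: "nat \<Rightarrow> complex"
  assumes "u 0 = of_real p" "u 1 = of_real q" "u 2 = of_real r" "u 3 = of_real s"
  shows "4 * (of_real a * - nl 0 (of_real m) (of_real (a\<^sup>2)) u + \<i> * - nl 1 (of_real m) (of_real (a\<^sup>2)) u)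
           + of_real m * (of_real a * u 0 + \<i> * u 1)
         = - ((u 2 + \<i> * of_real a * u 3) * cnj (of_real a * u 0 + \<i> * u 1))"
    and "4 * (- nl 2 (of_real m) (of_real (a\<^sup>2)) u + \<i> * of_real a * - nl 3 (of_real m) (of_real (a\<^sup>2)) u)
           + 4 * of_real m * (u 2 + \<i> * of_real a * u 3)
         = - ((of_real a * u 0 + \<i> * u 1)\<^sup>2)"
  unfolding nl_def using assms
  by (simp_all add: complex_eq_iff algebra_simps power2_eq_square add_divide_distrib diff_divide_distrib del: One_nat_def)

lemma x_deriv_add: "x_deriv \<Omega> f f' \<Longrightarrow> x_deriv \<Omega> g g' \<Longrightarrow> x_deriv \<Omega> (\<lambda>x z. f x z + g x z) (\<lambda>x z. f' x z + g' x z)"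
  unfolding x_deriv_def by (intro ballI has_vector_derivative_add) auto

lemma x_deriv_mult_left: "x_deriv \<Omega> f f' \<Longrightarrow> x_deriv \<Omega> (\<lambda>x z. c z * f x z) (\<lambda>x z. c z * f' x z)"
  unfolding x_deriv_def by (intro ballI has_vector_derivative_mult_right) auto

lemma x_deriv_compose: "x_deriv A f f' \<Longrightarrow> \<phi> ` \<Omega> \<subseteq> A \<Longrightarrow> x_deriv \<Omega> (\<lambda>x z. f x (\<phi> z)) (\<lambda>x z. f' x (\<phi> z))"
  unfolding x_deriv_def by blast

theorem theorem1p2:
  "\<exists>u1 u2 :: real \<Rightarrow> real \<Rightarrow> complex.
     (\<forall>\<omega>\<in>{0..2.03}. solves_system \<omega> (u1 \<omega>) (u2 \<omega>) \<and>
        (\<exists>x\<in>{0<..<1}. (u1 \<omega> x, u2 \<omega> x) \<noteq> (0, 0))) \<and>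
     smooth_H2_L2 {0<..<1} {0..2.03} u1 u2 \<and>
     (\<exists>c>0. \<forall>\<omega>\<in>{0..2.03}. H2_L2_norm {0<..<1} (u1 \<omega>) (u2 \<omega>) \<ge> c) \<and>
     (\<forall>\<omega>\<in>{0..2.03}. \<forall>x\<in>{-1/2<..<1/2}.
        u1 \<omega> (1/2 + x) = cnj (u1 \<omega> (1/2 - x)) \<and>
        u2 \<omega> (1/2 + x) = cnj (u2 \<omega> (1/2 - x)))"
proof (rule branch)
  fix U U1 U2 :: "nat \<Rightarrow> family" and A :: "complex \<Rightarrow> complex"
  assume U: "\<And>f. f < 4 \<Longrightarrow> adm (par f) (U f)" and U1: "\<And>f. f < 4 \<Longrightarrow> adm (- par f) (U1 f)"
    and U2: "\<And>f. f < 4 \<Longrightarrow> adm (par f) (U2 f)"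
    and d1: "\<And>f. f < 4 \<Longrightarrow> x_deriv (ball 0 1) (U f) (U1 f)" and d2: "\<And>f. f < 4 \<Longrightarrow> x_deriv (ball 0 1) (U1 f) (U2 f)"
    and A: "adm 1 (\<lambda>x. A)" and Ab: "\<And>t. t \<in> ball 0 1 \<Longrightarrow> norm (A t - alo t) \<le> 33 / 1000"
    and qb: "\<And>t. t \<in> ball 0 1 \<Longrightarrow> norm (U 1 1 t - ulo 1 1 t) \<le> 22 / 10 ^ 4"
    and eq: "\<And>f x t. f < 4 \<Longrightarrow> x \<in> {-1..1} \<Longrightarrow> t \<in> ball 0 1 \<Longrightarrow> U2 f x t = - nl f (mu t) (A t) (\<lambda>i. U i x t)"
    and bc: "\<And>t. t \<in> ball 0 1 \<Longrightarrow> U 2 1 t = 0 \<and> U 3 1 t = 0 \<and> U1 2 1 t = 0 \<and> U1 3 1 t = 0"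
  have holA: "A holomorphic_on ball 0 1"
    using A by (auto simp: adm_def hol_family_def)
  have hol_tpar: "tpar holomorphic_on S" for S
    unfolding tpar_def[abs_def] by (intro holomorphic_intros) auto
  \<comment> \<open>Positive real part keeps \<open>A (tpar w)\<close> off the branch cut of
    \<open>csqrt\<close>.\<close>
  define \<Omega> where "\<Omega> = tpar -` ball 0 1 \<inter> (\<lambda>w. A (tpar w)) -` {z. Re z > 0}"
  have tpar_\<Omega>: "tpar ` \<Omega> \<subseteq> ball 0 1" by (auto simp: \<Omega>_def)
  have opD: "open (tpar -` ball 0 1)"
    by (rule open_vimage) (auto intro: holomorphic_on_imp_continuous_on hol_tpar)
  have holAt: "(\<lambda>w. A (tpar w)) holomorphic_on tpar -` ball 0 1"
    using holomorphic_on_compose_gen[OF hol_tpar holA, of "tpar -` ball 0 1"] by (auto simp: o_def)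
  have op\<Omega>: "open \<Omega>"
    unfolding \<Omega>_def
    by (rule continuous_open_preimage[OF holomorphic_on_imp_continuous_on[OF holAt] opD])
       (rule open_halfspace_Re_gt)
  define a where "a w = csqrt (A (tpar w))" for w
  have hola: "a holomorphic_on \<Omega>"
    unfolding a_def[abs_def]
    by (intro holomorphic_on_csqrt' holomorphic_on_subset[OF holAt])
       (auto simp: \<Omega>_def complex_nonpos_Reals_iff)
  define C1 where "C1 G x w = a w * G 0 x (tpar w) + \<i> * G 1 x (tpar w)"
    for G :: "nat \<Rightarrow> family" and x w
  define C2 where "C2 G x w = G 2 x (tpar w) + \<i> * a w * G 3 x (tpar w)"
    for G :: "nat \<Rightarrow> family" and x w
  have fam: "hol_family \<Omega> (C1 G)" "hol_family \<Omega> (C2 G)" if "\<And>f. f < 4 \<Longrightarrow> hol_family (ball 0 1) (G f)" for G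
  proof -
    have *: "hol_family \<Omega> (\<lambda>x w. G f x (tpar w))" if "f < 4" for f
      by (rule hol_family_compose[OF \<open>\<And>f. f < 4 \<Longrightarrow> hol_family (ball 0 1) (G f)\<close>[OF that] hol_tpar tpar_\<Omega>])
    have ia: "(\<lambda>w. \<i> * a w) holomorphic_on \<Omega>" by (intro holomorphic_intros hola)
    show "hol_family \<Omega> (C1 G)" "hol_family \<Omega> (C2 G)"
      unfolding C1_def[abs_def] C2_def[abs_def]
      by (intro hol_family_add hol_family_mult * hol_family_const hola ia holomorphic_intros; simp)+
  qed
  have xd: "x_deriv \<Omega> (C1 G) (C1 G')" "x_deriv \<Omega> (C2 G) (C2 G')"
    if "\<And>f. f < 4 \<Longrightarrow> x_deriv (ball 0 1) (G f) (G' f)" for G G'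
    unfolding C1_def[abs_def] C2_def[abs_def]
    by (intro x_deriv_add x_deriv_mult_left x_deriv_compose[OF _ tpar_\<Omega>] that; simp)+
  note famU = fam[of U, OF adm_hol_family[OF U]] and famU1 = fam[of U1, OF adm_hol_family[OF U1]]
    and famU2 = fam[of U2, OF adm_hol_family[OF U2]]
  note xdU = xd[of U U1, OF d1] and xdU1 = xd[of U1 U2, OF d2]
  have par: "par 0 = 1" "par 1 = - 1" "par 2 = 1" "par 3 = - 1" by (simp_all add: par_def)
  define u1 where "u1 \<omega> x = C1 U (2 * x - 1) (of_real \<omega>)" for \<omega> x :: real
  define u2 where "u2 \<omega> x = C2 U (2 * x - 1) (of_real \<omega>)" for \<omega> x :: real
  have real_point: "of_real \<omega> \<in> \<Omega> \<and> (\<exists>b. a (of_real \<omega>) = of_real b \<and> A (tpar (of_real \<omega>)) = of_real (b\<^sup>2))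
      \<and> tpar (of_real \<omega>) \<in> ball 0 1 \<and> tpar (of_real \<omega>) \<in> \<real>"
    if \<omega>: "\<omega> \<in> {0..2.03}" for \<omega> :: real
  proof -
    obtain \<tau> where \<tau>: "tpar (of_real \<omega>) = of_real \<tau>" "-1 < \<tau>" "\<tau> \<le> 97 / 100"
      by (rule tpar_real[OF \<omega>])
    have t: "of_real \<tau> \<in> ball (0::complex) 1" using \<tau> by (simp add: abs_less_iff)
    have "A (of_real \<tau>) \<in> \<real>"
      using A t by (auto simp: adm_def)
    then obtain r where r: "A (of_real \<tau>) = of_real r" by (auto simp: Reals_def)
    have "Re (alo (of_real \<tau>) - A (of_real \<tau>)) \<le> 33 / 1000"
      using Ab[OF t] complex_Re_le_cmod order_trans by (subst (asm) norm_minus_commute) blast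
    hence "Re (alo (of_real \<tau>)) - r \<le> 33 / 1000" unfolding r by simp
    hence r0: "r > 0" using alo_pos[OF \<tau>(2,3)] by linarith
    hence "of_real \<omega> \<in> \<Omega>" using t by (simp add: \<Omega>_def \<tau> r)
    moreover have "a (of_real \<omega>) = of_real (sqrt r)" using r0 by (simp add: a_def \<tau> r)
    moreover have "A (tpar (of_real \<omega>)) = of_real ((sqrt r)\<^sup>2)" using r0 by (simp add: \<tau> r)
    moreover have "tpar (of_real \<omega>) \<in> ball 0 1 \<and> tpar (of_real \<omega>) \<in> \<real>" using \<tau> t by simp
    ultimately show ?thesis by blast
  qed
  have sub: "of_real ` {0..2.03} \<subseteq> \<Omega>" using real_point by blast
  have smooth: "smooth_H2_L2 {0<..<1} {0..2.03} u1 u2"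
    unfolding u1_def[abs_def] u2_def[abs_def]
    by (rule smooth_hol_family[OF op\<Omega> sub famU(1) famU1(1) famU2(1) famU(2) xdU(1) xdU1(1)])
  have real_values: "\<exists>v. U f y (tpar (of_real \<omega>)) = of_real v" if "\<omega> \<in> {0..2.03}" "y \<in> {-1..1}" "f < 4" for \<omega> y f
    using U[OF that(3)] real_point[OF that(1)] that(2) unfolding adm_def by (meson Reals_cases)
  have parity: "U f (- y) (tpar (of_real \<omega>)) = of_real (par f) * U f y (tpar (of_real \<omega>))"
    if "\<omega> \<in> {0..2.03}" "y \<in> {-1..1}" "f < 4" for \<omega> y f
    using U[OF that(3)] real_point[OF that(1)] that(2) unfolding adm_def by blast
  have parity1: "U1 f (- y) (tpar (of_real \<omega>)) = of_real (- par f) * U1 f y (tpar (of_real \<omega>))"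
    if "\<omega> \<in> {0..2.03}" "y \<in> {-1..1}" "f < 4" for \<omega> y f
    using U1[OF that(3)] real_point[OF that(1)] that(2) unfolding adm_def by blast
  have solves: "solves_system \<omega> (u1 \<omega>) (u2 \<omega>)" if \<omega>: "\<omega> \<in> {0..2.03}" for \<omega>
    unfolding solves_system_def
  proof (intro exI conjI ballI)
    define w where "w = complex_of_real \<omega>"
    define t where "t = tpar w"
    have w: "w \<in> \<Omega>" and t: "t \<in> ball 0 1" using real_point[OF \<omega>] by (auto simp: w_def t_def)
    obtain b where b: "a w = of_real b" "A t = of_real (b\<^sup>2)" using real_point[OF \<omega>] by (auto simp: w_def t_def)
    have m: "mu t = of_real (\<omega>\<^sup>2)" by (simp add: t_def w_def mu_tpar)
    fix x :: real
    show "(u1 \<omega> has_vector_derivative 2 * C1 U1 (2 * x - 1) (of_real \<omega>)) (at x within {0..1})" if "x \<in> {0..1}"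
      unfolding u1_def[abs_def] by (rule x_deriv_rescaled_within[OF xdU(1) w[unfolded w_def] that])
    show "(u2 \<omega> has_vector_derivative 2 * C2 U1 (2 * x - 1) (of_real \<omega>)) (at x within {0..1})" if "x \<in> {0..1}"
      unfolding u2_def[abs_def] by (rule x_deriv_rescaled_within[OF xdU(2) w[unfolded w_def] that])
    show "continuous_on {0..1} (\<lambda>x. 2 * C1 U1 (2 * x - 1) (of_real \<omega>))"
      by (intro continuous_on_mult_left continuous_on_rescaled[OF hol_family_continuous_x[OF famU1(1) w[unfolded w_def]]])
    show "continuous_on {0..1} (\<lambda>x. 2 * C2 U1 (2 * x - 1) (of_real \<omega>))"
      by (intro continuous_on_mult_left continuous_on_rescaled[OF hol_family_continuous_x[OF famU1(2) w[unfolded w_def]]])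
    show "((\<lambda>x. 2 * C1 U1 (2 * x - 1) (of_real \<omega>)) has_vector_derivative 2 * (2 * C1 U2 (2 * x - 1) (of_real \<omega>))) (at x)"
      if "x \<in> {0<..<1}"
      by (rule has_vector_derivative_mult_right[OF x_deriv_rescaled[OF xdU1(1) w[unfolded w_def] that]])
    show "((\<lambda>x. 2 * C2 U1 (2 * x - 1) (of_real \<omega>)) has_vector_derivative 2 * (2 * C2 U2 (2 * x - 1) (of_real \<omega>))) (at x)"
      if "x \<in> {0<..<1}"
      by (rule has_vector_derivative_mult_right[OF x_deriv_rescaled[OF xdU1(2) w[unfolded w_def] that]])
    show "2 * (2 * C1 U2 (2 * x - 1) (of_real \<omega>)) + (of_real \<omega>)\<^sup>2 * u1 \<omega> x = - (u2 \<omega> x * cnj (u1 \<omega> x))"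
      "2 * (2 * C2 U2 (2 * x - 1) (of_real \<omega>)) + 4 * (of_real \<omega>)\<^sup>2 * u2 \<omega> x = - ((u1 \<omega> x)\<^sup>2)"
      if "x \<in> {0<..<1}"
    proof -
      define y where "y = 2 * x - 1"
      have y: "y \<in> {-1..1}" using that by (auto simp: y_def)
      obtain p q r s where v: "U 0 y t = of_real p" "U 1 y t = of_real q" "U 2 y t = of_real r" "U 3 y t = of_real s"
        using real_values[OF \<omega> y, of 0] real_values[OF \<omega> y, of 1] real_values[OF \<omega> y, of 2] real_values[OF \<omega> y, of 3]
        by (auto simp: t_def w_def)
      note I = system_identities[where u = "\<lambda>i. U i y t" and a = b and m = "\<omega>\<^sup>2", OF v, folded b m]
      have W: "U2 0 y t = - nl 0 (mu t) (A t) (\<lambda>i. U i y t)" "U2 1 y t = - nl 1 (mu t) (A t) (\<lambda>i. U i y t)"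
        "U2 2 y t = - nl 2 (mu t) (A t) (\<lambda>i. U i y t)" "U2 3 y t = - nl 3 (mu t) (A t) (\<lambda>i. U i y t)"
        by (rule eq[OF _ y t]; simp)+
      have C: "C1 G (2 * x - 1) (of_real \<omega>) = a w * G 0 y t + \<i> * G 1 y t"
        "C2 G (2 * x - 1) (of_real \<omega>) = G 2 y t + \<i> * a w * G 3 y t" for G
        by (simp_all add: C1_def C2_def w_def t_def y_def)
      have m': "(of_real \<omega>)\<^sup>2 = mu t" by (simp add: m)
      show "2 * (2 * C1 U2 (2 * x - 1) (of_real \<omega>)) + (of_real \<omega>)\<^sup>2 * u1 \<omega> x = - (u2 \<omega> x * cnj (u1 \<omega> x))"
        unfolding u1_def u2_def C m' W I(1)[symmetric] by simp
      show "2 * (2 * C2 U2 (2 * x - 1) (of_real \<omega>)) + 4 * (of_real \<omega>)\<^sup>2 * u2 \<omega> x = - ((u1 \<omega> x)\<^sup>2)"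
        unfolding u1_def u2_def C m' W using I(2) by simp
    qed
    show "u2 \<omega> x = 0" "2 * C2 U1 (2 * x - 1) (of_real \<omega>) = 0" if "x \<in> {0, 1}"
    proof -
      \<comment> \<open>The conditions were imposed at \<open>y = 1\<close> only; parity transports
        them to the left end.\<close>
      have "U 2 (- 1) t = 0" "U 3 (- 1) t = 0" "U1 2 (- 1) t = 0" "U1 3 (- 1) t = 0"
        using bc[OF t] parity[OF \<omega>, of 1 2] parity[OF \<omega>, of 1 3] parity1[OF \<omega>, of 1 2] parity1[OF \<omega>, of 1 3]
        by (simp_all add: t_def w_def)
      with bc[OF t] that show "u2 \<omega> x = 0" "2 * C2 U1 (2 * x - 1) (of_real \<omega>) = 0"
        by (auto simp: u2_def C2_def t_def w_def)
    qed
  qed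
  have end_nonzero: "C1 U 1 (of_real \<omega>) \<noteq> 0" if \<omega>: "\<omega> \<in> {0..2.03}" for \<omega>
  proof
    assume z: "C1 U 1 (of_real \<omega>) = 0"
    define t where "t = tpar (of_real \<omega>)"
    have t: "t \<in> ball 0 1" using real_point[OF \<omega>] by (simp add: t_def)
    obtain b p q where v: "a (of_real \<omega>) = of_real b" "U 0 1 t = of_real p" "U 1 1 t = of_real q"
      using real_point[OF \<omega>] real_values[OF \<omega>, of 1 0] real_values[OF \<omega>, of 1 1] by (auto simp: t_def)
    \<comment> \<open>For real parameters the root of \<open>A\<close> and \<open>p\<close> are
      real, so \<open>q\<close> is exactly the imaginary part and cannot be cancelled by the other
      term.\<close>
    have "Im (C1 U 1 (of_real \<omega>)) = q"
      using v by (simp add: C1_def t_def)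
    hence "U 1 1 t = 0" using z v by simp
    thus False using qb[OF t] q_end_nonzero[of t] t by simp
  qed
  obtain c where c: "c > 0" "\<And>\<omega>. \<omega> \<in> {0..2.03} \<Longrightarrow> L2_norm {0<..<1} (u1 \<omega>) \<ge> c"
    using L2_norm_pos_uniform[OF famU(1) sub _ end_nonzero] unfolding u1_def by auto
  have nontrivial: "\<exists>x\<in>{0<..<1}. (u1 \<omega> x, u2 \<omega> x) \<noteq> (0, 0)" if \<omega>: "\<omega> \<in> {0..2.03}" for \<omega>
  proof (rule ccontr)
    assume "\<not> ?thesis"
    hence "\<And>x. x \<in> {0<..<1} \<Longrightarrow> u1 \<omega> x = 0" by simp
    hence "(\<integral>x. (cmod (u1 \<omega> x))\<^sup>2 \<partial>lebesgue_on {0<..<1}) = 0"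
      by (intro integral_eq_zero_AE AE_I2) simp
    hence "L2_norm {0<..<1} (u1 \<omega>) = 0" by (simp add: L2_norm_def)
    thus False using c(1) c(2)[OF \<omega>] by simp
  qed
  have symmetric: "u1 \<omega> (1/2 + x) = cnj (u1 \<omega> (1/2 - x)) \<and> u2 \<omega> (1/2 + x) = cnj (u2 \<omega> (1/2 - x))"
    if \<omega>: "\<omega> \<in> {0..2.03}" and x: "x \<in> {-1/2<..<1/2}" for \<omega> x
  proof -
    define t where "t = tpar (of_real \<omega>)"
    have y: "2 * x \<in> {-1..1}" using x by auto
    obtain b where b: "a (of_real \<omega>) = of_real b" using real_point[OF \<omega>] by auto
    obtain p q r s where v: "U 0 (2 * x) t = of_real p" "U 1 (2 * x) t = of_real q"
        "U 2 (2 * x) t = of_real r" "U 3 (2 * x) t = of_real s"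
      using real_values[OF \<omega> y, of 0] real_values[OF \<omega> y, of 1] real_values[OF \<omega> y, of 2] real_values[OF \<omega> y, of 3]
      by (auto simp: t_def)
    \<comment> \<open>Reflection changes the sign of \<open>q\<close> and \<open>s\<close> only, and
      these make up the imaginary parts.\<close>
    have v': "U 0 (- (2 * x)) t = of_real p" "U 1 (- (2 * x)) t = - of_real q"
        "U 2 (- (2 * x)) t = of_real r" "U 3 (- (2 * x)) t = - of_real s"
      using parity[OF \<omega> y, of 0] parity[OF \<omega> y, of 1] parity[OF \<omega> y, of 2] parity[OF \<omega> y, of 3] v
      by (simp_all add: t_def par del: One_nat_def)
    have e: "2 * (1/2 + x) - 1 = 2 * x" "2 * (1/2 - x) - 1 = - (2 * x)" by simp_all
    show ?thesis
      unfolding u1_def u2_def C1_def C2_def e t_def[symmetric] b v v' by simp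
  qed
  show ?thesis
    using solves nontrivial smooth symmetric c order_trans[OF c(2) H2_L2_norm_ge]
    by (intro exI[of _ u1] exI[of _ u2]) blast
qed

end
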